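(* Let $k\ge1$ be a natural number and let $m$ be a natural number with $m>1$. For any real $\alpha,\beta>0$ satisfying $\alpha\beta=\pi^2$, \begin{align*} &(\alpha^k)^{m}\sum_{n=1}^{\infty}d_k(n)n^{2m-1}\Psi_{(2\alpha)^k,k}(n)-(-\beta^k)^{m}\sum_{n=1}^{\infty}d_k(n)n^{2m-1}\Psi_{(2\beta)^k,k}(n)\\ &=\frac{1}{(k-1)!}\frac{d^{k-1}}{ds^{k-1}}\left\{\zeta^k(1-2m+s)\zeta^k(s)\Gamma^k(s+1)\cos^{k-1}\left(\frac{\pi s}{2}\right)2^{-ks}\left(\alpha^{-k(s-m)}-(-1)^m\beta^{-k(s-m)}\right)\right\}\bigg|_{s=0}. \end{align*}
   Context: $\zeta$ is the (analytically continued) Riemann zeta function, $\Gamma$ the Gamma function, and $f^k(s)$ denotes $(f(s))^k$. $d_k(n)$ is the Piltz divisor function: the number of ordered $k$-tuples of positive integers with product $n$ (so $\sum_{n\ge1} d_k(n)n^{-s}=\zeta^k(s)$ for $\mathrm{Re}(s)>1$). For $\rho>0$, $x>0$ and a natural number $k$, $$\Psi_{\rho,k}(x):=\frac{\pi^{k/2-1}}{2^{k-1}}\sum_{j=1}^\infty d_k(j)\,G^{k+1,0}_{0,2k}\left(\begin{matrix}\text{---}\\ (0)_k,\tfrac12;(\tfrac12)_{k-1}\end{matrix}\ \bigg|\ \frac{\rho^2j^2x^2}{2^{2k}}\right),$$ where $(a)_r$ means the parameter $a$ repeated $r$ times and the Meijer $G$-function occurring here is, for $z>0$ and any $\mu<0$,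 $$G^{k+1,0}_{0,2k}\left(\begin{matrix}\text{---}\\ (0)_k,\tfrac12;(\tfrac12)_{k-1}\end{matrix}\ \bigg|\ z\right)=\frac{1}{2\pi i}\int_{\mu-i\infty}^{\mu+i\infty}\frac{\Gamma(-s)^k\,\Gamma(\tfrac12-s)}{\Gamma(\tfrac12+s)^{k-1}}\,z^s\,ds.$$ *)

theory Defs
  imports "HOL-Complex_Analysis.Complex_Analysis"
begin

text \<open>The Riemann zeta function, as the analytic continuation of its Dirichlet series to the plane
  punctured at 1. The value 0 at the pole is a convention that makes the description unique.\<close>

definition zeta :: "complex \<Rightarrow> complex" where
  "zeta = (THE f. f holomorphic_on (- {1}) \<and> f 1 = 0 \<and>
             (\<forall>s. Re s > 1 \<longrightarrow> (\<lambda>n. 1 / of_nat (Suc n) powr s) sums f s))"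

definition piltz :: "nat \<Rightarrow> nat \<Rightarrow> nat" where
  "piltz k n = card {xs :: nat list. length xs = k \<and> (\<forall>x\<in>set xs. x > 0) \<and> prod_list xs = n}"

text \<open>The Meijer function \<open>G\<close> of order \<open>(k+1,0;0,2k)\<close> with lower parameters
  0 (\<open>k\<close> times), 1/2; 1/2 (\<open>k-1\<close> times), as a Mellin--Barnes integral along
  the line \<open>Re s = \<mu>\<close>. The substitution \<open>s = \<mu> + i t\<close>, \<open>ds = i dt\<close>
  turns the prefactor \<open>1/(2\<pi>i)\<close> into \<open>1/(2\<pi>)\<close>. The integral is absolutely convergent
  and, for \<open>\<mu> < 0\<close>, independent of \<open>\<mu>\<close>. The convention that Gamma vanishes at its
  poles and \<open>x / 0 = 0\<close> give \<open>1 / Gamma\<close> its correct value 0 there.\<close>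

definition meijer_G :: "real \<Rightarrow> nat \<Rightarrow> real \<Rightarrow> complex" where
  "meijer_G \<mu> k z =
     1 / (2 * of_real pi) *
     (LINT t|lborel. (let s = Complex \<mu> t in
        Gamma (- s) ^ k * Gamma (1/2 - s) / Gamma (1/2 + s) ^ (k - 1) * of_real z powr s))"

definition Psi :: "real \<Rightarrow> real \<Rightarrow> nat \<Rightarrow> real \<Rightarrow> complex" where
  "Psi \<mu> \<rho> k x =
     of_real (pi powr (real k / 2 - 1) / 2 ^ (k - 1)) *
     (\<Sum>j. of_nat (piltz k (Suc j)) *
           meijer_G \<mu> k (\<rho>^2 * real (Suc j)^2 * x^2 / 2 ^ (2 * k)))"

end

theory Submission
  imports Defs "HOL-Probability.Sinc_Integral" "HOL-Real_Asymp.Real_Asymp"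
begin

text \<open>By the reflection and duplication formulas of Gamma, the Meijer function, multiplied by the
  constant in front of the series for \<open>\<Psi>\<close>, is the Mellin integral
  \<open>1/(2\<pi>i) \<integral> \<Gamma>(w)^k cos(\<pi>w/2)^(k-1) y^(-w) dw\<close> over a line \<open>Re w = c\<close>, where
  \<open>y = \<rho>jx\<close> (\<open>meijer_G_eq_mellin_integral\<close>). The integrand decays like
  \<open>exp (-\<pi>|Im w|/2)\<close> up to a power, so \<open>c\<close> may be any positive number. For \<open>c > 2m\<close> both sums
  can be carried out under the integral sign, and each produces a power of zeta. Hence
  \<open>\<gamma>^(km) \<Sum> d_k(n) n^(2m-1) \<Psi>(n)\<close> is the integral over \<open>Re w = c\<close> of
  \<open>\<Phi>_\<gamma>(w) = \<zeta>(1-2m+w)^k \<zeta>(w)^k \<Gamma>(w)^k cos(\<pi>w/2)^(k-1) 2^(-kw) \<gamma>^(-k(w-m))\<close>, divided by \<open>2\<pi>i\<close>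
  (\<open>Psi_series_sums\<close>).

  The functional equation of zeta, applied to both zeta factors, gives the symmetry
  \<open>\<Phi>_\<beta>(2m-w) = (-1)^m \<Phi>_\<alpha>(w)\<close> when \<open>\<alpha>\<beta> = \<pi>\<^sup>2\<close> (\<open>mellin_integrand_reflection\<close>). On the central line
  \<open>Re w = m\<close> it says that the integrals of \<open>\<Phi>_\<alpha>\<close> and \<open>(-1)^m \<Phi>_\<beta>\<close> agree, so they cancel in
  the difference asked for, and only the residues picked up between \<open>Re w = m\<close> and \<open>Re w = c\<close>
  remain. The only pole there is \<open>2m\<close>; the symmetry carries it to the pole of order \<open>k\<close> of
  \<open>\<Gamma>(w)^k\<close> at the origin, where the residue is the \<open>(k-1)\<close>-st derivative of the regular factor
  divided by \<open>(k-1)!\<close> (\<open>mellin_integrand_integral_shift\<close>).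

  This needs three facts about zeta: it continues to the plane punctured at 1, it satisfies the
  functional equation, and it grows at most polynomially in vertical strips. The Dirichlet series,
  written as a sum of errors of the trapezoid rule for \<open>u^(-s)\<close>, converges for \<open>Re s > -1\<close>
  and gives continuation and growth there. For real \<open>s\<close> between -1 and 0 the same errors, times
  \<open>\<Gamma>(s)\<close>, are the Mellin integrals of functions with sum \<open>coth(x/2)/2 - 1/x\<close>; expanding
  this sum in partial fractions and integrating term by term is the functional equation on a real interval
  (\<open>functional_equation_real\<close>), and the identity theorem extends it. Everything in that step is
  nonnegative, so the interchanges need no estimates. To the left of the strip the functional
  equation itself provides continuation and growth, given the decay of Gamma.\<close>

section \<open>Decay of Gamma in vertical strips\<close>

text \<open>In Gauss's product each factor \<open>(x + j) / |x + j + it|\<close> increases with \<open>x\<close>. This reduces bounds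
  for Gamma on a whole strip to a single vertical line with integer real part.\<close>

lemma norm_Gamma_ratio_mono:
  fixes a b t :: real
  assumes "0 < a" "a \<le> b"
  shows "norm (Gamma (Complex a t)) / Gamma a \<le> norm (Gamma (Complex b t)) / Gamma b"
proof -
  have *: "norm (Gamma_series (Complex x t) n) / Gamma_series x n
      = (\<Prod>j\<le>n. (x + real j) / norm (Complex x t + of_nat j))" if "x > 0" for x n
  proof -
    have "norm (exp (Complex x t * of_real (ln (real n)))) = exp (x * ln (real n))"
      by simp
    moreover have "pochhammer x (n+1) > 0" using that by (intro pochhammer_pos)
    ultimately show ?thesis
      unfolding Gamma_series_def norm_mult norm_divide
      by (simp add: pochhammer_prod atLeast0AtMost prod_dividef prod_norm field_simps lessThan_Suc_atMost atLeast0LessThan)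
  qed
  have lim: "(\<lambda>n. norm (Gamma_series (Complex x t) n) / Gamma_series x n)
      \<longlonglongrightarrow> norm (Gamma (Complex x t)) / Gamma x" if "x > 0" for x
    using Gamma_real_pos[OF that] by (intro tendsto_intros) auto
  show ?thesis
  proof (rule LIMSEQ_le[OF lim lim])
    have "(\<Prod>j\<le>n. (a + real j) / norm (Complex a t + of_nat j))
        \<le> (\<Prod>j\<le>n. (b + real j) / norm (Complex b t + of_nat j))" for n
    proof (intro prod_mono conjI)
      fix j
      define p q where "p = a + real j" and "q = b + real j"
      have pq: "0 < p" "p \<le> q" using assms by (auto simp: p_def q_def)
      have "p * sqrt (q\<^sup>2 + t\<^sup>2) \<le> q * sqrt (p\<^sup>2 + t\<^sup>2)"
      proof (rule power2_le_imp_le)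
        have "p\<^sup>2 * t\<^sup>2 \<le> q\<^sup>2 * t\<^sup>2" using pq by (intro mult_right_mono power_mono) auto
        then show "(p * sqrt (q\<^sup>2 + t\<^sup>2))\<^sup>2 \<le> (q * sqrt (p\<^sup>2 + t\<^sup>2))\<^sup>2"
          by (simp add: power_mult_distrib algebra_simps)
      qed (use pq in auto)
      moreover have "sqrt (p\<^sup>2 + t\<^sup>2) > 0" "sqrt (q\<^sup>2 + t\<^sup>2) > 0"
        using pq by (auto intro!: add_pos_nonneg)
      ultimately have "p / sqrt (p\<^sup>2 + t\<^sup>2) \<le> q / sqrt (q\<^sup>2 + t\<^sup>2)"
        by (simp add: field_simps)
      moreover have "norm (Complex a t + of_nat j) = sqrt (p\<^sup>2 + t\<^sup>2)"
        "norm (Complex b t + of_nat j) = sqrt (q\<^sup>2 + t\<^sup>2)"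
        by (simp_all add: cmod_def p_def q_def)
      ultimately show "(a + real j) / norm (Complex a t + of_nat j)
          \<le> (b + real j) / norm (Complex b t + of_nat j)"
        by (simp add: p_def q_def)
    qed (use assms in auto)
    then show "\<exists>N. \<forall>n\<ge>N. norm (Gamma_series (Complex a t) n) / Gamma_series a n
        \<le> norm (Gamma_series (Complex b t) n) / Gamma_series b n"
      using assms by (simp add: *)
  qed (use assms in auto)
qed

text \<open>The reflection formula gives \<open>|\<Gamma>(1 + it)|\<^sup>2 = \<pi>t / sinh (\<pi>t)\<close>, and \<open>x / sinh x \<le> (1 + 2x) exp (-x)\<close>.\<close>

lemma norm_Gamma_1_plus_it_le:
  "norm (Gamma (Complex 1 t)) \<le> (1 + 2 * pi * \<bar>t\<bar>) * exp (- pi * \<bar>t\<bar> / 2)"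
proof (cases "t = 0")
  case False
  define z where "z = Complex 0 t"
  have z: "Complex 1 t = z + 1" "1 - z = cnj (z + 1)" "z = \<i> * of_real t"
    by (simp_all add: z_def complex_eq_iff)
  have z0: "z \<notin> \<int>\<^sub>\<le>\<^sub>0" using False by (auto simp: z_def nonpos_Ints_def complex_eq_iff)
  \<comment> \<open>On the line \<open>Re = 1\<close> conjugation is \<open>z + 1 \<mapsto> 1 - z\<close>, so the reflection formula computes the squared modulus.\<close>
  have "norm (Gamma (z+1)) ^ 2 = norm (Gamma (z + 1) * Gamma (1 - z))"
    unfolding z(2) cnj_Gamma[symmetric] by (simp add: norm_mult power2_eq_square)
  also have "Gamma (z + 1) * Gamma (1 - z) = z * (of_real pi / sin (of_real pi * z))"
    using z0 Gamma_reflection_complex[of z] by (auto simp: Gamma_plus1 mult.assoc)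
  also have "norm \<dots> = pi * \<bar>t\<bar> / \<bar>sinh (pi * t)\<bar>"
  proof -
    have e: "sin (of_real pi * z) = \<i> * of_real (sinh (pi * t))"
      unfolding z(3) by (simp add: sin_exp_eq sinh_def exp_of_real[symmetric] field_simps flip: exp_minus)
    have "norm z = \<bar>t\<bar>" by (simp add: z_def cmod_def)
    then show ?thesis unfolding norm_mult norm_divide e by simp
  qed
  also have "\<dots> \<le> (1 + 2 * pi * \<bar>t\<bar>) * exp (- pi * \<bar>t\<bar>)"
  proof -
    define x where "x = pi * \<bar>t\<bar>"
    have x: "x > 0" using False by (simp add: x_def)
    have "\<bar>sinh (pi * t)\<bar> = sinh x"
      using False by (cases "t > 0") (auto simp: x_def mult_less_0_iff abs_if)
    moreover have "x / sinh x \<le> (1 + 2 * x) * exp (- x)"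
    proof -
      have "2 * x * 1 \<le> (1 + 2 * x) * (1 - exp (- 2 * x))"
      proof -
        have "(1 + 2 * x) * exp (- 2 * x) \<le> exp (2*x) * exp (- 2 * x)"
          by (intro mult_right_mono exp_ge_add_one_self) auto
        then show ?thesis by (simp add: algebra_simps flip: exp_add)
      qed
      then have "x \<le> (1 + 2 * x) * exp (- x) * sinh x"
        by (simp add: sinh_def algebra_simps flip: exp_add)
      moreover have "sinh x > 0" using x by simp
      ultimately show ?thesis by (simp add: field_simps)
    qed
    ultimately show ?thesis by (simp add: x_def mult.assoc)
  qed
  also have "\<dots> \<le> (1 + 2 * pi * \<bar>t\<bar>)\<^sup>2 * exp (- pi * \<bar>t\<bar>)"
    by (intro mult_right_mono self_le_power) auto
  also have "\<dots> = ((1 + 2 * pi * \<bar>t\<bar>) * exp (- pi * \<bar>t\<bar> / 2))\<^sup>2"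
    by (simp add: power_mult_distrib exp_double[symmetric] flip: exp_add)
  finally show ?thesis unfolding z(1) by (rule power2_le_imp_le) auto
qed (simp add: complex_eq_iff flip: one_complex.code)

text \<open>The exponent \<open>-\<pi>|t|/2\<close> is sharp, and it has to be: the \<open>k-1\<close> cosines in the final integrand
  each grow like \<open>exp (\<pi>|t|/2)\<close> and must be beaten by \<open>k\<close> Gamma factors.\<close>

lemma norm_Gamma_strip_le:
  fixes a b :: real
  assumes "0 < a"
  shows "\<exists>C N. C > 0 \<and> (\<forall>x t. a \<le> x \<longrightarrow> x \<le> b \<longrightarrow>
    norm (Gamma (Complex x t)) \<le> C * (1 + \<bar>t\<bar>) ^ N * exp (- pi * \<bar>t\<bar> / 2))"
proof -
  define N where "N = nat \<lceil>b\<rceil>"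
  have N: "b \<le> real (Suc N)" unfolding N_def by linarith
  have bound: "norm (Gamma (Complex (real (Suc n)) t)) \<le> fact n * (1 + \<bar>t\<bar>) ^ n * norm (Gamma (Complex 1 t))" for n t
  proof (induction n)
    case (Suc n)
    have "Complex (real (Suc (Suc n))) t = Complex (real (Suc n)) t + 1" by (simp add: complex_eq_iff)
    moreover have "Complex (real (Suc n)) t \<notin> \<int>\<^sub>\<le>\<^sub>0" by (auto simp: nonpos_Ints_def complex_eq_iff)
    ultimately have "norm (Gamma (Complex (real (Suc (Suc n))) t))
        = norm (Complex (real (Suc n)) t) * norm (Gamma (Complex (real (Suc n)) t))"
      using Gamma_plus1[of "Complex (real (Suc n)) t"] by (metis norm_mult zero_in_nonpos_Ints)
    also have "norm (Complex (real (Suc n)) t) \<le> real (Suc n) + \<bar>t\<bar>"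
      using cmod_le[of "Complex (real (Suc n)) t"] by simp
    also have "real (Suc n) + \<bar>t\<bar> \<le> real (Suc n) * (1 + \<bar>t\<bar>)" by (simp add: algebra_simps)
    also note Suc
    finally show ?case by (simp add: mult_right_mono mult_left_mono mult_ac)
  qed simp
  have "compact (Gamma ` {a..b})"
    using assms by (intro compact_continuous_image continuous_intros) (auto simp: nonpos_Ints_def)
  then obtain B where B: "\<And>x. x \<in> {a..b} \<Longrightarrow> norm (Gamma x) \<le> B"
    using compact_imp_bounded bounded_iff by (metis image_eqI)
  define C where "C = (\<bar>B\<bar> + 1) / Gamma (real (Suc N)) * (fact N * (1 + 2 * pi))"
  have G: "Gamma (real (Suc N)) > 0" by (rule Gamma_real_pos) auto
  show ?thesis
  proof (intro exI[of _ C] exI[of _ "N + 1"] conjI allI impI)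
    have "\<bar>B\<bar> + 1 > 0" "1 + 2 * pi > 0" using pi_gt_zero by linarith+
    then show "C > 0" unfolding C_def using G by (intro mult_pos_pos divide_pos_pos) auto
    fix x t assume x: "a \<le> x" "x \<le> b"
    have Gx: "Gamma x > 0" "Gamma x \<le> \<bar>B\<bar> + 1" using x assms B[of x] by (auto intro!: Gamma_real_pos)
    have "norm (Gamma (Complex x t)) / Gamma x \<le> norm (Gamma (Complex (real (Suc N)) t)) / Gamma (real (Suc N))"
      using x N assms by (intro norm_Gamma_ratio_mono) auto
    then have "norm (Gamma (Complex x t)) \<le> Gamma x / Gamma (real (Suc N)) * norm (Gamma (Complex (real (Suc N)) t))"
      using Gx by (simp add: field_simps)
    also have "\<dots> \<le> (\<bar>B\<bar> + 1) / Gamma (real (Suc N)) * (fact N * (1 + \<bar>t\<bar>) ^ N * norm (Gamma (Complex 1 t)))"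
      using Gx G bound by (intro mult_mono divide_right_mono) auto
    also have "norm (Gamma (Complex 1 t)) \<le> (1 + 2 * pi) * (1 + \<bar>t\<bar>) * exp (- pi * \<bar>t\<bar> / 2)"
      by (rule order_trans[OF norm_Gamma_1_plus_it_le]) (auto simp: algebra_simps)
    finally show "norm (Gamma (Complex x t)) \<le> C * (1 + \<bar>t\<bar>) ^ (N + 1) * exp (- pi * \<bar>t\<bar> / 2)"
      using G by (simp add: C_def mult_left_mono mult_right_mono mult_ac divide_right_mono)
  qed
qed

lemma norm_cos_half_pi_le: "norm (cos (of_real pi * Complex x t / 2)) \<le> exp (pi * \<bar>t\<bar> / 2)"
proof -
  have "norm (exp (\<i> * (of_real pi * Complex x t / 2))) = exp (- (pi * t / 2))" 
    "norm (exp (- (\<i> * (of_real pi * Complex x t / 2)))) = exp (pi * t / 2)" by auto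
  then have "norm (cos (of_real pi * Complex x t / 2)) \<le> (exp (- (pi * t / 2)) + exp (pi * t / 2)) / 2"
    unfolding cos_exp_eq by (metis divide_right_mono norm_divide norm_numeral norm_triangle_ineq zero_le_numeral)
  also have "\<dots> \<le> exp (pi * \<bar>t\<bar> / 2)"
    using exp_le_cancel_iff[of "- (pi * \<bar>t\<bar> / 2)" "pi * \<bar>t\<bar> / 2"] by (cases "t \<ge> 0") (auto simp: mult_le_0_iff)
  finally show ?thesis .
qed

section \<open>Zeta to the right of -1 by the trapezoid rule\<close>

text \<open>The error of the trapezoid rule on a unit interval with Peano's kernel \<open>v(1-v)/2\<close>, for a function
  \<open>f\<close> with antiderivative \<open>F\<close>. It is used for \<open>u^(-s)\<close>, complex and real, and for \<open>exp (-xu)\<close>.\<close>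

lemma trapezoid_rule_has_integral:
  fixes F f f1 f2 :: "real \<Rightarrow> 'a :: banach"
  assumes "\<And>u. u \<in> {a..a+1} \<Longrightarrow> (F has_vector_derivative f u) (at u)"
    "\<And>u. u \<in> {a..a+1} \<Longrightarrow> (f has_vector_derivative f1 u) (at u)"
    "\<And>u. u \<in> {a..a+1} \<Longrightarrow> (f1 has_vector_derivative f2 u) (at u)"
  shows "((\<lambda>v. (v * (1 - v) / 2) *\<^sub>R f2 (a + v)) has_integral
     ((1/2) *\<^sub>R (f a + f (a + 1)) - (F (a + 1) - F a))) {0..1}"
proof -
  \<comment> \<open>An antiderivative of the kernel times \<open>f2\<close>, found by integrating by parts twice.\<close>
  define A where "A v = (v * (1 - v) / 2) *\<^sub>R f1 (a + v) - ((1 - 2 * v) / 2) *\<^sub>R f (a + v) - F (a + v)" for v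
  have shift: "((\<lambda>v. g (a + v)) has_vector_derivative g' (a + v)) (at v within {0..1})"
    if "\<And>u. u \<in> {a..a+1} \<Longrightarrow> (g has_vector_derivative g' u) (at u)" "v \<in> {0..1}" for g g' :: "real \<Rightarrow> 'a" and v
  proof -
    have "((g \<circ> (\<lambda>v. a + v)) has_vector_derivative (1 *\<^sub>R g' (a + v))) (at v within {0..1})"
    proof (rule vector_diff_chain_within)
      show "((\<lambda>v. a + v) has_vector_derivative 1) (at v within {0..1})"
        using has_vector_derivative_add[OF has_vector_derivative_const[of a "at v within {0..1}"]
            has_vector_derivative_id[of "at v within {0..1}"]]
        by simp
      show "(g has_vector_derivative g' (a + v)) (at (a + v) within (+) a ` {0..1})"
        by (rule has_vector_derivative_at_within, rule that(1)) (use that(2) in simp)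
    qed
    then show ?thesis by (simp add: o_def)
  qed
  have "((\<lambda>v. (v * (1 - v) / 2) *\<^sub>R f2 (a + v)) has_integral (A 1 - A 0)) {0..1}"
  proof (rule fundamental_theorem_of_calculus)
    fix v :: real assume v: "v \<in> {0..1}"
    have 1: "((\<lambda>v. v * (1 - v) / 2) has_field_derivative ((1 - 2 * v) / 2)) (at v within {0..1})"
      by (auto intro!: derivative_eq_intros simp: field_simps)
    have 2: "((\<lambda>v. (1 - 2 * v) / 2) has_field_derivative -1) (at v within {0..1})"
      by (auto intro!: derivative_eq_intros)
    have "(A has_vector_derivative
       (((v * (1 - v) / 2) *\<^sub>R f2 (a + v) + ((1 - 2 * v) / 2) *\<^sub>R f1 (a + v))
        - (((1 - 2 * v) / 2) *\<^sub>R f1 (a + v) + (-1) *\<^sub>R f (a + v)) - f (a + v))) (at v within {0..1})"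
      unfolding A_def
      by (intro has_vector_derivative_diff has_vector_derivative_scaleR 1 2
          shift[of F f, OF assms(1) v] shift[of f f1, OF assms(2) v] shift[of f1 f2, OF assms(3) v])
    then show "(A has_vector_derivative (v * (1 - v) / 2) *\<^sub>R f2 (a + v)) (at v within {0..1})"
      by simp
  qed auto
  also have "A 1 - A 0 = (1/2) *\<^sub>R (f a + f (a + 1)) - (F (a + 1) - F a)"
    by (simp add: A_def algebra_simps)
  finally show ?thesis .
qed

text \<open>The trapezoid error for \<open>u^(-s)\<close> on \<open>[n, n+1]\<close>. As \<open>0 powr z = 0\<close>, the term for
  \<open>n = 0\<close> is \<open>1/2 + 1/(s-1)\<close>, so the sum over all \<open>n\<close> needs no separate main terms.\<close>

definition trapezoid_error :: "nat \<Rightarrow> complex \<Rightarrow> complex" where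
  "trapezoid_error n s = (of_nat n powr (-s) + of_nat (Suc n) powr (-s)) / 2
     - (of_nat (Suc n) powr (1 - s) - of_nat n powr (1 - s)) / (1 - s)"

lemma has_vector_derivative_of_real_powr:
  assumes "u > 0"
  shows "((\<lambda>u. complex_of_real u powr s) has_vector_derivative (s * of_real u powr (s - 1))) (at u)"
proof (rule has_vector_derivative_real_field)
  show "((\<lambda>z. z powr s) has_field_derivative s * of_real u powr (s - 1)) (at (of_real u))"
    using assms by (intro has_field_derivative_powr) auto
qed

lemma trapezoid_error_has_integral:
  assumes "n > 0" "s \<noteq> 1"
  shows "((\<lambda>v. of_real (v * (1 - v) / 2) * (s * (s + 1) * of_real (real n + v) powr (-s-2)))
     has_integral trapezoid_error n s) {0..1}"
proof -
  have "((\<lambda>v. (v * (1 - v) / 2) *\<^sub>R (s * (s + 1) * of_real (real n + v) powr (-s-2))) has_integral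
     ((1/2) *\<^sub>R (of_real (real n) powr (-s) + of_real (real n + 1) powr (-s)) 
       - (of_real (real n + 1) powr (1-s) / (1-s) - of_real (real n) powr (1-s) / (1-s)))) {0..1}"
  proof (rule trapezoid_rule_has_integral[where ?f1.0 = "\<lambda>u. (-s) * of_real u powr (-s-1)"])
    fix u assume "u \<in> {real n..real n + 1}"
    then have u: "u > 0" using assms by auto
    note d = has_vector_derivative_of_real_powr[OF u]
    show "((\<lambda>u. of_real u powr (1-s) / (1-s)) has_vector_derivative of_real u powr (-s)) (at u)"
      using has_vector_derivative_divide[OF d[of "1-s"], of "1-s"] assms by simp
    show "((\<lambda>u. of_real u powr (-s)) has_vector_derivative (-s) * of_real u powr (-s-1)) (at u)"
      by (rule d)
    show "((\<lambda>u. (-s) * of_real u powr (-s-1)) has_vector_derivative s * (s + 1) * of_real u powr (-s-2)) (at u)"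
      using has_vector_derivative_mult_right[OF d[of "-s-1"], of "-s"] by (simp add: algebra_simps)
  qed
  moreover have "complex_of_real (real n + 1) = of_nat (Suc n)" "complex_of_real (real n) = of_nat n"
    by simp_all
  moreover have "(1/2) *\<^sub>R (x + y) = (x + y) / 2" "(v * (1 - v) / 2) *\<^sub>R x = of_real (v * (1 - v) / 2) * x" for x y :: complex and v
    by (simp_all only: scaleR_conv_of_real) simp
  ultimately show ?thesis
    unfolding trapezoid_error_def diff_divide_distrib by (simp only:)
qed

text \<open>The gain of two powers of \<open>n\<close> over the Dirichlet series is what moves the abscissa of convergence
  from 1 to -1.\<close>

lemma norm_trapezoid_error_le:
  assumes "n > 0" "s \<noteq> 1" "Re s > -2"
  shows "norm (trapezoid_error n s) \<le> norm s * norm (s + 1) * real n powr (- Re s - 2)"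
proof -
  have "norm (trapezoid_error n s) \<le> norm s * norm (s + 1) * real n powr (- Re s - 2) * Henstock_Kurzweil_Integration.content (cbox 0 (1::real))"
  proof (rule has_integral_bound)
    show "((\<lambda>v. of_real (v * (1 - v) / 2) * (s * (s + 1) * of_real (real n + v) powr (-s-2)))
     has_integral trapezoid_error n s) (cbox 0 1)"
      using trapezoid_error_has_integral[OF assms(1,2)] by simp
    fix v :: real assume v: "v \<in> cbox 0 1"
    have "norm (of_real (v * (1 - v) / 2) * (s * (s + 1) * of_real (real n + v) powr (-s-2)))
      = v * (1 - v) / 2 * (norm s * norm (s + 1) * (real n + v) powr (-Re s-2))"
    proof -
      have "norm (complex_of_real (real n + v) powr (-s-2)) = (real n + v) powr (-Re s-2)"
        using v by (subst norm_powr_real_powr) (auto simp del: of_real_add)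
      moreover have "norm (complex_of_real (v * (1 - v) / 2)) = v * (1 - v) / 2"
        unfolding norm_of_real using v by simp
      ultimately show ?thesis by (simp only: norm_mult)
    qed
    also have "\<dots> \<le> 1 * (norm s * norm (s + 1) * real n powr (-Re s-2))"
    proof (rule mult_mono)
      have "v * (1 - v) \<le> 1 * 1" using v by (intro mult_mono) auto
      then show "v * (1 - v) / 2 \<le> 1" by simp
      show "norm s * norm (s + 1) * (real n + v) powr (-Re s-2) \<le> norm s * norm (s + 1) * real n powr (-Re s-2)"
        using assms v by (intro mult_left_mono powr_mono2') auto
    qed (use v in auto)
    finally show "norm (of_real (v * (1 - v) / 2) * (s * (s + 1) * of_real (real n + v) powr (-s-2)))
      \<le> norm s * norm (s + 1) * real n powr (- Re s - 2)" by simp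
  qed auto
  then show ?thesis by simp
qed

lemma summable_trapezoid_error:
  assumes "s \<noteq> 1" "Re s > -1"
  shows "summable (\<lambda>n. trapezoid_error n s)"
proof (rule summable_comparison_test_ev)
  show "\<forall>\<^sub>F n in sequentially. norm (trapezoid_error n s) \<le> norm s * norm (s + 1) * real n powr (- Re s - 2)"
    using eventually_gt_at_top[of 0] by eventually_elim (rule norm_trapezoid_error_le, use assms in auto)
  show "summable (\<lambda>n. norm s * norm (s + 1) * real n powr (- Re s - 2))"
    by (intro summable_mult iffD2[OF summable_real_powr_iff]) (use assms(2) in linarith)
qed

text \<open>Zeta on the half-plane \<open>Re s > -1\<close> punctured at 1.\<close>

definition right_zeta :: "complex \<Rightarrow> complex" where
  "right_zeta s = (\<Sum>n. trapezoid_error n s)"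

lemma right_zeta_holomorphic: "right_zeta holomorphic_on ({s. Re s > -1} - {1})"
proof (rule holomorphic_uniform_sequence)
  show op: "open ({s. Re s > -1} - {1})" by (intro open_Diff open_halfspace_Re_gt) auto
  fix N :: nat
  have "(\<lambda>s. trapezoid_error n s) holomorphic_on ({s. Re s > -1} - {1})" for n
    unfolding trapezoid_error_def by (cases "n = 0") (auto intro!: holomorphic_intros)
  then show "(\<lambda>s. \<Sum>n<N. trapezoid_error n s) holomorphic_on ({s. Re s > -1} - {1})"
    by (intro holomorphic_intros)
  fix z assume z: "z \<in> {s. Re s > -1} - {1::complex}"
  obtain r where r: "r > 0" "cball z r \<subseteq> {s. Re s > -1} - {1}"
    using op z by (meson open_contains_cball)
  define R where "R = norm z + r"
  have R: "R \<ge> 0" using r by (simp add: R_def)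
  have "uniform_limit (cball z r) (\<lambda>N s. \<Sum>n<N. trapezoid_error n s) right_zeta sequentially"
    unfolding right_zeta_def
  proof (rule Weierstrass_m_test_ev)
    have s: "norm s \<le> R \<and> norm (s + 1) \<le> R + 1 \<and> s \<noteq> 1 \<and> Re s > -1 \<and> Re s \<ge> Re z - r" if "s \<in> cball z r" for s
    proof -
      have "norm (s - z) \<le> r" using that by (simp add: dist_norm norm_minus_commute)
      then show ?thesis
        using norm_triangle_ineq2[of s z] norm_triangle_ineq[of s 1] that r(2) abs_Re_le_cmod[of "s - z"] 
        by (auto simp: R_def)
    qed
    have zr: "Re z - r > -1"
      using s[of "z - of_real r"] r by (auto simp: dist_norm)
    show "\<forall>\<^sub>F n in sequentially. \<forall>s\<in>cball z r. norm (trapezoid_error n s) \<le> R * (R + 1) * real n powr (- (Re z - r) - 2)"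
      using eventually_gt_at_top[of 0]
    proof eventually_elim
      case (elim n)
      show ?case
      proof
        fix s assume "s \<in> cball z r"
        note s = s[OF this]
        have "norm (trapezoid_error n s) \<le> norm s * norm (s + 1) * real n powr (- Re s - 2)"
          using s elim by (intro norm_trapezoid_error_le) auto
        also have "\<dots> \<le> R * (R + 1) * real n powr (- (Re z - r) - 2)"
          using s elim R by (intro mult_mono powr_mono) auto
        finally show "norm (trapezoid_error n s) \<le> R * (R + 1) * real n powr (- (Re z - r) - 2)" .
      qed
    qed
    show "summable (\<lambda>n. R * (R + 1) * real n powr (- (Re z - r) - 2))"
      by (intro summable_mult iffD2[OF summable_real_powr_iff]) (use zr in linarith)
  qed
  then show "\<exists>d>0. cball z d \<subseteq> {s. -1 < Re s} - {1} \<and>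
       uniform_limit (cball z d) (\<lambda>N s. \<Sum>n<N. trapezoid_error n s) right_zeta sequentially"
    using r by auto
qed

text \<open>The integrals in the trapezoid errors telescope, which leaves the partial sums of the Dirichlet
  series up to two boundary terms that vanish in the limit.\<close>

lemma right_zeta_sums:
  assumes "Re s > 1"
  shows "(\<lambda>n. 1 / of_nat (Suc n) powr s) sums right_zeta s"
proof -
  have s: "s \<noteq> 1" using assms by auto
  have tel: "(\<Sum>n<N. trapezoid_error n s)
      = (\<Sum>n<N. of_nat n powr (-s)) + of_nat N powr (-s) / 2 - of_nat N powr (1 - s) / (1 - s)" for N
    by (induction N) (use s in \<open>auto simp: trapezoid_error_def field_simps\<close>)
  have z: "(\<lambda>N. of_nat N powr (-w)) \<longlonglongrightarrow> 0" if "Re w > 0" for w :: complex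
  proof (rule tendsto_norm_zero_cancel)
    have "(\<lambda>N. real N powr (- Re w)) \<longlonglongrightarrow> 0"
      using that by (intro tendsto_neg_powr filterlim_real_sequentially) auto
    then show "(\<lambda>N. norm (of_nat N powr (-w) :: complex)) \<longlonglongrightarrow> 0"
      by (rule Lim_transform_eventually)
         (use eventually_gt_at_top[of 0] in eventually_elim, simp add: norm_powr_real_powr)
  qed
  have "(\<lambda>N. \<Sum>n<N. trapezoid_error n s) \<longlonglongrightarrow> right_zeta s"
    using summable_trapezoid_error[of s] assms s unfolding right_zeta_def
    by (intro summable_LIMSEQ) auto
  moreover have "(\<lambda>N. of_nat N powr (-s) / 2 - of_nat N powr (-(s - 1)) / (1 - s)) \<longlonglongrightarrow> 0 / 2 - 0 / (1 - s)"
    using assms s by (intro tendsto_intros z) auto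
  ultimately have "(\<lambda>N. (\<Sum>n<N. trapezoid_error n s) - (of_nat N powr (-s) / 2 - of_nat N powr (-(s - 1)) / (1 - s)))
      \<longlonglongrightarrow> right_zeta s - (0 / 2 - 0 / (1 - s))" by (rule tendsto_diff)
  then have "(\<lambda>N. \<Sum>n<N. of_nat n powr (-s)) \<longlonglongrightarrow> right_zeta s"
    by (simp add: tel)
  then have "(\<lambda>N. \<Sum>n<Suc N. of_nat n powr (-s)) \<longlonglongrightarrow> right_zeta s"
    by (rule LIMSEQ_Suc)
  then show ?thesis
    unfolding sums_def sum.lessThan_Suc_shift by (simp add: powr_minus_divide)
qed

lemma norm_right_zeta_le:
  obtains C where "C > 0"
    "\<And>s. Re s \<ge> -1/2 \<Longrightarrow> \<bar>Im s\<bar> \<ge> 1 \<Longrightarrow> norm (right_zeta s) \<le> C * (1 + norm s) ^ 2"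
proof -
  define B where "B = (\<Sum>n. real (Suc n) powr (-3/2))"
  have sB: "summable (\<lambda>n. real (Suc n) powr (-3/2))"
    by (subst summable_Suc_iff) (auto simp: summable_real_powr_iff)
  have B0: "B \<ge> 0" unfolding B_def by (intro suminf_nonneg sB) auto
  show thesis
  proof (rule that[of "2 + B"])
    show "2 + B > 0" using B0 by simp
    fix s assume s: "Re s \<ge> -1/2" "\<bar>Im s\<bar> \<ge> 1"
    have s1: "s \<noteq> 1" using s by auto
    have n1: "norm (s - 1) \<ge> 1" using s abs_Im_le_cmod[of "s - 1"] by auto
    have summ: "summable (\<lambda>n. trapezoid_error n s)" using s s1 by (intro summable_trapezoid_error) auto
    have le: "norm (trapezoid_error (Suc n) s) \<le> norm s * norm (s + 1) * real (Suc n) powr (-3/2)" for n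
    proof -
      have "norm (trapezoid_error (Suc n) s) \<le> norm s * norm (s + 1) * real (Suc n) powr (- Re s - 2)"
        using s s1 by (intro norm_trapezoid_error_le) auto
      also have "\<dots> \<le> norm s * norm (s + 1) * real (Suc n) powr (-3/2)"
      proof (intro mult_left_mono powr_mono)
        show "- Re s - 2 \<le> - 3 / 2" using s(1) by (simp add: field_simps)
      qed auto
      finally show ?thesis .
    qed
    have "right_zeta s = trapezoid_error 0 s + (\<Sum>n. trapezoid_error (Suc n) s)"
      unfolding right_zeta_def using suminf_split_head[OF summ] by simp
    also have "norm \<dots> \<le> norm (trapezoid_error 0 s) + norm (\<Sum>n. trapezoid_error (Suc n) s)"
      by (rule norm_triangle_ineq)
    also have "norm (\<Sum>n. trapezoid_error (Suc n) s) \<le> (\<Sum>n. norm s * norm (s + 1) * real (Suc n) powr (-3/2))"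
      by (intro norm_suminf_le le summable_mult sB)
    also have "\<dots> = norm s * norm (s + 1) * B"
      unfolding B_def by (rule suminf_mult[OF sB])
    also have "\<dots> \<le> (1 + norm s) * (1 + norm s) * B"
      using norm_triangle_ineq[of s 1] B0 by (intro mult_right_mono mult_mono) auto
    also have "norm (trapezoid_error 0 s) \<le> 1 / 2 + norm (1 / (1 - s))"
      using norm_triangle_ineq4[of "1/2" "1 / (1 - s)"] by (simp add: trapezoid_error_def)
    also have "norm (1 / (1 - s)) \<le> 1"
    proof -
      have "norm (1 - s) \<ge> 1" using n1 by (simp add: norm_minus_commute)
      then show ?thesis unfolding norm_divide by (auto simp: divide_le_eq_1)
    qed
    also have "1 / 2 + 1 \<le> 2 * (1 + norm s)\<^sup>2"
    proof -
      have "1 \<le> (1 + norm s)\<^sup>2" by (rule one_le_power) simp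
      then show ?thesis by linarith
    qed
    finally show "norm (right_zeta s) \<le> (2 + B) * (1 + norm s) ^ 2"
      by (simp add: power2_eq_square algebra_simps)
  qed
qed

section \<open>The functional equation on a real interval\<close>

lemma Gamma_real_reflection_cos:
  fixes s :: real
  assumes "-1 < s" "s < 1"
  shows "Gamma ((1 - s) / 2) * Gamma ((1 + s) / 2) = pi / cos (pi * s / 2)"
proof -
  define p where "p = (1 - s) / 2"
  have q: "(1 + s) / 2 = 1 - p" by (simp add: p_def field_simps)
  have "complex_of_real (Gamma p * Gamma (1 - p)) = Gamma (of_real p) * Gamma (1 - of_real p)"
    by (simp flip: Gamma_complex_of_real)
  also have "\<dots> = of_real (pi / sin (pi * p))"
    by (simp add: Gamma_reflection_complex sin_of_real flip: of_real_mult)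
  finally have "Gamma p * Gamma (1 - p) = pi / sin (pi * p)" by (simp only: of_real_eq_iff)
  also have "sin (pi * p) = cos (pi * s / 2)"
  proof -
    have "pi * p = pi / 2 - pi * s / 2" by (simp add: p_def field_simps)
    then show ?thesis by (simp only: sin_cos_eq) simp
  qed
  finally show ?thesis by (simp add: q p_def)
qed

text \<open>The substitution \<open>t = a\<^sup>2 / (x\<^sup>2 + a\<^sup>2)\<close> turns the integral into the Beta integral with parameters
  \<open>(1-s)/2\<close> and \<open>(1+s)/2\<close>, whose sum is 1.\<close>

lemma mellin_inverse_square:
  fixes a s :: real
  assumes a: "a > 0" and s: "-1 < s" "s < 1"
  shows "(\<integral>\<^sup>+x. ennreal (2 * x powr s / (x\<^sup>2 + a\<^sup>2)) * indicator {0<..} x \<partial>lborel)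
    = ennreal (a powr (s - 1) * (pi / cos (pi * s / 2)))"
proof -
  define p q where "p = (1 - s) / 2" and "q = (1 + s) / 2"
  have pq: "p > 0" "q > 0" "p + q = 1" using s by (auto simp: p_def q_def field_simps)
  define f where "f = (\<lambda>t. t powr (p - 1) * (1 - t) powr (q - 1))"
  define g where "g = (\<lambda>x. a\<^sup>2 / (x\<^sup>2 + a\<^sup>2))"
  define g' where "g' = (\<lambda>x. - 2 * x * a\<^sup>2 / (x\<^sup>2 + a\<^sup>2)\<^sup>2)"
  have pos: "x\<^sup>2 + a\<^sup>2 > 0" for x using a by (simp add: add_nonneg_pos)
  \<comment> \<open>\<open>f\<close> is the Beta integrand and \<open>g\<close> the substitution, with derivative \<open>g'\<close>.\<close>
  have f: "(f has_integral Beta p q) {0<..<1}"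
    using has_integral_Beta_real[of p q] pq unfolding f_def by (simp add: has_integral_Icc_iff_Ioo)
  have Beta: "Beta p q = pi / cos (pi * s / 2)"
    using Gamma_real_reflection_cos[OF s] pq(3) by (simp add: Beta_def p_def q_def)
  have img: "g ` {0<..} = {0<..<1}"
  proof (intro equalityI subsetI)
    fix y :: real assume y: "y \<in> {0<..<1}"
    define x where "x = a * sqrt (1 / y - 1)"
    have "1 / y - 1 > 0" using y by (simp add: field_simps)
    then have "x > 0" "x\<^sup>2 = a\<^sup>2 * (1 / y - 1)" using a by (auto simp: x_def power_mult_distrib)
    then have "g x = y" using y a by (simp add: g_def field_simps)
    with \<open>x > 0\<close> show "y \<in> g ` {0<..}" by (auto intro!: image_eqI[of _ _ x])
  next
    fix y assume "y \<in> g ` {0<..}"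
    then obtain x where "x > 0" "y = g x" by auto
    then have "a\<^sup>2 > 0" "x\<^sup>2 > 0" using a by auto
    then show "y \<in> {0<..<1}" using \<open>y = g x\<close> pos[of x] by (auto simp: g_def intro: divide_pos_pos)
  qed
  have inj: "inj_on g {0<..}"
  proof (rule inj_onI)
    fix x y assume xy: "x \<in> {0<..}" "y \<in> {0<..}" "g x = g y"
    then have "x\<^sup>2 = y\<^sup>2" using pos[of x] pos[of y] a by (simp add: g_def field_simps)
    then show "x = y" using xy by (simp add: power2_eq_iff)
  qed
  have "(\<lambda>x. \<bar>g' x\<bar> *\<^sub>R f (g x)) absolutely_integrable_on {0<..} \<and>
        integral {0<..} (\<lambda>x. \<bar>g' x\<bar> *\<^sub>R f (g x)) = Beta p q"
    unfolding real_scaleR_def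
  proof (rule has_absolute_integral_change_of_variables_1'[where f = f and g = g and g' = g', THEN iffD2])
    show "(g has_field_derivative g' x) (at x within {0<..})" for x
      unfolding g_def g'_def using pos[of x]
      by (auto intro!: derivative_eq_intros simp: power2_eq_square)
    have "f absolutely_integrable_on {0<..<1}"
      using f by (intro nonnegative_absolutely_integrable_1) (auto simp: f_def)
    then show "f absolutely_integrable_on g ` {0<..} \<and> integral (g ` {0<..}) f = Beta p q"
      using f by (simp add: img integral_unique)
  qed (use inj in auto)
  then have "((\<lambda>x. \<bar>g' x\<bar> *\<^sub>R f (g x)) has_integral Beta p q) {0<..}"
    by (auto simp: has_integral_iff set_lebesgue_integral_eq_integral)
  then have "((\<lambda>x. a powr (1 - s) * (2 * x powr s / (x\<^sup>2 + a\<^sup>2))) has_integral Beta p q) {0<..}"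
  proof (rule has_integral_eq[rotated])
    fix x :: real assume x: "x \<in> {0<..}"
    define D where "D = x\<^sup>2 + a\<^sup>2"
    have D: "D > 0" using pos[of x] by (simp add: D_def)
    have g1: "1 - g x = x\<^sup>2 / D"
    proof -
      have "1 - g x = (D - a\<^sup>2) / D" using D by (simp add: g_def diff_divide_distrib flip: D_def)
      also have "D - a\<^sup>2 = x\<^sup>2" by (simp add: D_def)
      finally show ?thesis .
    qed
    have xs: "x * (x\<^sup>2) powr (q - 1) = x powr s"
    proof -
      have "x * (x\<^sup>2) powr (q - 1) = x powr 1 * x powr (2 * (q - 1))"
      proof -
        have "x\<^sup>2 = x powr 2" using x by simp
        then show ?thesis using x by (simp only: powr_powr) simp
      qed
      also have "\<dots> = x powr (1 + 2 * (q - 1))" by (rule powr_add[symmetric])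
      also have "1 + 2 * (q - 1) = s" by (simp add: q_def field_simps)
      finally show ?thesis .
    qed
    have as: "a\<^sup>2 * (a\<^sup>2) powr (p - 1) = a powr (1 - s)"
    proof -
      have "a\<^sup>2 * (a\<^sup>2) powr (p - 1) = a powr 2 * a powr (2 * (p - 1))"
      proof -
        have "a\<^sup>2 = a powr 2" using a by simp
        then show ?thesis by (simp only: powr_powr)
      qed
      also have "\<dots> = a powr (2 + 2 * (p - 1))" by (rule powr_add[symmetric])
      also have "2 + 2 * (p - 1) = 1 - s" by (simp add: p_def field_simps)
      finally show ?thesis .
    qed
    have Ds: "D powr (p - 1) * D powr (q - 1) = 1 / D"
    proof -
      have "p - 1 + (q - 1) = -1" using pq by linarith
      then show ?thesis using D by (simp add: powr_minus_divide flip: powr_add)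
    qed
    have "\<bar>g' x\<bar> *\<^sub>R f (g x) = 2 * x * a\<^sup>2 / D\<^sup>2 * ((a\<^sup>2 / D) powr (p - 1) * (x\<^sup>2 / D) powr (q - 1))"
      using x a D by (simp add: g'_def f_def g1 abs_mult flip: D_def) (simp add: g_def D_def)
    also have "(a\<^sup>2 / D) powr (p - 1) * (x\<^sup>2 / D) powr (q - 1)
        = (a\<^sup>2) powr (p - 1) * (x\<^sup>2) powr (q - 1) / (D powr (p - 1) * D powr (q - 1))"
      using D by (simp add: powr_divide)
    also have "\<dots> = (a\<^sup>2) powr (p - 1) * (x\<^sup>2) powr (q - 1) * D"
      unfolding Ds using D by simp
    also have "2 * x * a\<^sup>2 / D\<^sup>2 * \<dots> = (a\<^sup>2 * (a\<^sup>2) powr (p - 1)) * (2 * (x * (x\<^sup>2) powr (q - 1)) / D)"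
      using D by (simp add: power2_eq_square)
    finally show "\<bar>g' x\<bar> *\<^sub>R f (g x) = a powr (1 - s) * (2 * x powr s / (x\<^sup>2 + a\<^sup>2))"
      unfolding xs as by (simp only: D_def)
  qed
  then have "((\<lambda>x. a powr (s - 1) * (a powr (1 - s) * (2 * x powr s / (x\<^sup>2 + a\<^sup>2))))
      has_integral a powr (s - 1) * Beta p q) {0<..}"
    by (rule has_integral_mult_right)
  moreover have "a powr (s - 1) * (a powr (1 - s) * y) = y" for y
    using a by (simp flip: mult.assoc powr_add)
  ultimately have "((\<lambda>x. 2 * x powr s / (x\<^sup>2 + a\<^sup>2)) has_integral a powr (s - 1) * Beta p q) {0<..}"
    by simp
  then show ?thesis
    unfolding Beta by (intro nn_integral_has_integral_lebesgue') (auto intro!: divide_nonneg_nonneg)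
qed

text \<open>The logarithmic derivative of the reflection formula of Gamma.\<close>

lemma Digamma_reflection:
  fixes z :: complex
  assumes z: "z \<notin> \<int>"
  shows "Digamma (1 - z) - Digamma z = of_real pi * cot (of_real pi * z)"
proof -
  have z1: "z \<notin> \<int>\<^sub>\<le>\<^sub>0" "1 - z \<notin> \<int>\<^sub>\<le>\<^sub>0"
    using z nonpos_Ints_subset_Ints minus_in_Ints_iff Ints_diff[of 1 "1 - z"] by auto
  have sin0: "sin (of_real pi * w) \<noteq> 0" if "w \<notin> \<int>" for w :: complex
    using that by (auto simp: sin_eq_0 Ints_def)
  \<comment> \<open>\<open>G\<close> is constantly \<open>\<pi>\<close> off the integers, so its derivative vanishes.\<close>
  define G where "G w = Gamma w * Gamma (1 - w) * sin (of_real pi * w)" for w :: complex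
  have "(G has_field_derivative
     (Gamma z * Gamma (1 - z) * ((Digamma z - Digamma (1 - z)) * sin (of_real pi * z) + of_real pi * cos (of_real pi * z)))) (at z)"
    unfolding G_def using z1 by (auto intro!: derivative_eq_intros simp: algebra_simps)
  moreover have "(G has_field_derivative 0) (at z)"
  proof (rule has_field_derivative_transform_within_open)
    show "((\<lambda>_. of_real pi) has_field_derivative 0) (at z)" by simp
    show "open (- \<int> :: complex set)" by (simp add: open_Compl closed_Ints)
    show "of_real pi = G w" if "w \<in> - \<int>" for w
      using sin0[of w] that by (simp add: G_def Gamma_reflection_complex)
  qed (use z in auto)
  ultimately have "Gamma z * Gamma (1 - z) * ((Digamma z - Digamma (1 - z)) * sin (of_real pi * z) + of_real pi * cos (of_real pi * z)) = 0"
    by (rule DERIV_unique)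
  then have "(Digamma z - Digamma (1 - z)) * sin (of_real pi * z) + of_real pi * cos (of_real pi * z) = 0"
    using z1 by (simp add: Gamma_eq_zero_iff)
  then show ?thesis
    using sin0[OF z] by (simp add: cot_def field_simps)
qed

text \<open>The reflection formula of Digamma at \<open>z = ix/(2\<pi>)\<close>, where the series of \<open>\<psi>(1+z) - \<psi>(1-z)\<close>
  becomes the partial fraction expansion.\<close>

lemma coth_partial_fractions:
  fixes x :: real
  assumes x: "x > 0"
  shows "(\<lambda>n. 2 * x / (x\<^sup>2 + (2 * pi * real (Suc n))\<^sup>2)) sums (cosh (x/2) / (2 * sinh (x/2)) - 1 / x)"
proof -
  define z where "z = \<i> * of_real (x / (2 * pi))"
  have zI: "z \<notin> \<int>" "z \<noteq> 0" using x by (auto simp: z_def Ints_def complex_eq_iff)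
  have nz: "1 + z \<noteq> 0" "1 - z \<noteq> 0" by (auto simp: z_def complex_eq_iff)
  note sums = sums_diff[OF summable_sums[OF summable_Digamma[OF nz(1)]] summable_sums[OF summable_Digamma[OF nz(2)]]]
  have "(\<lambda>n. inverse (1 - z + of_nat n) - inverse (1 + z + of_nat n)) sums (Digamma (1 + z) - Digamma (1 - z))"
    using sums by (simp add: Digamma_def)
  also have "Digamma (1 + z) = Digamma z + 1 / z"
    using Digamma_plus1[of z] zI by (simp add: add.commute)
  also have "Digamma z + 1 / z - Digamma (1 - z) = 1 / z - of_real pi * cot (of_real pi * z)"
    using Digamma_reflection[OF zI(1)] by (simp add: algebra_simps)
  finally have "(\<lambda>n. 1 / (2 * of_real pi * \<i>) * (inverse (1 - z + of_nat n) - inverse (1 + z + of_nat n))) sums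
     (1 / (2 * of_real pi * \<i>) * (1 / z - of_real pi * cot (of_real pi * z)))" by (rule sums_mult)
  also have "(\<lambda>n. 1 / (2 * of_real pi * \<i>) * (inverse (1 - z + of_nat n) - inverse (1 + z + of_nat n)))
     = (\<lambda>n. complex_of_real (2 * x / (x\<^sup>2 + (2 * pi * real (Suc n))\<^sup>2)))"
  proof
    fix n
    define N where "N = complex_of_real (real (Suc n))"
    have z2: "z\<^sup>2 = - of_real ((x / (2 * pi))\<^sup>2)" 
      unfolding z_def power_mult_distrib i_squared by simp
    have ne: "N - z \<noteq> 0" "N + z \<noteq> 0" by (auto simp: N_def z_def complex_eq_iff)
    have "inverse (1 - z + of_nat n) - inverse (1 + z + of_nat n) = inverse (N - z) - inverse (N + z)"
      by (simp add: N_def algebra_simps)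
    also have "\<dots> = 2 * z / (N\<^sup>2 - z\<^sup>2)"
      using ne by (simp add: field_simps power2_eq_square)
    also have "N\<^sup>2 - z\<^sup>2 = of_real ((real (Suc n))\<^sup>2 + (x / (2 * pi))\<^sup>2)"
      unfolding z2 by (simp add: N_def)
    also have "1 / (2 * of_real pi * \<i>) * (2 * z / \<dots>)
       = of_real (x / (2 * pi\<^sup>2) / ((real (Suc n))\<^sup>2 + (x / (2 * pi))\<^sup>2))"
      by (simp add: z_def power2_eq_square)
    also have "x / (2 * pi\<^sup>2) / ((real (Suc n))\<^sup>2 + (x / (2 * pi))\<^sup>2) = 2 * x / (x\<^sup>2 + (2 * pi * real (Suc n))\<^sup>2)"
    proof -
      have p: "(real (Suc n))\<^sup>2 + (x / (2 * pi))\<^sup>2 > 0" "x\<^sup>2 + (2 * pi * real (Suc n))\<^sup>2 > 0"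
        using x by (auto intro!: add_pos_nonneg add_nonneg_pos)
      have "(real (Suc n))\<^sup>2 + (x / (2 * pi))\<^sup>2 = (x\<^sup>2 + (2 * pi * real (Suc n))\<^sup>2) / (4 * pi\<^sup>2)"
        by (simp add: field_simps power2_eq_square del: of_nat_Suc)
      then show ?thesis by simp
    qed
    finally show "1 / (2 * of_real pi * \<i>) * (inverse (1 - z + of_nat n) - inverse (1 + z + of_nat n))
      = complex_of_real (2 * x / (x\<^sup>2 + (2 * pi * real (Suc n))\<^sup>2))" .
  qed
  also have "1 / (2 * of_real pi * \<i>) * (1 / z - of_real pi * cot (of_real pi * z))
      = complex_of_real (cosh (x/2) / (2 * sinh (x/2)) - 1 / x)"
  proof -
    have "of_real pi * z = \<i> * of_real (x / 2)" by (simp add: z_def)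
    then have "cot (of_real pi * z) = cosh (of_real (x/2)) / (\<i> * sinh (of_real (x/2)))"
      unfolding cot_def cosh_conv_cos sinh_conv_sin by (simp only:) simp
    also have "\<dots> = - \<i> * of_real (cosh (x/2) / sinh (x/2))"
    proof -
      have "cosh (complex_of_real r) = of_real (cosh r)" "sinh (complex_of_real r) = of_real (sinh r)" for r
        by (simp_all add: cosh_def sinh_def scaleR_conv_of_real flip: exp_of_real)
      moreover have "sinh (x/2) \<noteq> 0" using x by simp
      ultimately show ?thesis by (simp only:) (simp add: field_simps)
    qed
    finally show ?thesis using x by (simp add: z_def field_simps)
  qed
  finally show ?thesis by (simp only: sums_of_real_iff)
qed

lemma trapezoid_exp:
  fixes x :: real
  assumes x: "x > 0"
  shows "((\<lambda>v. v * (1 - v) / 2 * exp (- (x * v))) has_integral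
     ((1 + exp (- x)) / 2 - (1 - exp (- x)) / x) / x\<^sup>2) {0..1}"
proof -
  have "((\<lambda>v. (v * (1 - v) / 2) *\<^sub>R (x\<^sup>2 * exp (- (x * (0 + v))))) has_integral
    ((1/2) *\<^sub>R (exp (- (x * 0)) + exp (- (x * (0 + 1)))) - (- exp (- (x * (0 + 1))) / x - - exp (- (x * 0)) / x))) {0..1}"
    by (rule trapezoid_rule_has_integral[where ?f1.0 = "\<lambda>u. - x * exp (- (x * u))"];
        unfold has_real_derivative_iff_has_vector_derivative[symmetric])
       (use x in \<open>auto intro!: derivative_eq_intros simp: power2_eq_square\<close>)
  also have "(1/2) *\<^sub>R (exp (- (x * 0)) + exp (- (x * (0 + 1)))) - (- exp (- (x * (0 + 1))) / x - - exp (- (x * 0)) / x)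
     = (1 + exp (- x)) / 2 - (1 - exp (- x)) / x"
    by (simp add: diff_divide_distrib)
  finally have "((\<lambda>v. x\<^sup>2 * (v * (1 - v) / 2 * exp (- (x * v)))) has_integral (1 + exp (- x)) / 2 - (1 - exp (- x)) / x) {0..1}"
    by (simp add: mult_ac)
  from has_integral_divide[OF this, of "x\<^sup>2"] show ?thesis using x by simp
qed

definition real_trapezoid_error :: "nat \<Rightarrow> real \<Rightarrow> real" where
  "real_trapezoid_error n s = (real n powr (-s) + real (Suc n) powr (-s)) / 2
     - (real (Suc n) powr (1 - s) - real n powr (1 - s)) / (1 - s)"

lemma trapezoid_error_of_real:
  "trapezoid_error n (of_real s) = of_real (real_trapezoid_error n s)"
proof -
  have "of_nat k powr (of_real r) = complex_of_real (real k powr r)" for k r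
    using powr_of_real[of "real k" r] by simp
  from this[of _ "-s"] this[of _ "1-s"] show ?thesis
    by (simp add: trapezoid_error_def real_trapezoid_error_def del: of_nat_Suc)
qed

lemma real_trapezoid_error_has_integral:
  assumes s: "-1 < s" "s < 0"
  shows "((\<lambda>v. v * (1 - v) / 2 * (s * (s + 1) * (real n + v) powr (-(s+2))))
     has_integral real_trapezoid_error n s) {0..1}"
proof (cases "n = 0")
  case False
  have "((\<lambda>v. (v * (1 - v) / 2) *\<^sub>R (s * (s + 1) * (real n + v) powr (-(s+2)))) has_integral
     ((1/2) *\<^sub>R (real n powr (-s) + (real n + 1) powr (-s)) 
       - ((real n + 1) powr (1-s) / (1-s) - real n powr (1-s) / (1-s)))) {0..1}"
  proof (rule trapezoid_rule_has_integral[where ?f1.0 = "\<lambda>u. (-s) * u powr (-s-1)"];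
         unfold has_real_derivative_iff_has_vector_derivative[symmetric])
    fix u assume "u \<in> {real n..real n + 1}"
    then have u: "u > 0" using False by auto
    show "((\<lambda>u. u powr (1-s) / (1-s)) has_field_derivative u powr (-s)) (at u)"
      using u s by (auto intro!: derivative_eq_intros)
    show "((\<lambda>u. u powr (-s)) has_field_derivative (-s) * u powr (-s-1)) (at u)"
      using u by (auto intro!: derivative_eq_intros)
    have e: "-s-1-1 = -(s+2)" by simp
    show "((\<lambda>u. (-s) * u powr (-s-1)) has_field_derivative s * (s + 1) * u powr (-(s+2))) (at u)"
      using DERIV_cmult[OF has_real_derivative_powr[OF u, of "-s-1"], of "-s"]
      unfolding e by (simp add: algebra_simps)
  qed
  then show ?thesis
    by (simp add: real_trapezoid_error_def diff_divide_distrib add_ac)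
next
  case True
  have "((\<lambda>v. s * (s + 1) / 2 * (v powr (-s-1) - v powr (-s))) has_integral
     s * (s + 1) / 2 * (1 powr (-s-1+1) / (-s-1+1) - 1 powr (-s+1) / (-s+1))) {0..1::real}"
    using s by (intro has_integral_mult_right has_integral_diff has_integral_powr_from_0) auto
  also have "s * (s + 1) / 2 * (1 powr (-s-1+1) / (-s-1+1) - 1 powr (-s+1) / (-s+1)) = real_trapezoid_error n s"
    using s True by (simp add: real_trapezoid_error_def field_simps)
  finally show ?thesis
  proof (rule has_integral_eq[rotated])
    fix v :: real assume v: "v \<in> {0..1}"
    show "s * (s + 1) / 2 * (v powr (-s-1) - v powr (-s)) = v * (1 - v) / 2 * (s * (s + 1) * (real n + v) powr (-(s+2)))"
    proof (cases "v = 0")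
      case False
      then have "v > 0" using v by auto
      have "v powr (-(s+2)) * v powr 1 = v powr (-s-1)" "v powr (-s-1) * v powr 1 = v powr (-s)"
        unfolding powr_add[symmetric] by (rule arg_cong[of _ _ "\<lambda>e. v powr e"], simp)+
      then have "v powr (-s-1) = v powr (-(s+2)) * v" "v powr (-s) = v powr (-(s+2)) * v * v"
        using \<open>v > 0\<close> by simp_all
      then have "s * (s + 1) / 2 * (v powr (-s-1) - v powr (-s)) = s * (s + 1) / 2 * (v powr (-(s+2)) * v - v powr (-(s+2)) * v * v)"
        by (simp only:)
      also have "\<dots> = v * (1 - v) / 2 * (s * (s + 1) * v powr (-(s+2)))"
        by (simp add: field_simps)
      finally show ?thesis using True by simp
    qed simp
  qed
qed

lemma Gamma_nn_integral_scaled: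
  fixes z y :: real
  assumes "z > 0" "y > 0"
  shows "(\<integral>\<^sup>+x. ennreal (x powr (z - 1) * exp (- (x * y))) * indicator {0<..} x \<partial>lborel) = ennreal (Gamma z * y powr (-z))"
proof -
  have "ennreal (Gamma z) = (\<integral>\<^sup>+t. ennreal (indicator {0..} t * t powr (z - 1) / exp t) \<partial>lborel)"
    using Gamma_conv_nn_integral_real[OF assms(1)] .
  also have "\<dots> = ennreal \<bar>y\<bar> * (\<integral>\<^sup>+t. ennreal (indicator {0..} (0 + y * t) * (0 + y * t) powr (z - 1) / exp (0 + y * t)) \<partial>lborel)"
    using assms by (intro nn_integral_real_affine) auto
  also have "(\<integral>\<^sup>+t. ennreal (indicator {0..} (0 + y * t) * (0 + y * t) powr (z - 1) / exp (0 + y * t)) \<partial>lborel)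
     = (\<integral>\<^sup>+t. ennreal (y powr (z - 1)) * (ennreal (t powr (z - 1) * exp (- (t * y))) * indicator {0<..} t) \<partial>lborel)"
  proof (rule nn_integral_cong)
    fix t :: real
    consider "t < 0" | "t = 0" | "t > 0" by linarith
    then show "ennreal (indicator {0..} (0 + y * t) * (0 + y * t) powr (z - 1) / exp (0 + y * t))
       = ennreal (y powr (z - 1)) * (ennreal (t powr (z - 1) * exp (- (t * y))) * indicator {0<..} t)"
    proof cases
      case 1
      then have "y * t < 0" using assms by (simp add: mult_pos_neg)
      then show ?thesis using 1 by simp
    next
      case 3
      then show ?thesis using assms
        by (simp add: powr_mult exp_minus field_simps flip: ennreal_mult)
    qed simp
  qed
  also have "\<dots> = ennreal (y powr (z - 1)) * (\<integral>\<^sup>+t. ennreal (t powr (z - 1) * exp (- (t * y))) * indicator {0<..} t \<partial>lborel)"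
    by (rule nn_integral_cmult) auto
  finally have *: "ennreal (Gamma z) = ennreal (y powr z) * (\<integral>\<^sup>+t. ennreal (t powr (z - 1) * exp (- (t * y))) * indicator {0<..} t \<partial>lborel)"
    using assms by (simp add: powr_mult_base flip: mult.assoc ennreal_mult)
  have "ennreal (Gamma z * y powr (-z)) = ennreal (y powr (-z)) * ennreal (Gamma z)"
    using Gamma_real_pos[OF assms(1)] by (simp add: ennreal_mult mult.commute)
  also have "\<dots> = (ennreal (y powr (-z)) * ennreal (y powr z)) * (\<integral>\<^sup>+t. ennreal (t powr (z - 1) * exp (- (t * y))) * indicator {0<..} t \<partial>lborel)"
    unfolding * by (simp add: mult.assoc)
  also have "ennreal (y powr (-z)) * ennreal (y powr z) = 1"
    using assms by (simp add: powr_minus flip: ennreal_mult)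
  finally show ?thesis by simp
qed

text \<open>Since \<open>\<Gamma>(s) s (s+1) = \<Gamma>(s+2)\<close>, the second derivative of \<open>u^(-s)\<close> times \<open>\<Gamma>(s)\<close> is the
  Laplace transform of \<open>x^(s+1)\<close>, which converges although that of \<open>x^(s-1)\<close> does not. After
  swapping the integrals the inner one is the trapezoid error of \<open>exp (-xu)\<close>.\<close>

lemma Gamma_times_trapezoid_error:
  assumes s: "-1 < s" "s < 0"
  shows "ennreal (Gamma s * real_trapezoid_error n s) =
    (\<integral>\<^sup>+x. ennreal (x powr (s - 1) * exp (- (x * real n)) * ((1 + exp (- x)) / 2 - (1 - exp (- x)) / x)) * indicator {0<..} x \<partial>lborel)"
    and "Gamma s * real_trapezoid_error n s \<ge> 0"
proof -
  have Gs: "Gamma s * (s * (s + 1)) = Gamma (s + 2)"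
  proof -
    have "s \<notin> \<int>\<^sub>\<le>\<^sub>0" "s + 1 \<notin> \<int>\<^sub>\<le>\<^sub>0" using s by (auto elim!: nonpos_Ints_cases)
    then have "Gamma (s + 1) = s * Gamma s" "Gamma (s + 1 + 1) = (s + 1) * Gamma (s + 1)"
      by (blast intro: Gamma_plus1)+
    then show ?thesis by (simp add: add.assoc mult_ac)
  qed
  have "((\<lambda>v. Gamma s * (v * (1 - v) / 2 * (s * (s + 1) * (real n + v) powr (-(s+2)))))
     has_integral Gamma s * real_trapezoid_error n s) {0..1}"
    by (intro has_integral_mult_right real_trapezoid_error_has_integral s)
  then have I: "((\<lambda>v. v * (1 - v) / 2 * (Gamma (s + 2) * (real n + v) powr (-(s+2))))
     has_integral Gamma s * real_trapezoid_error n s) {0..1}"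
    by (simp add: mult_ac flip: Gs)
  have nn: "v * (1 - v) / 2 * (Gamma (s + 2) * (real n + v) powr (-(s+2))) \<ge> 0" if "v \<in> {0..1}" for v
    using that s Gamma_real_pos[of "s + 2"] by auto
  show "Gamma s * real_trapezoid_error n s \<ge> 0"
    using has_integral_nonneg[OF I nn] .
  define h where "h v x = v * (1 - v) / 2 * (x powr (s + 1) * exp (- (x * (real n + v))))" for v x :: real
  have "ennreal (Gamma s * real_trapezoid_error n s)
    = (\<integral>\<^sup>+v. ennreal (v * (1 - v) / 2 * (Gamma (s + 2) * (real n + v) powr (-(s+2)))) * indicator {0..1} v \<partial>lborel)"
    using nn_integral_has_integral_lebesgue'[OF nn I] by simp
  also have "\<dots> = (\<integral>\<^sup>+v. \<integral>\<^sup>+x. ennreal (h v x) * indicator {0<..} x * indicator {0..1} v \<partial>lborel \<partial>lborel)"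
  proof (rule nn_integral_cong)
    fix v :: real
    show "ennreal (v * (1 - v) / 2 * (Gamma (s + 2) * (real n + v) powr (-(s+2)))) * indicator {0..1} v
       = (\<integral>\<^sup>+x. ennreal (h v x) * indicator {0<..} x * indicator {0..1} v \<partial>lborel)"
    proof (cases "v \<in> {0<..1}")
      case True
      then have v: "v \<ge> 0" "v \<le> 1" "real n + v > 0" by auto
      have "(\<integral>\<^sup>+x. ennreal (h v x) * indicator {0<..} x * indicator {0..1} v \<partial>lborel)
        = (\<integral>\<^sup>+x. ennreal (v * (1 - v) / 2) * (ennreal (x powr (s + 1) * exp (- (x * (real n + v)))) * indicator {0<..} x) \<partial>lborel)"
        unfolding h_def using v
        by (intro nn_integral_cong) (simp add: mult.assoc flip: ennreal_mult split: split_indicator)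
      also have "\<dots> = ennreal (v * (1 - v) / 2) * ennreal (Gamma (s + 2) * (real n + v) powr (-(s+2)))"
      proof -
        have "s + 2 - 1 = s + 1" by simp
        with Gamma_nn_integral_scaled[of "s + 2" "real n + v"]
        have "(\<integral>\<^sup>+x. ennreal (x powr (s + 1) * exp (- (x * (real n + v)))) * indicator {0<..} x \<partial>lborel)
          = ennreal (Gamma (s + 2) * (real n + v) powr (-(s+2)))" using s v by simp
        then show ?thesis by (subst nn_integral_cmult) auto
      qed
      finally show ?thesis using v by (simp flip: ennreal_mult')
    qed (cases "v = 0"; simp add: h_def)
  qed
  also have "\<dots> = (\<integral>\<^sup>+x. \<integral>\<^sup>+v. ennreal (h v x) * indicator {0<..} x * indicator {0..1} v \<partial>lborel \<partial>lborel)"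
    unfolding h_def by (rule lborel_pair.Fubini'[symmetric]) measurable
  also have "\<dots> = (\<integral>\<^sup>+x. ennreal (x powr (s - 1) * exp (- (x * real n)) * ((1 + exp (- x)) / 2 - (1 - exp (- x)) / x)) * indicator {0<..} x \<partial>lborel)"
  proof (rule nn_integral_cong)
    fix x :: real
    show "(\<integral>\<^sup>+v. ennreal (h v x) * indicator {0<..} x * indicator {0..1} v \<partial>lborel)
       = ennreal (x powr (s - 1) * exp (- (x * real n)) * ((1 + exp (- x)) / 2 - (1 - exp (- x)) / x)) * indicator {0<..} x"
    proof (cases "x > 0")
      case True
      have e: "x powr (s + 1) * exp (- (x * real n)) * (v * (1 - v) / 2 * exp (- (x * v))) = h v x" for v
        by (simp add: h_def algebra_simps flip: exp_add)
      have "((\<lambda>v. h v x) has_integral (x powr (s + 1) * exp (- (x * real n)) * (((1 + exp (- x)) / 2 - (1 - exp (- x)) / x) / x\<^sup>2))) {0..1}"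
        using has_integral_mult_right[OF trapezoid_exp[OF True], of "x powr (s + 1) * exp (- (x * real n))"]
        unfolding e .
      also have "x powr (s + 1) * exp (- (x * real n)) * (((1 + exp (- x)) / 2 - (1 - exp (- x)) / x) / x\<^sup>2)
        = x powr (s - 1) * exp (- (x * real n)) * ((1 + exp (- x)) / 2 - (1 - exp (- x)) / x)"
      proof -
        have "x powr (s + 1) = x powr (s - 1) * x\<^sup>2"
        proof -
          have "x powr (s - 1) * x powr 2 = x powr (s + 1)"
            unfolding powr_add[symmetric] by (rule arg_cong[of _ _ "\<lambda>e. x powr e"]) simp
          then show ?thesis using True by simp
        qed
        then show ?thesis using True by simp
      qed
      finally have "(\<integral>\<^sup>+v. ennreal (h v x) * indicator {0..1} v \<partial>lborel)
         = ennreal (x powr (s - 1) * exp (- (x * real n)) * ((1 + exp (- x)) / 2 - (1 - exp (- x)) / x))"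
        by (rule nn_integral_has_integral_lebesgue'[rotated]) (auto simp: h_def)
      then show ?thesis using True by simp
    qed simp
  qed
  finally show "ennreal (Gamma s * real_trapezoid_error n s) =
    (\<integral>\<^sup>+x. ennreal (x powr (s - 1) * exp (- (x * real n)) * ((1 + exp (- x)) / 2 - (1 - exp (- x)) / x)) * indicator {0<..} x \<partial>lborel)" .
qed

text \<open>Summing the preceding lemma over \<open>n\<close> is a geometric series and produces \<open>coth(x/2)/2 - 1/x\<close>;
  expanding that in partial fractions instead and integrating each fraction gives the right-hand
  side. All terms are nonnegative, so both sums may be exchanged with the integral.\<close>

lemma functional_equation_real:
  fixes s :: real
  assumes s: "-1 < s" "s < 0"
  shows "(\<lambda>n. Gamma s * real_trapezoid_error n s) sums
     ((2 * pi) powr (s - 1) * (pi / cos (pi * s / 2)) * (\<Sum>n. real (Suc n) powr (s - 1)))"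
proof -
  define E where "E x = (1 + exp (- x)) / 2 - (1 - exp (- x)) / x" for x :: real
  define T where "T n = Gamma s * real_trapezoid_error n s" for n
  define R where "R n = (2 * pi * real (Suc n)) powr (s - 1) * (pi / cos (pi * s / 2))" for n
  have cos: "cos (pi * s / 2) > 0"
  proof (rule cos_gt_zero_pi)
    show "- (pi / 2) < pi * s / 2" using s mult_strict_left_mono[of "-1" s pi] by simp
    show "pi * s / 2 < pi / 2" using s mult_strict_left_mono[of s 1 pi] by simp
  qed
  have Rnn: "R n \<ge> 0" for n using cos by (simp add: R_def)
  have Tnn: "T n \<ge> 0" for n unfolding T_def using Gamma_times_trapezoid_error(2)[OF s] .
  have "(\<Sum>n. ennreal (T n)) =
    (\<Sum>n. \<integral>\<^sup>+x. ennreal (x powr (s - 1) * exp (- (x * real n)) * E x) * indicator {0<..} x \<partial>lborel)"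
    unfolding T_def E_def by (simp only: Gamma_times_trapezoid_error(1)[OF s])
  also have "\<dots> = (\<integral>\<^sup>+x. (\<Sum>n. ennreal (x powr (s - 1) * exp (- (x * real n)) * E x) * indicator {0<..} x) \<partial>lborel)"
    unfolding E_def by (rule nn_integral_suminf[symmetric]) measurable
  also have "\<dots> = (\<integral>\<^sup>+x. (\<Sum>n. ennreal (2 * x powr s / (x\<^sup>2 + (2 * pi * real (Suc n))\<^sup>2)) * indicator {0<..} x) \<partial>lborel)"
  proof (rule nn_integral_cong)
    fix x :: real
    show "(\<Sum>n. ennreal (x powr (s - 1) * exp (- (x * real n)) * E x) * indicator {0<..} x)
       = (\<Sum>n. ennreal (2 * x powr s / (x\<^sup>2 + (2 * pi * real (Suc n))\<^sup>2)) * indicator {0<..} x)"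
    proof (cases "x > 0")
      case x: True
      define c where "c = x powr (s - 1) * (cosh (x/2) / (2 * sinh (x/2)) - 1 / x)"
      have e1: "exp (- x) < 1" using x by simp
      have "(\<lambda>n. x powr (s - 1) * E x * exp (- x) ^ n) sums (x powr (s - 1) * E x * (1 / (1 - exp (- x))))"
        using e1 by (intro sums_mult geometric_sums) auto
      also have "(\<lambda>n. x powr (s - 1) * E x * exp (- x) ^ n) = (\<lambda>n. x powr (s - 1) * exp (- (x * real n)) * E x)"
        by (simp add: exp_of_nat_mult[symmetric] mult_ac)
      also have "x powr (s - 1) * E x * (1 / (1 - exp (- x))) = c"
      proof -
        have "cosh (x/2) / (2 * sinh (x/2)) = (1 + exp (- x)) / (2 * (1 - exp (- x)))"
        proof -
          have "exp (x/2) * (1 + exp (- x)) = 2 * cosh (x/2)" "exp (x/2) * (1 - exp (- x)) = 2 * sinh (x/2)"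
            by (simp_all add: cosh_def sinh_def algebra_simps flip: exp_add)
          then have "2 * cosh (x/2) / (2 * (2 * sinh (x/2))) = (exp (x/2) * (1 + exp (- x))) / (2 * (exp (x/2) * (1 - exp (- x))))"
            by (simp only:)
          then show ?thesis by simp
        qed
        then show ?thesis using e1 x by (simp add: c_def E_def field_simps)
      qed
      finally have s1: "(\<lambda>n. x powr (s - 1) * exp (- (x * real n)) * E x) sums c" .
      have "(\<lambda>n. x powr (s - 1) * (2 * x / (x\<^sup>2 + (2 * pi * real (Suc n))\<^sup>2))) sums c"
        unfolding c_def by (intro sums_mult coth_partial_fractions x)
      also have "(\<lambda>n. x powr (s - 1) * (2 * x / (x\<^sup>2 + (2 * pi * real (Suc n))\<^sup>2)))
         = (\<lambda>n. 2 * x powr s / (x\<^sup>2 + (2 * pi * real (Suc n))\<^sup>2))"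
        using x by (simp add: powr_diff mult.commute)
      finally have s2: "(\<lambda>n. 2 * x powr s / (x\<^sup>2 + (2 * pi * real (Suc n))\<^sup>2)) sums c" .
      have nn2: "2 * x powr s / (x\<^sup>2 + (2 * pi * real (Suc n))\<^sup>2) \<ge> 0" for n by simp
      have Enn: "E x \<ge> 0"
      proof -
        have "((1 + exp (- x)) / 2 - (1 - exp (- x)) / x) / x\<^sup>2 \<ge> 0"
          by (rule has_integral_nonneg[OF trapezoid_exp[OF x]]) auto
        then show ?thesis using x by (simp add: E_def zero_le_divide_iff)
      qed
      have nn1: "x powr (s - 1) * exp (- (x * real n)) * E x \<ge> 0" for n using Enn by simp
      show ?thesis
        using suminf_ennreal_eq[OF nn1 s1] suminf_ennreal_eq[OF nn2 s2] x by simp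
    qed simp
  qed
  also have "\<dots> = (\<Sum>n. \<integral>\<^sup>+x. ennreal (2 * x powr s / (x\<^sup>2 + (2 * pi * real (Suc n))\<^sup>2)) * indicator {0<..} x \<partial>lborel)"
    by (rule nn_integral_suminf) measurable
  also have "\<dots> = (\<Sum>n. ennreal (R n))"
    unfolding R_def using s by (subst mellin_inverse_square) auto
  finally have TR: "(\<Sum>n. ennreal (T n)) = (\<Sum>n. ennreal (R n))" .
  have "summable (\<lambda>n. real (Suc n) powr (s - 1))"
    by (subst summable_Suc_iff) (use s in \<open>simp add: summable_real_powr_iff\<close>)
  then have "(\<lambda>n. (2 * pi) powr (s - 1) * (pi / cos (pi * s / 2)) * real (Suc n) powr (s - 1)) sums
     ((2 * pi) powr (s - 1) * (pi / cos (pi * s / 2)) * (\<Sum>n. real (Suc n) powr (s - 1)))"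
    by (intro sums_mult summable_sums)
  also have "(\<lambda>n. (2 * pi) powr (s - 1) * (pi / cos (pi * s / 2)) * real (Suc n) powr (s - 1)) = R"
    by (simp add: R_def powr_mult mult_ac fun_eq_iff del: of_nat_Suc)
  finally have "R sums ((2 * pi) powr (s - 1) * (pi / cos (pi * s / 2)) * (\<Sum>n. real (Suc n) powr (s - 1)))" .
  with TR have "(\<Sum>n. ennreal (T n)) = ennreal ((2 * pi) powr (s - 1) * (pi / cos (pi * s / 2)) * (\<Sum>n. real (Suc n) powr (s - 1)))"
    using suminf_ennreal_eq[OF Rnn] by simp
  moreover have "(\<lambda>n. ennreal (T n)) sums (\<Sum>n. ennreal (T n))" by (rule summable_sums) simp
  ultimately have "(\<lambda>n. ennreal (T n)) sums ennreal ((2 * pi) powr (s - 1) * (pi / cos (pi * s / 2)) * (\<Sum>n. real (Suc n) powr (s - 1)))"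
    by simp
  moreover have "(2 * pi) powr (s - 1) * (pi / cos (pi * s / 2)) * (\<Sum>n. real (Suc n) powr (s - 1)) \<ge> 0"
    using \<open>R sums _\<close> Rnn by (metis sums_unique suminf_nonneg sums_summable)
  ultimately show ?thesis
    unfolding T_def[symmetric] using Tnn by (simp only: sums_ennreal)
qed

section \<open>The zeta function: continuation, functional equation, growth\<close>

text \<open>The identity holds for real \<open>w\<close>, which suffices by the identity theorem. The form with \<open>\<Gamma>(w)\<close>
  follows from the one with \<open>\<Gamma>(1-w)\<close> by the reflection formula and
  \<open>sin(\<pi>s) = 2 sin(\<pi>s/2) cos(\<pi>s/2)\<close>.\<close>

lemma right_zeta_functional_equation:
  assumes w: "1 < Re w" "Re w < 2"
  shows "right_zeta (1 - w) = 2 * (2 * of_real pi) powr (-w) * cos (of_real pi * w / 2) * Gamma w * right_zeta w"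
proof -
  define f where "f w = right_zeta (1 - w) - 2 * (2 * of_real pi) powr (-w) * cos (of_real pi * w / 2) * Gamma w * right_zeta w" for w
  define S where "S = {w. 1 < Re w} \<inter> {w. Re w < 2}"
  have Spos: "w \<notin> \<int>\<^sub>\<le>\<^sub>0" "w \<noteq> 1" "w \<noteq> 0" "Re w > 1" "Re w < 2" if "w \<in> S" for w
    using that by (auto simp: S_def nonpos_Ints_def)
  have real: "f (of_real r) = 0" if r: "1 < r" "r < 2" for r
  proof -
    define s where "s = 1 - r"
    have s: "-1 < s" "s < 0" using r by (auto simp: s_def)
    have sI: "s \<notin> \<int>\<^sub>\<le>\<^sub>0" using s by (auto elim!: nonpos_Ints_cases)
    have 1: "(\<lambda>n. complex_of_real (real_trapezoid_error n s)) sums right_zeta (of_real s)"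
    proof -
      have "summable (\<lambda>n. trapezoid_error n (of_real s))"
        using s by (intro summable_trapezoid_error) (auto simp: complex_eq_iff)
      then show ?thesis unfolding right_zeta_def trapezoid_error_of_real[symmetric] by (rule summable_sums)
    qed
    have 2: "(\<lambda>n. complex_of_real (real (Suc n) powr (s - 1))) sums right_zeta (of_real r)"
    proof -
      have "1 / of_nat (Suc n) powr complex_of_real r = of_real (real (Suc n) powr (s - 1))" for n
      proof -
        have "of_nat (Suc n) powr complex_of_real r = of_real (real (Suc n) powr r)"
          using powr_of_real[of "real (Suc n)" r] by simp
        moreover have "real (Suc n) powr (s - 1) = 1 / real (Suc n) powr r"
          by (simp add: s_def powr_minus_divide)
        ultimately show ?thesis by simp
      qed
      then show ?thesis using right_zeta_sums[of "of_real r"] r by simp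
    qed
    define Z where "Z = (\<Sum>n. real (Suc n) powr (s - 1))"
    have "summable (\<lambda>n. real (Suc n) powr (s - 1))"
      by (subst summable_Suc_iff) (use s in \<open>simp add: summable_real_powr_iff\<close>)
    then have "(\<lambda>n. complex_of_real (real (Suc n) powr (s - 1))) sums of_real Z"
      unfolding Z_def by (intro sums_of_real summable_sums)
    with 2 have Z: "right_zeta (of_real r) = of_real Z" by (rule sums_unique2)
    have "(\<lambda>n. complex_of_real (Gamma s * real_trapezoid_error n s)) sums (of_real (Gamma s) * right_zeta (of_real s))"
      unfolding of_real_mult by (rule sums_mult[OF 1])
    moreover have "(\<lambda>n. complex_of_real (Gamma s * real_trapezoid_error n s)) sums
       of_real ((2 * pi) powr (s - 1) * (pi / cos (pi * s / 2)) * Z)"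
      using functional_equation_real[OF s] unfolding Z_def by (rule sums_of_real)
    ultimately have main: "of_real (Gamma s) * right_zeta (of_real s) = of_real ((2 * pi) powr (s - 1) * (pi / cos (pi * s / 2)) * Z)"
      by (rule sums_unique2)
    have rpos: "cos (pi * s / 2) > 0"
    proof (rule cos_gt_zero_pi)
      show "- (pi / 2) < pi * s / 2" using s mult_strict_left_mono[of "-1" s pi] by simp
      show "pi * s / 2 < pi / 2" using s mult_strict_left_mono[of s 1 pi] by simp
    qed
    have sinneg: "sin (pi * s / 2) \<noteq> 0"
    proof -
      have "0 < - (pi * s / 2)" "- (pi * s / 2) < pi"
        using s mult_strict_left_mono[of "-1" s pi] mult_pos_neg[of pi s] by simp_all
      then have "sin (- (pi * s / 2)) > 0" by (rule sin_gt_zero)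
      then show ?thesis by simp
    qed
    have "Gamma s * Gamma r = pi / sin (pi * s)"
    proof -
      have "complex_of_real (Gamma s * Gamma (1 - s)) = Gamma (of_real s) * Gamma (1 - of_real s)"
        by (simp flip: Gamma_complex_of_real)
      also have "\<dots> = of_real (pi / sin (pi * s))"
        by (simp add: Gamma_reflection_complex sin_of_real flip: of_real_mult)
      finally show ?thesis by (simp only: of_real_eq_iff) (simp add: s_def)
    qed
    also have "sin (pi * s) = 2 * sin (pi * s / 2) * cos (pi * s / 2)"
      using sin_double[of "pi * s / 2"] by simp
    finally have GG: "Gamma s * (2 * sin (pi * s / 2) * Gamma r) = pi / cos (pi * s / 2)"
      using rpos sinneg by (simp add: field_simps)
    have cs: "cos (pi * r / 2) = sin (pi * s / 2)"
    proof -
      have "pi * r / 2 = pi / 2 - pi * s / 2" by (simp add: s_def field_simps)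
      then show ?thesis by (simp only: sin_cos_eq) simp
    qed
    have rs: "- r = s - 1" by (simp add: s_def)
    have "complex_of_real (Gamma s) * right_zeta (of_real s)
       = complex_of_real (Gamma s) * of_real (2 * (2 * pi) powr (-r) * cos (pi * r / 2) * Gamma r * Z)"
      unfolding main cs rs of_real_mult[symmetric] GG[symmetric] by (simp only: mult_ac)
    moreover have "complex_of_real (Gamma s) \<noteq> 0"
      using sI by (simp add: Gamma_eq_zero_iff)
    ultimately have "right_zeta (of_real s) = of_real (2 * (2 * pi) powr (-r) * cos (pi * r / 2) * Gamma r * Z)"
      by simp
    also have "\<dots> = 2 * (2 * of_real pi) powr (- of_real r) * cos (of_real pi * of_real r / 2) * Gamma (of_real r) * of_real Z"
    proof -
      have "(2 * of_real pi) powr (- of_real r) = complex_of_real ((2 * pi) powr (-r))"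
        using powr_of_real[of "2 * pi" "-r"] by simp
      moreover have "cos (of_real pi * of_real r / 2) = complex_of_real (cos (pi * r / 2))"
        unfolding cos_of_real[symmetric] by simp
      ultimately show ?thesis by (simp add: Gamma_complex_of_real)
    qed
    finally show ?thesis by (simp add: f_def Z s_def)
  qed
  have "f w = 0"
  proof (rule analytic_continuation[where f = f and S = S and U = "of_real ` {1<..<2}" and \<xi> = "of_real (3/2)"])
    have "right_zeta \<circ> (\<lambda>w. 1 - w) holomorphic_on S"
      by (rule holomorphic_on_compose_gen[OF _ right_zeta_holomorphic])
         (auto intro!: holomorphic_intros simp: S_def)
    moreover have "right_zeta holomorphic_on S"
      by (rule holomorphic_on_subset[OF right_zeta_holomorphic]) (auto simp: S_def)
    moreover have "Gamma holomorphic_on S"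
      by (rule holomorphic_Gamma) (use Spos in auto)
    ultimately show "f holomorphic_on S"
      unfolding f_def o_def by (intro holomorphic_intros) (use Spos in auto)
    show "open S" unfolding S_def by (intro open_Int open_halfspace_Re_gt open_halfspace_Re_lt)
    show "connected S" unfolding S_def
      by (intro convex_connected convex_Int convex_halfspace_Re_gt convex_halfspace_Re_lt)
    show "of_real ` {1<..<2} \<subseteq> S" by (auto simp: S_def)
    show "of_real (3/2) \<in> S" by (auto simp: S_def)
    show "complex_of_real (3/2) islimpt of_real ` {1<..<2}"
      unfolding islimpt_approachable
    proof (intro allI impI)
      fix e :: real assume e: "e > 0"
      define x where "x = 3/2 + min (e/2) (1/4)"
      have "1 < x" "x < 2" "x \<noteq> 3/2" "\<bar>x - 3/2\<bar> < e" using e by (auto simp: x_def min_def)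
      then show "\<exists>x'\<in>of_real ` {1<..<2}. x' \<noteq> complex_of_real (3/2) \<and> dist x' (of_real (3/2)) < e"
        by (intro bexI[of _ "of_real x"]) (auto simp only: dist_norm of_real_diff[symmetric] norm_of_real of_real_eq_iff greaterThanLessThan_iff)
    qed
    show "f z = 0" if "z \<in> of_real ` {1<..<2}" for z using that real by auto
    show "w \<in> S" using w by (auto simp: S_def)
  qed
  then show ?thesis by (simp add: f_def)
qed

text \<open>The functional equation read as a definition for \<open>Re s < 0\<close>.\<close>

definition left_zeta :: "complex \<Rightarrow> complex" where
  "left_zeta s = 2 * (2 * of_real pi) powr (-(1-s)) * cos (of_real pi * (1 - s) / 2) * Gamma (1 - s) * right_zeta (1 - s)"

definition glued_zeta :: "complex \<Rightarrow> complex" where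
  "glued_zeta s = (if s = 1 then 0 else if Re s > -1 then right_zeta s else left_zeta s)"

lemma glued_zeta_eq_left: "Re s < 0 \<Longrightarrow> glued_zeta s = left_zeta s"
  using right_zeta_functional_equation[of "1 - s"] by (auto simp: glued_zeta_def left_zeta_def)

lemma glued_zeta_eq_right: "Re s > -1 \<Longrightarrow> s \<noteq> 1 \<Longrightarrow> glued_zeta s = right_zeta s"
  by (simp add: glued_zeta_def)

lemma glued_zeta_holomorphic: "glued_zeta holomorphic_on (- {1})"
proof -
  have "left_zeta holomorphic_on {s. Re s < 0}"
  proof -
    have "right_zeta \<circ> (\<lambda>w. 1 - w) holomorphic_on {s. Re s < 0}"
      by (rule holomorphic_on_compose_gen[OF _ right_zeta_holomorphic])
         (auto intro!: holomorphic_intros)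
    moreover have "Gamma \<circ> (\<lambda>w. 1 - w) holomorphic_on {s. Re s < 0}"
      by (rule holomorphic_on_compose_gen[where t = "{s. Re s > 0}"])
         (auto intro!: holomorphic_intros holomorphic_Gamma simp: nonpos_Ints_def)
    moreover have "1 - z \<notin> \<int>\<^sub>\<le>\<^sub>0" if "Re z < 0" for z :: complex
      using that by (auto simp: nonpos_Ints_def complex_eq_iff)
    ultimately show ?thesis
      unfolding left_zeta_def o_def by (intro holomorphic_intros) auto
  qed
  then have "glued_zeta holomorphic_on {s. Re s < 0}"
    by (rule holomorphic_transform) (simp add: glued_zeta_eq_left)
  moreover have "glued_zeta holomorphic_on ({s. Re s > -1} - {1})"
    using right_zeta_holomorphic by (rule holomorphic_transform) (simp add: glued_zeta_eq_right)
  ultimately have "glued_zeta holomorphic_on ({s. Re s < 0} \<union> ({s. Re s > -1} - {1}))"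
    by (intro holomorphic_on_Un open_Diff open_halfspace_Re_gt open_halfspace_Re_lt) auto
  also have "{s. Re s < 0} \<union> ({s. Re s > -1} - {1}) = - {1::complex}" by (auto simp: complex_eq_iff)
  finally show ?thesis .
qed

lemma zeta_eq_glued_zeta: "zeta = glued_zeta"
  unfolding zeta_def
proof (rule the_equality)
  show P: "glued_zeta holomorphic_on (- {1}) \<and> glued_zeta 1 = 0 \<and>
     (\<forall>s. Re s > 1 \<longrightarrow> (\<lambda>n. 1 / of_nat (Suc n) powr s) sums glued_zeta s)"
    using right_zeta_sums glued_zeta_holomorphic by (auto simp: glued_zeta_def)
  fix g :: "complex \<Rightarrow> complex"
  assume g: "g holomorphic_on (- {1}) \<and> g 1 = 0 \<and>
     (\<forall>s. Re s > 1 \<longrightarrow> (\<lambda>n. 1 / of_nat (Suc n) powr s) sums g s)"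
  show "g = glued_zeta"
  proof
    fix z
    show "g z = glued_zeta z"
    proof (cases "z = 1")
      case False
      show ?thesis
      proof (rule analytic_continuation_open[of "{s. Re s > 1}" "- {1}" g glued_zeta])
        show "open {s. 1 < Re s}" by (rule open_halfspace_Re_gt)
        show "{s. 1 < Re s} \<noteq> {}" by (auto intro!: exI[of _ 2])
        show "connected (- {1::complex})"
          by (rule connected_punctured_universe) simp
        show "g w = glued_zeta w" if "w \<in> {s. 1 < Re s}" for w
          using that g P by (metis mem_Collect_eq sums_unique2)
      qed (use False g P in auto)
    next
      case True
      then show ?thesis using g P by simp
    qed
  qed
qed

lemma zeta_eq_right_zeta: "Re s > -1 \<Longrightarrow> s \<noteq> 1 \<Longrightarrow> zeta s = right_zeta s"
  unfolding zeta_eq_glued_zeta by (rule glued_zeta_eq_right)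

lemma zeta_eq_left_zeta: "Re s < 0 \<Longrightarrow> zeta s = left_zeta s"
  unfolding zeta_eq_glued_zeta by (rule glued_zeta_eq_left)

lemma zeta_holomorphic: "zeta holomorphic_on (- {1})"
  unfolding zeta_eq_glued_zeta by (rule glued_zeta_holomorphic)

lemma zeta_sums: "Re s > 1 \<Longrightarrow> (\<lambda>n. 1 / of_nat (Suc n) powr s) sums zeta s"
  using right_zeta_sums[of s] zeta_eq_right_zeta[of s] by (cases "s = 1") auto

lemma holomorphic_on_zeta [holomorphic_intros]:
  assumes "f holomorphic_on A" "\<And>z. z \<in> A \<Longrightarrow> f z \<noteq> 1"
  shows "(\<lambda>z. zeta (f z)) holomorphic_on A"
proof -
  have "f ` A \<subseteq> - {1}" by (rule image_subsetI) (simp add: assms(2))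
  from holomorphic_on_compose_gen[OF assms(1) zeta_holomorphic this] show ?thesis by (simp add: o_def)
qed

text \<open>For \<open>Re w > 1\<close> this is how zeta was continued; both sides are holomorphic off the integers, whose
  complement is connected.\<close>

lemma zeta_functional_equation:
  assumes w: "w \<notin> \<int>"
  shows "zeta (1 - w) = 2 * (2 * of_real pi) powr (-w) * cos (of_real pi * w / 2) * Gamma w * zeta w"
proof (rule analytic_continuation_open[of "{s. Re s > 1} - \<int>" "- \<int>" "\<lambda>w. zeta (1 - w)"
      "\<lambda>w. 2 * (2 * of_real pi) powr (-w) * cos (of_real pi * w / 2) * Gamma w * zeta w"])
  show "open ({s. Re s > 1} - \<int> :: complex set)" by (intro open_Diff open_halfspace_Re_gt closed_Ints)
  show "open (- \<int> :: complex set)" by (simp add: open_Compl closed_Ints)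
  have "Complex (3/2) 1 \<in> {s. Re s > 1} - \<int>" by (auto simp: Ints_def complex_eq_iff)
  then show "{s. Re s > 1} - \<int> \<noteq> ({} :: complex set)" by blast
  \<comment> \<open>Off a countable set the plane stays connected.\<close>
  have "countable (\<int> :: complex set)" by (simp add: Ints_def)
  then show "connected (- \<int> :: complex set)"
    by (intro path_connected_imp_connected path_connected_complement_countable) auto
  have one: "z \<noteq> 1" "1 - z \<noteq> 1" if "z \<in> - \<int>" for z :: complex using that by auto
  show "(\<lambda>w. zeta (1 - w)) holomorphic_on - \<int>"
    using one by (intro holomorphic_intros) auto
  have "z \<notin> \<int>\<^sub>\<le>\<^sub>0" if "z \<in> - \<int>" for z :: complex using nonpos_Ints_subset_Ints that by auto
  then show "(\<lambda>w. 2 * (2 * of_real pi) powr (-w) * cos (of_real pi * w / 2) * Gamma w * zeta w) holomorphic_on - \<int>"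
    using one by (intro holomorphic_intros) auto
  show "zeta (1 - z) = 2 * (2 * of_real pi) powr (-z) * cos (of_real pi * z / 2) * Gamma z * zeta z"
    if "z \<in> {s. Re s > 1} - \<int>" for z
  proof -
    have "zeta (1 - z) = left_zeta (1 - z)" using that by (intro zeta_eq_left_zeta) auto
    moreover have "zeta z = right_zeta z" using that by (intro zeta_eq_right_zeta) auto
    ultimately show ?thesis by (simp add: left_zeta_def)
  qed
qed (use w in auto)

text \<open>On \<open>Re s < -1/2\<close> the functional equation expresses zeta by its values to the right of 3/2, and the
  exponential growth of the cosine cancels against the decay of Gamma.\<close>

lemma norm_zeta_strip_le:
  fixes a b :: real
  shows "\<exists>C N. C > 0 \<and> (\<forall>x t. a \<le> x \<longrightarrow> x \<le> b \<longrightarrow> \<bar>t\<bar> \<ge> 1 \<longrightarrow>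
    norm (zeta (Complex x t)) \<le> C * (1 + \<bar>t\<bar>) ^ N)"
proof -
  define M where "M = 1 + \<bar>a\<bar> + \<bar>b\<bar>"
  obtain C1 where C1: "C1 > 0" "\<And>s. Re s \<ge> -1/2 \<Longrightarrow> \<bar>Im s\<bar> \<ge> 1 \<Longrightarrow> norm (right_zeta s) \<le> C1 * (1 + norm s) ^ 2"
    using norm_right_zeta_le by blast
  obtain C2 N where C2: "C2 > 0" "\<And>x t. 3/2 \<le> x \<Longrightarrow> x \<le> M \<Longrightarrow>
      norm (Gamma (Complex x t)) \<le> C2 * (1 + \<bar>t\<bar>) ^ N * exp (- pi * \<bar>t\<bar> / 2)"
    using norm_Gamma_strip_le[of "3/2" M] by auto
  have M: "M \<ge> 1" by (simp add: M_def)
  have r: "norm (zeta (Complex x t)) \<le> C1 * (1 + M) ^ 2 * (1 + \<bar>t\<bar>) ^ 2"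
    if x: "x \<ge> -1/2" "\<bar>x\<bar> \<le> M" "\<bar>t\<bar> \<ge> 1" for x t
  proof -
    have "zeta (Complex x t) = right_zeta (Complex x t)"
    proof (rule zeta_eq_right_zeta)
      show "-1 < Re (Complex x t)" using x(1) by (simp add: field_simps)
      show "Complex x t \<noteq> 1" using x(3) by (auto simp: complex_eq_iff)
    qed
    also have "norm \<dots> \<le> C1 * (1 + norm (Complex x t)) ^ 2" using x by (intro C1) auto
    also have "\<dots> \<le> C1 * ((1 + M) * (1 + \<bar>t\<bar>)) ^ 2"
    proof (intro mult_left_mono power_mono)
      have "norm (Complex x t) \<le> M + \<bar>t\<bar>" using cmod_le[of "Complex x t"] x by simp
      also have "\<dots> \<le> M + \<bar>t\<bar> + M * \<bar>t\<bar>" using M by simp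
      finally show "1 + norm (Complex x t) \<le> (1 + M) * (1 + \<bar>t\<bar>)" by (simp add: algebra_simps)
    qed (use C1 in auto)
    finally show ?thesis by (simp add: power_mult_distrib mult.assoc)
  qed
  have l: "norm (zeta (Complex x t)) \<le> 2 * C2 * (C1 * (1 + M) ^ 2) * (1 + \<bar>t\<bar>) ^ (N + 2)"
    if x: "x < -1/2" "1 - x \<le> M" "\<bar>t\<bar> \<ge> 1" for x t
  proof -
    define w where "w = Complex (1 - x) (-t)"
    have w: "Complex x t = 1 - w" by (simp add: w_def complex_eq_iff)
    have x32: "3/2 \<le> 1 - x" using x(1) by (simp add: field_simps)
    have zw: "norm (zeta w) \<le> C1 * (1 + M) ^ 2 * (1 + \<bar>t\<bar>) ^ 2"
      using r[of "1 - x" "-t"] x x32 by (auto simp: w_def)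
    have "zeta (Complex x t) = left_zeta (Complex x t)"
      using x(1) by (intro zeta_eq_left_zeta) (simp add: field_simps)
    also have "\<dots> = 2 * (2 * of_real pi) powr (-w) * cos (of_real pi * w / 2) * Gamma w * zeta w"
      using x32 x(3) zeta_eq_right_zeta[of w] by (simp add: left_zeta_def w) (simp add: w_def complex_eq_iff)
    also have "norm \<dots> = 2 * norm ((2 * of_real pi) powr (-w)) * norm (cos (of_real pi * w / 2)) * norm (Gamma w) * norm (zeta w)"
      by (simp add: norm_mult)
    also have "\<dots> \<le> 2 * 1 * exp (pi * \<bar>t\<bar> / 2) * (C2 * (1 + \<bar>t\<bar>) ^ N * exp (- pi * \<bar>t\<bar> / 2)) * (C1 * (1 + M) ^ 2 * (1 + \<bar>t\<bar>) ^ 2)"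
    proof (intro mult_mono zw mult_nonneg_nonneg)
      have "norm ((2 * of_real pi) powr (-w)) = (2 * pi) powr (x - 1)"
        by (subst norm_powr_real_powr) (auto simp: w_def)
      also have "\<dots> \<le> (2 * pi) powr 0" using pi_gt3 x32 by (intro powr_mono) auto
      finally show "norm ((2 * of_real pi) powr (-w)) \<le> 1" by simp
      show "norm (cos (of_real pi * w / 2)) \<le> exp (pi * \<bar>t\<bar> / 2)"
        using norm_cos_half_pi_le[of "1 - x" "-t"] by (simp add: w_def)
      show "norm (Gamma w) \<le> C2 * (1 + \<bar>t\<bar>) ^ N * exp (- pi * \<bar>t\<bar> / 2)"
        using C2(2)[of "1 - x" "-t"] x x32 by (simp add: w_def)
    qed (use C1 C2 in auto)
    also have "\<dots> = 2 * C2 * (C1 * (1 + M) ^ 2) * (1 + \<bar>t\<bar>) ^ (N + 2) * (exp (pi * \<bar>t\<bar> / 2) * exp (- pi * \<bar>t\<bar> / 2))"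
      by (simp only: power_add mult_ac mult_1_left)
    also have "exp (pi * \<bar>t\<bar> / 2) * exp (- pi * \<bar>t\<bar> / 2) = 1" by (simp flip: exp_add)
    finally show ?thesis by simp
  qed
  define C where "C = C1 * (1 + M) ^ 2 + 2 * C2 * (C1 * (1 + M) ^ 2)"
  have pos: "0 < C1 * (1 + M) ^ 2" "0 < 2 * C2 * (C1 * (1 + M) ^ 2)" using C1 C2 M by auto
  show ?thesis
  proof (intro exI[of _ C] exI[of _ "N + 2"] conjI allI impI)
    show "C > 0" unfolding C_def by (intro add_pos_pos pos)
    fix x t :: real assume x: "a \<le> x" "x \<le> b" "\<bar>t\<bar> \<ge> 1"
    show "norm (zeta (Complex x t)) \<le> C * (1 + \<bar>t\<bar>) ^ (N + 2)"
    proof (cases "x \<ge> -1/2")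
      case True
      have "norm (zeta (Complex x t)) \<le> C1 * (1 + M) ^ 2 * (1 + \<bar>t\<bar>) ^ 2"
        using x by (intro r True) (auto simp: M_def)
      also have "\<dots> \<le> C * (1 + \<bar>t\<bar>) ^ (N + 2)"
        using pos by (intro mult_mono power_increasing) (auto simp: C_def)
      finally show ?thesis .
    next
      case False
      have "norm (zeta (Complex x t)) \<le> 2 * C2 * (C1 * (1 + M) ^ 2) * (1 + \<bar>t\<bar>) ^ (N + 2)"
        using x False by (intro l) (auto simp: M_def)
      also have "\<dots> \<le> C * (1 + \<bar>t\<bar>) ^ (N + 2)"
        using pos by (intro mult_right_mono) (auto simp: C_def)
      finally show ?thesis .
    qed
  qed
qed

section \<open>Dirichlet series of the Piltz function\<close>

text \<open>The tuples counted by the Piltz function, without fixing the product. Indexing the \<open>k\<close>-fold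
  product of Dirichlet series by these lists makes it a plain product of sums, and grouping the lists
  by their product gives the Piltz coefficients.\<close>

definition factorisations :: "nat \<Rightarrow> nat list set" where
  "factorisations k = {xs. length xs = k \<and> (\<forall>x\<in>set xs. x > 0)}"

lemma factorisations_Suc:
  "factorisations (Suc k) = (\<lambda>(x, xs). x # xs) ` ({0<..} \<times> factorisations k)"
  by (force simp: factorisations_def length_Suc_conv image_iff)

lemma prod_list_factorisation_pos: "xs \<in> factorisations k \<Longrightarrow> prod_list xs > 0"
  unfolding factorisations_def by (induction xs arbitrary: k) auto

lemma le_prod_list_factorisation: "xs \<in> factorisations k \<Longrightarrow> x \<in> set xs \<Longrightarrow> x \<le> prod_list xs"
proof (induction xs arbitrary: k)
  case (Cons y ys)
  have ys: "ys \<in> factorisations (length ys)" "y > 0" using Cons.prems by (auto simp: factorisations_def)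
  have "prod_list ys > 0" using prod_list_factorisation_pos[OF ys(1)] .
  then show ?case using Cons.IH[OF ys(1)] Cons.prems(2) ys(2)
    by (auto intro: order_trans[of _ "prod_list ys"])
qed simp

lemma piltz_eq_card: "piltz k n = card {xs \<in> factorisations k. prod_list xs = n}"
  unfolding piltz_def factorisations_def by (rule arg_cong[of _ _ card]) auto

lemma finite_factorisations: "finite {xs \<in> factorisations k. prod_list xs = n}"
proof (rule finite_subset)
  show "{xs \<in> factorisations k. prod_list xs = n} \<subseteq> {xs. set xs \<subseteq> {..n} \<and> length xs = k}"
    using le_prod_list_factorisation by (fastforce simp: factorisations_def)
qed (rule finite_lists_length_eq, simp)

text \<open>The sum over lists of length \<open>k + 1\<close> is a sum over pairs of head and tail. Summability is a
  hypothesis because it comes from the real case, where nonnegativity settles it.\<close>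

lemma has_sum_factorisations:
  fixes f :: "nat \<Rightarrow> 'a :: {real_normed_field, banach}"
  assumes mult: "\<And>a b. a > 0 \<Longrightarrow> b > 0 \<Longrightarrow> f (a * b) = f a * f b" and one: "f 1 = 1"
    and Z: "(f has_sum Z) {0<..}"
    and summable: "\<And>k. (\<lambda>xs. f (prod_list xs)) summable_on factorisations k"
  shows "((\<lambda>xs. f (prod_list xs)) has_sum Z ^ k) (factorisations k)"
proof (induction k)
  case 0
  have "factorisations 0 = {[]}" by (auto simp: factorisations_def)
  then show ?case using has_sum_finite[of "{[]}" "\<lambda>xs. f (prod_list xs)"] one by simp
next
  case (Suc k)
  have inj: "inj_on (\<lambda>(x, xs). x # xs) ({0<..} \<times> factorisations k)" by (auto simp: inj_on_def)
  have "((\<lambda>p. f (fst p) * f (prod_list (snd p))) has_sum (Z * Z ^ k)) ({0<..} \<times> factorisations k)"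
  proof (rule has_sum_SigmaI)
    show "((\<lambda>xs. f (fst (x, xs)) * f (prod_list (snd (x, xs)))) has_sum f x * Z ^ k) (factorisations k)" for x
      using has_sum_cmult_right[OF Suc] by simp
    show "((\<lambda>x. f x * Z ^ k) has_sum Z * Z ^ k) {0<..}"
      by (rule has_sum_cmult_left[OF Z])
    have "((\<lambda>xs. f (prod_list xs)) \<circ> (\<lambda>(x, xs). x # xs)) summable_on ({0<..} \<times> factorisations k)"
      using summable[of "Suc k"] unfolding factorisations_Suc by (subst (asm) summable_on_reindex[OF inj])
    then show "(\<lambda>p. f (fst p) * f (prod_list (snd p))) summable_on {0<..} \<times> factorisations k"
      by (rule summable_on_cong[THEN iffD1, rotated]) (auto simp: mult prod_list_factorisation_pos)
  qed
  then have "((\<lambda>xs. f (prod_list xs)) \<circ> (\<lambda>(x, xs). x # xs) has_sum Z * Z ^ k) ({0<..} \<times> factorisations k)"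
    by (rule has_sum_cong[THEN iffD1, rotated]) (auto simp: mult prod_list_factorisation_pos)
  then show ?case unfolding factorisations_Suc by (subst has_sum_reindex[OF inj]) simp
qed

lemma summable_on_factorisations_nonneg:
  fixes f :: "nat \<Rightarrow> real"
  assumes mult: "\<And>a b. a > 0 \<Longrightarrow> b > 0 \<Longrightarrow> f (a * b) = f a * f b"
    and nonneg: "\<And>a. f a \<ge> 0" and Z: "f summable_on {0<..}"
  shows "(\<lambda>xs. f (prod_list xs)) summable_on factorisations k"
proof (induction k)
  case 0
  have "factorisations 0 = {[]}" by (auto simp: factorisations_def)
  then show ?case by simp
next
  case (Suc k)
  have inj: "inj_on (\<lambda>(x, xs). x # xs) ({0<..} \<times> factorisations k)" by (auto simp: inj_on_def)
  obtain S where S: "((\<lambda>xs. f (prod_list xs)) has_sum S) (factorisations k)"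
    using Suc by (auto simp: summable_on_def)
  have "(\<lambda>p. f (fst p) * f (prod_list (snd p))) summable_on {0<..} \<times> factorisations k"
  proof (rule summable_on_SigmaI)
    show "((\<lambda>xs. f (fst (x, xs)) * f (prod_list (snd (x, xs)))) has_sum f x * S) (factorisations k)" for x
      using has_sum_cmult_right[OF S] by simp
    show "(\<lambda>x. f x * S) summable_on {0<..}"
      by (rule summable_on_cmult_left[OF Z])
  qed (auto simp: nonneg)
  then have "((\<lambda>xs. f (prod_list xs)) \<circ> (\<lambda>(x, xs). x # xs)) summable_on ({0<..} \<times> factorisations k)"
    by (rule summable_on_cong[THEN iffD1, rotated]) (auto simp: mult prod_list_factorisation_pos)
  then show ?case unfolding factorisations_Suc by (subst summable_on_reindex[OF inj]) simp
qed

lemma has_sum_piltz: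
  fixes f :: "nat \<Rightarrow> 'a :: {real_normed_field, banach}"
  assumes "((\<lambda>xs. f (prod_list xs)) has_sum S) (factorisations k)"
  shows "((\<lambda>n. of_nat (piltz k n) * f n) has_sum S) {0<..}"
proof (rule has_sum_SigmaD)
  let ?B = "\<lambda>n. {xs \<in> factorisations k. prod_list xs = n}"
  have inj: "inj_on snd (Sigma {0<..} ?B)" by (auto simp: inj_on_def)
  have img: "snd ` Sigma {0<..} ?B = factorisations k"
    using prod_list_factorisation_pos by (force simp: image_iff)
  show "((\<lambda>p. f (prod_list (snd p))) has_sum S) (Sigma {0<..} ?B)"
  proof -
    have "((\<lambda>xs. f (prod_list xs)) has_sum S) (snd ` Sigma {0<..} ?B)" using assms by (simp only: img)
    then show ?thesis by (simp only: has_sum_reindex[OF inj] o_def)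
  qed
  show "((\<lambda>xs. f (prod_list (snd (n, xs)))) has_sum of_nat (piltz k n) * f n) (?B n)" for n
  proof -
    have "((\<lambda>xs. f (prod_list xs)) has_sum (\<Sum>xs\<in>?B n. f (prod_list xs))) (?B n)"
      by (rule has_sum_finite[OF finite_factorisations])
    also have "(\<Sum>xs\<in>?B n. f (prod_list xs)) = (\<Sum>xs\<in>?B n. f n)" by (rule sum.cong) auto
    also have "\<dots> = of_nat (piltz k n) * f n" by (simp add: piltz_eq_card)
    finally show ?thesis by simp
  qed
qed

lemma has_sum_positive_iff_Suc:
  fixes f :: "nat \<Rightarrow> 'a :: {comm_monoid_add, topological_space}"
  shows "(f has_sum S) {0<..} \<longleftrightarrow> ((\<lambda>n. f (Suc n)) has_sum S) UNIV"
proof -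
  have "{0<..} = range Suc" by (auto simp: image_iff gr0_conv_Suc)
  then show ?thesis by (simp add: has_sum_reindex o_def)
qed

lemma summable_piltz_powr:
  fixes \<sigma> :: real
  assumes "\<sigma> > 1"
  shows "summable (\<lambda>n. real (piltz k (Suc n)) * real (Suc n) powr (-\<sigma>))"
    and "(\<lambda>xs. real (prod_list xs) powr (-\<sigma>)) summable_on factorisations k"
proof -
  have "summable (\<lambda>n. real (Suc n) powr (-\<sigma>))"
    by (subst summable_Suc_iff) (use assms in \<open>simp add: summable_real_powr_iff\<close>)
  then have "(\<lambda>n. real (Suc n) powr (-\<sigma>)) summable_on UNIV"
    by (subst summable_on_UNIV_nonneg_real_iff) auto
  then have "(\<lambda>n. real n powr (-\<sigma>)) summable_on {0<..}"
    by (simp add: summable_on_def has_sum_positive_iff_Suc)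
  then show *: "(\<lambda>xs. real (prod_list xs) powr (-\<sigma>)) summable_on factorisations k"
    by (rule summable_on_factorisations_nonneg[rotated 2]) (auto simp: powr_mult)
  then obtain S where "((\<lambda>xs. real (prod_list xs) powr (-\<sigma>)) has_sum S) (factorisations k)"
    by (auto simp: summable_on_def)
  from has_sum_piltz[OF this]
  have "((\<lambda>n. real (piltz k (Suc n)) * real (Suc n) powr (-\<sigma>)) has_sum S) UNIV"
    by (simp add: has_sum_positive_iff_Suc)
  then show "summable (\<lambda>n. real (piltz k (Suc n)) * real (Suc n) powr (-\<sigma>))"
    by (auto dest: has_sum_imp_sums simp: sums_iff)
qed

lemma piltz_sums_zeta_power:
  assumes s: "Re s > 1"
  shows "(\<lambda>n. of_nat (piltz k (Suc n)) * of_nat (Suc n) powr (-s)) sums (zeta s ^ k)"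
proof -
  let ?f = "\<lambda>n. complex_of_nat n powr (-s)"
  have norm_f: "norm (?f n) = real n powr (- Re s)" if "n > 0" for n
    using that by (subst norm_powr_real_powr) auto
  have "summable (\<lambda>n. real (Suc n) powr (- Re s))"
    by (subst summable_Suc_iff) (use s in \<open>simp add: summable_real_powr_iff\<close>)
  then have "summable (\<lambda>n. norm (?f (Suc n)))" by (simp only: norm_f zero_less_Suc)
  moreover have "(\<lambda>n. ?f (Suc n)) sums zeta s"
    using zeta_sums[OF s] by (simp add: powr_minus_divide)
  ultimately have "((\<lambda>n. ?f (Suc n)) has_sum zeta s) UNIV"
    by (rule norm_summable_imp_has_sum)
  then have Z: "(?f has_sum zeta s) {0<..}" by (simp add: has_sum_positive_iff_Suc)
  have "((\<lambda>xs. ?f (prod_list xs)) has_sum zeta s ^ k) (factorisations k)"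
  proof (rule has_sum_factorisations[OF _ _ Z])
    show "?f (a * b) = ?f a * ?f b" if "a > 0" "b > 0" for a b
      using powr_times_real[of "of_nat a" "of_nat b" "-s"] that by simp
    show "(\<lambda>xs. ?f (prod_list xs)) summable_on factorisations j" for j
    proof (rule abs_summable_summable)
      show "(\<lambda>xs. norm (?f (prod_list xs))) summable_on factorisations j"
        using summable_piltz_powr(2)[OF s, of j]
        by (rule summable_on_cong[THEN iffD1, rotated]) (use prod_list_factorisation_pos norm_f in metis)
    qed
  qed simp
  from has_sum_piltz[OF this] show ?thesis
    by (simp only: has_sum_positive_iff_Suc has_sum_imp_sums)
qed

lemma powr_of_real_exp:
  assumes "x > 0"
  shows "complex_of_real x powr z = exp (z * of_real (ln x))"
  using assms by (simp add: powr_def Ln_of_real)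

text \<open>On a vertical line the terms of a Dirichlet series have constant modulus, so absolute convergence at
  \<open>c\<close> alone dominates the whole series of integrals.\<close>

lemma dirichlet_series_integral:
  fixes g :: "real \<Rightarrow> complex" and a :: "nat \<Rightarrow> real" and D :: "real \<Rightarrow> complex"
  assumes g: "integrable lborel g" and nonneg: "\<And>n. a n \<ge> 0"
    and summable: "summable (\<lambda>n. a n * real (Suc n) powr (-c))"
    and D: "\<And>t. (\<lambda>n. of_real (a n) * of_nat (Suc n) powr (- Complex c t)) sums D t"
  shows "integrable lborel (\<lambda>t. g t * D t)"
    and "(\<lambda>n. of_real (a n) * (LINT t|lborel. g t * of_nat (Suc n) powr (- Complex c t))) sums (LINT t|lborel. g t * D t)"
proof -
  have [measurable]: "g \<in> borel_measurable borel" using g by auto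
  define f where "f n t = of_real (a n) * (g t * of_nat (Suc n) powr (- Complex c t))" for n t
  have norm_f: "norm (f n t) = (a n * real (Suc n) powr (-c)) * norm (g t)" for n t
  proof -
    have "norm (of_nat (Suc n) powr (- Complex c t)) = real (Suc n) powr (-c)"
      by (subst norm_powr_real_powr) auto
    then show ?thesis using nonneg[of n] by (simp add: f_def norm_mult)
  qed
  have meas [measurable]: "(\<lambda>t. of_nat (Suc n) powr (- Complex c t)) \<in> borel_measurable borel" for n
  proof -
    have "of_nat (Suc n) powr z = exp (z * of_real (ln (real (Suc n))))" for z :: complex
      using powr_of_real_exp[of "real (Suc n)" z] by simp
    then show ?thesis
      unfolding complex_eq by (simp only:) (intro borel_measurable_continuous_onI continuous_intros)
  qed
  have sum_f: "(\<lambda>n. f n t) sums (g t * D t)" for t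
    using sums_mult[OF D[of t], of "g t"] by (simp add: f_def mult_ac)
  have 1: "integrable lborel (f n)" for n
  proof (rule Bochner_Integration.integrable_bound)
    show "integrable lborel (\<lambda>t. (a n * real (Suc n) powr (-c)) * norm (g t))" using g by auto
    show "f n \<in> borel_measurable lborel" unfolding f_def by measurable
  qed (use nonneg norm_f in \<open>auto simp: abs_mult\<close>)
  have 2: "AE t in lborel. summable (\<lambda>n. norm (f n t))"
    unfolding norm_f by (intro AE_I2 summable_mult2 summable)
  have 3: "summable (\<lambda>n. LINT t|lborel. norm (f n t))"
    unfolding norm_f integral_mult_right_zero by (intro summable_mult2 summable)
  have eq: "(\<Sum>n. f n t) = g t * D t" for t using sum_f by (simp add: sums_iff)
  show "integrable lborel (\<lambda>t. g t * D t)"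
    using integrable_suminf[OF 1 2 3] unfolding eq .
  have "(\<lambda>n. integral\<^sup>L lborel (f n)) sums (LINT t|lborel. g t * D t)"
    using sums_integral[OF 1 2 3] unfolding eq .
  then show "(\<lambda>n. of_real (a n) * (LINT t|lborel. g t * of_nat (Suc n) powr (- Complex c t))) sums (LINT t|lborel. g t * D t)"
    unfolding f_def by simp
qed

section \<open>Moving a vertical line of integration\<close>

lemma integrable_inverse_1_plus_square_lborel: "integrable lborel (\<lambda>t::real. 1 / (1 + t\<^sup>2))"
proof -
  have "einterval (-\<infinity>) \<infinity> = UNIV" by (auto simp: einterval_def)
  then show ?thesis
    using integrable_inverse_1_plus_square by (simp add: set_integrable_def inverse_eq_divide)
qed

lemma integrable_of_inverse_square_decay:
  fixes g :: "real \<Rightarrow> complex"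
  assumes cont: "continuous_on UNIV g" and decay: "\<And>t. \<bar>t\<bar> \<ge> T \<Longrightarrow> norm (g t) \<le> C / (1 + t\<^sup>2)"
  shows "integrable lborel g"
proof -
  have "compact (g ` {-T..T})"
    by (intro compact_continuous_image continuous_on_subset[OF cont]) auto
  then obtain B where B: "\<And>t. t \<in> {-T..T} \<Longrightarrow> norm (g t) \<le> B"
    using compact_imp_bounded bounded_iff by (metis image_eqI)
  define D where "D = max C (\<bar>B\<bar> * (1 + T\<^sup>2))"
  have pos: "1 + t\<^sup>2 > 0" for t :: real by (simp add: add_pos_nonneg)
  have bound: "norm (g t) \<le> D * (1 / (1 + t\<^sup>2))" for t
  proof (cases "\<bar>t\<bar> \<ge> T")
    case True
    have "norm (g t) \<le> C / (1 + t\<^sup>2)" by (rule decay[OF True])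
    also have "\<dots> \<le> D / (1 + t\<^sup>2)" using pos[of t] by (intro divide_right_mono) (auto simp: D_def)
    finally show ?thesis by simp
  next
    case False
    then have t2: "t\<^sup>2 \<le> T\<^sup>2" using abs_le_square_iff[of t T] by linarith
    have "norm (g t) * (1 + t\<^sup>2) \<le> \<bar>B\<bar> * (1 + T\<^sup>2)"
    proof (rule mult_mono)
      have "t \<in> {-T..T}" using False by auto
      from B[OF this] show "norm (g t) \<le> \<bar>B\<bar>" by linarith
    qed (use t2 pos[of t] in auto)
    then have "norm (g t) * (1 + t\<^sup>2) \<le> D" by (simp add: D_def)
    then show ?thesis using pos[of t] by (simp add: field_simps)
  qed
  show ?thesis
  proof (rule Bochner_Integration.integrable_bound)
    show "integrable lborel (\<lambda>t. D * (1 / (1 + t\<^sup>2)))"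
      by (intro integrable_mult_right integrable_inverse_1_plus_square_lborel)
    show "g \<in> borel_measurable lborel"
      using borel_measurable_continuous_onI[OF cont] by simp
    show "AE t in lborel. norm (g t) \<le> norm (D * (1 / (1 + t\<^sup>2)))"
      unfolding real_norm_def by (rule AE_I2) (rule order_trans[OF bound abs_ge_self])
  qed
qed

text \<open>Relates the contour integrals, which are gauge integrals over finite segments, to the Lebesgue
  integral over the line.\<close>

lemma integral_symmetric_interval_tendsto:
  fixes g :: "real \<Rightarrow> complex"
  assumes g: "integrable lborel g"
  shows "(\<lambda>n. integral {- real n..real n} g) \<longlonglongrightarrow> (LINT t|lborel. g t)"
proof -
  have [measurable]: "g \<in> borel_measurable borel" using g by auto
  have "(\<lambda>n. LINT t|lborel. indicator {- real n..real n} t *\<^sub>R g t) \<longlonglongrightarrow> (LINT t|lborel. g t)"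
  proof (rule integral_dominated_convergence)
    show "integrable lborel (\<lambda>t. norm (g t))" using g by simp
    show "AE t in lborel. (\<lambda>n. indicator {- real n..real n} t *\<^sub>R g t) \<longlonglongrightarrow> g t"
    proof (rule AE_I2)
      fix t :: real
      have "\<forall>\<^sub>F n in sequentially. indicator {- real n..real n} t *\<^sub>R g t = g t"
        using eventually_ge_at_top[of "nat \<lceil>\<bar>t\<bar>\<rceil>"]
      proof eventually_elim
        case (elim n)
        then have "\<bar>t\<bar> \<le> real n" by linarith
        then show ?case by (auto simp: indicator_def)
      qed
      then show "(\<lambda>n. indicator {- real n..real n} t *\<^sub>R g t) \<longlonglongrightarrow> g t"
        by (rule tendsto_eventually)
    qed
  qed (auto simp: indicator_def)
  moreover have "(LINT t|lborel. indicator {- real n..real n} t *\<^sub>R g t) = integral {- real n..real n} g" for n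
  proof -
    have "set_integrable lborel {- real n..real n} g"
      unfolding set_integrable_def by (rule integrable_mult_indicator) (use g in auto)
    from set_borel_integral_eq_integral(2)[OF this] show ?thesis
      by (simp add: set_lebesgue_integral_def)
  qed
  ultimately show ?thesis by simp
qed

lemma continuous_on_vertical_line:
  assumes "continuous_on S f" "\<And>t. Complex x t \<in> S"
  shows "continuous_on T (\<lambda>t. f (Complex x t))"
proof -
  have "continuous_on T (\<lambda>t. Complex x t)"
    unfolding complex_eq by (intro continuous_intros)
  then show ?thesis by (rule continuous_on_compose2[OF assms(1)]) (use assms(2) in auto)
qed

text \<open>The residue theorem on rectangles of growing height: by the decay of \<open>f\<close> the horizontal sides
  contribute nothing in the limit.\<close>

lemma vertical_line_shift:
  fixes f :: "complex \<Rightarrow> complex" and a b x0 x1 T C :: real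
  assumes ab: "x0 < a" "a < Re p" "Re p < b" "b < x1"
    and holo: "f holomorphic_on {w. x0 < Re w \<and> Re w < x1} - {p}"
    and decay: "\<And>x t. a \<le> x \<Longrightarrow> x \<le> b \<Longrightarrow> \<bar>t\<bar> \<ge> T \<Longrightarrow> norm (f (Complex x t)) \<le> C / (1 + t\<^sup>2)"
  shows "(LINT t|lborel. f (Complex b t)) - (LINT t|lborel. f (Complex a t)) = 2 * of_real pi * residue f p"
proof -
  define U where "U = {w. x0 < Re w \<and> Re w < x1}"
  have U: "open U" "convex U"
  proof -
    have "U = {w. x0 < Re w} \<inter> {w. Re w < x1}" by (auto simp: U_def)
    then show "open U" "convex U"
      by (auto intro!: open_Int convex_Int open_halfspace_Re_gt open_halfspace_Re_lt convex_halfspace_Re_gt convex_halfspace_Re_lt)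
  qed
  have cont: "continuous_on (U - {p}) f"
    using holomorphic_on_imp_continuous_on[OF holo] by (simp add: U_def)
  have cont_line: "continuous_on S (\<lambda>t. f (Complex x t))" if "x \<in> {a, b}" for x S
    by (rule continuous_on_vertical_line[OF cont]) (use that ab in \<open>auto simp: U_def\<close>)
  have ia: "integrable lborel (\<lambda>t. f (Complex a t))"
    by (rule integrable_of_inverse_square_decay[OF cont_line, where T = T and C = C])
       (use ab in \<open>auto intro!: decay\<close>)
  have ib: "integrable lborel (\<lambda>t. f (Complex b t))"
    by (rule integrable_of_inverse_square_decay[OF cont_line, where T = T and C = C])
       (use ab in \<open>auto intro!: decay\<close>)
  \<comment> \<open>From height \<open>N0\<close> on the rectangle encloses \<open>p\<close> and its horizontal sides lie where \<open>f\<close> decays.\<close>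
  define N0 where "N0 = nat \<lceil>\<bar>T\<bar>\<rceil> + nat \<lceil>\<bar>Im p\<bar>\<rceil> + 1"
  define I where "I x n = integral {- real n..real n} (\<lambda>t. f (Complex x t))" for x n
  define E where "E n = I b n - I a n - 2 * of_real pi * residue f p" for n
  have E: "norm (E n) \<le> 2 * (\<bar>C\<bar> * (b - a)) / (1 + (real n)\<^sup>2)" if n: "n \<ge> N0" for n
  proof -
    have nT: "real n \<ge> T" "real n > \<bar>Im p\<bar>" "real n > 0" using n unfolding N0_def by linarith+
    define A1 where "A1 = Complex a (- real n)"
    define A2 where "A2 = Complex b (- real n)"
    define A3 where "A3 = Complex b (real n)"
    define A4 where "A4 = Complex a (real n)"
    note A = A1_def A2_def A3_def A4_def
    have rect: "rectpath A1 A3 = linepath A1 A2 +++ linepath A2 A3 +++ linepath A3 A4 +++ linepath A4 A1"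
      by (simp add: rectpath_def Let_def A)
    have p_box: "p \<in> box A1 A3" using ab nT by (auto simp: in_box_complex_iff A)
    have img: "path_image (rectpath A1 A3) \<subseteq> U - {p}"
    proof -
      have "path_image (rectpath A1 A3) \<subseteq> cbox A1 A3"
        by (rule path_image_rectpath_subset_cbox) (use ab in \<open>auto simp: A\<close>)
      also have "cbox A1 A3 \<subseteq> U" using ab by (auto simp: in_cbox_complex_iff A U_def)
      finally have "path_image (rectpath A1 A3) \<subseteq> U" .
      moreover have "p \<notin> path_image (rectpath A1 A3)"
        using path_image_rectpath_inter_box[of A1 A3] p_box ab by (auto simp: A)
      ultimately show ?thesis by blast
    qed
    have seg: "closed_segment A1 A2 \<subseteq> U - {p}" "closed_segment A2 A3 \<subseteq> U - {p}"
      "closed_segment A3 A4 \<subseteq> U - {p}" "closed_segment A4 A1 \<subseteq> U - {p}"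
      using img unfolding rect by (auto simp: path_image_join)
    note int = seg[THEN continuous_on_subset[OF cont], THEN contour_integrable_continuous_linepath]
    have "contour_integral (rectpath A1 A3) f = 2 * pi * \<i> * (\<Sum>p\<in>{p}. winding_number (rectpath A1 A3) p * residue f p)"
    proof (rule Residue_theorem)
      show "f holomorphic_on U - {p}" using holo by (simp add: U_def)
      show "\<forall>z. z \<notin> U \<longrightarrow> winding_number (rectpath A1 A3) z = 0"
      proof (intro allI impI)
        fix z assume "z \<notin> U"
        then show "winding_number (rectpath A1 A3) z = 0"
          using ab by (intro winding_number_rectpath_outside) (auto simp: in_cbox_complex_iff A U_def)
      qed
    qed (use U img convex_connected in auto)
    also have "\<dots> = 2 * of_real pi * \<i> * residue f p"
      using winding_number_rectpath[OF p_box] by simp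
    also have "contour_integral (rectpath A1 A3) f = contour_integral (linepath A1 A2) f
       + contour_integral (linepath A2 A3) f + contour_integral (linepath A3 A4) f + contour_integral (linepath A4 A1) f"
      unfolding rect using int by simp
    also have "contour_integral (linepath A2 A3) f = \<i> * I b n"
      unfolding I_def by (rule contour_integral_linepath_same_Re) (use nT in \<open>auto simp: A\<close>)
    also have "contour_integral (linepath A4 A1) f = - (\<i> * I a n)"
    proof -
      have "contour_integral (linepath A1 A4) f = \<i> * I a n"
        unfolding I_def by (rule contour_integral_linepath_same_Re) (use nT in \<open>auto simp: A\<close>)
      then show ?thesis
        using contour_integral_reversepath[of "linepath A1 A4" f] by simp
    qed
    finally have "\<i> * E n = - (contour_integral (linepath A1 A2) f + contour_integral (linepath A3 A4) f)"
      by (simp add: E_def algebra_simps)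
    then have "norm (E n) = norm (contour_integral (linepath A1 A2) f + contour_integral (linepath A3 A4) f)"
      by (metis norm_minus_cancel norm_mult norm_ii mult_1)
    also have "\<dots> \<le> norm (contour_integral (linepath A1 A2) f) + norm (contour_integral (linepath A3 A4) f)"
      by (rule norm_triangle_ineq)
    also have "\<dots> \<le> \<bar>C\<bar> / (1 + (real n)\<^sup>2) * (b - a) + \<bar>C\<bar> / (1 + (real n)\<^sup>2) * (b - a)"
    proof (rule add_mono)
      have horizontal: "norm (f z) \<le> \<bar>C\<bar> / (1 + (real n)\<^sup>2)" if "a \<le> Re z" "Re z \<le> b" "\<bar>Im z\<bar> = real n" for z
      proof -
        have "norm (f (Complex (Re z) (Im z))) \<le> C / (1 + (Im z)\<^sup>2)" using that nT by (intro decay) auto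
        also have "(Im z)\<^sup>2 = (real n)\<^sup>2" using that by (metis power2_abs)
        also have "C / (1 + (real n)\<^sup>2) \<le> \<bar>C\<bar> / (1 + (real n)\<^sup>2)" by (intro divide_right_mono) auto
        finally show ?thesis by simp
      qed
      have "norm (contour_integral (linepath A1 A2) f) \<le> \<bar>C\<bar> / (1 + (real n)\<^sup>2) * norm (A2 - A1)"
        by (intro contour_integral_bound_linepath int horizontal)
           (use ab in \<open>auto simp: A closed_segment_same_Im closed_segment_eq_real_ivl\<close>)
      also have "norm (A2 - A1) = b - a" using ab by (simp add: A cmod_def)
      finally show "norm (contour_integral (linepath A1 A2) f) \<le> \<bar>C\<bar> / (1 + (real n)\<^sup>2) * (b - a)" .
      have "norm (contour_integral (linepath A3 A4) f) \<le> \<bar>C\<bar> / (1 + (real n)\<^sup>2) * norm (A4 - A3)"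
        by (intro contour_integral_bound_linepath int horizontal)
           (use ab in \<open>auto simp: A closed_segment_same_Im closed_segment_eq_real_ivl\<close>)
      also have "norm (A4 - A3) = b - a" using ab by (simp add: A cmod_def)
      finally show "norm (contour_integral (linepath A3 A4) f) \<le> \<bar>C\<bar> / (1 + (real n)\<^sup>2) * (b - a)" .
    qed
    also have "\<dots> = 2 * (\<bar>C\<bar> * (b - a)) / (1 + (real n)\<^sup>2)" by simp
    finally show ?thesis .
  qed
  have "E \<longlonglongrightarrow> 0"
  proof (rule Lim_null_comparison)
    show "\<forall>\<^sub>F n in sequentially. norm (E n) \<le> 2 * (\<bar>C\<bar> * (b - a)) / (1 + (real n)\<^sup>2)"
      using eventually_ge_at_top[of N0] by eventually_elim (rule E)
    show "(\<lambda>n. 2 * (\<bar>C\<bar> * (b - a)) / (1 + (real n)\<^sup>2)) \<longlonglongrightarrow> 0"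
      by real_asymp
  qed
  moreover have "E \<longlonglongrightarrow> (LINT t|lborel. f (Complex b t)) - (LINT t|lborel. f (Complex a t)) - 2 * of_real pi * residue f p"
    unfolding E_def I_def by (intro tendsto_intros integral_symmetric_interval_tendsto ia ib)
  ultimately have "(LINT t|lborel. f (Complex b t)) - (LINT t|lborel. f (Complex a t)) - 2 * of_real pi * residue f p = 0"
    using LIMSEQ_unique by blast
  then show "(LINT t|lborel. f (Complex b t)) - (LINT t|lborel. f (Complex a t)) = 2 * of_real pi * residue f p"
    by simp
qed

lemma polynomial_times_exp_le:
  fixes t :: real
  shows "(1 + \<bar>t\<bar>) ^ N * exp (- pi * \<bar>t\<bar> / 2) \<le> real (N + 2) ^ (N + 2) / (1 + t\<^sup>2)"
proof -
  define u where "u = \<bar>t\<bar>"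
  define M where "M = N + 2"
  have M: "real M \<ge> 1" "real M > 0" by (simp_all add: M_def)
  have u: "u \<ge> 0" "t\<^sup>2 = u\<^sup>2" by (simp_all add: u_def)
  \<comment> \<open>The power \<open>M = N + 2\<close> pays for the factor \<open>1 + t\<^sup>2\<close>; then \<open>(1 + u)^M \<le> M^M exp u\<close> and \<open>1 < \<pi>/2\<close>.\<close>
  have "1 + u \<le> real M * (1 + u / real M)" using M by (simp add: field_simps)
  also have "\<dots> \<le> real M * exp (u / real M)" using M by (intro mult_left_mono exp_ge_add_one_self) auto
  finally have "(1 + u) ^ M \<le> (real M * exp (u / real M)) ^ M" using u by (intro power_mono) auto
  also have "\<dots> = real M ^ M * exp u"
    using M by (simp add: power_mult_distrib exp_of_nat_mult[symmetric])
  finally have 1: "(1 + u) ^ M \<le> real M ^ M * exp u" .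
  have "1 + u\<^sup>2 \<le> (1 + u)\<^sup>2" using u by (simp add: power2_eq_square algebra_simps)
  then have "(1 + u) ^ N * (1 + u\<^sup>2) \<le> (1 + u) ^ N * (1 + u)\<^sup>2" using u by (intro mult_left_mono) auto
  also have "\<dots> = (1 + u) ^ M" by (simp add: M_def power_add power2_eq_square)
  also note 1
  also have "real M ^ M * exp u \<le> real M ^ M * exp (pi * u / 2)"
    using u pi_gt3 mult_right_mono[of 2 pi u] by (intro mult_left_mono) auto
  finally have 2: "(1 + u) ^ N * (1 + u\<^sup>2) \<le> real M ^ M * exp (pi * u / 2)" .
  have "(1 + u) ^ N * exp (- pi * u / 2) * (1 + u\<^sup>2) = ((1 + u) ^ N * (1 + u\<^sup>2)) * exp (- (pi * u / 2))"
    by simp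
  also have "\<dots> \<le> (real M ^ M * exp (pi * u / 2)) * exp (- (pi * u / 2))"
    by (intro mult_right_mono 2) auto
  also have "\<dots> = real M ^ M" by (simp add: exp_minus)
  finally have "(1 + u) ^ N * exp (- pi * u / 2) * (1 + u\<^sup>2) \<le> real M ^ M" .
  moreover have "1 + u\<^sup>2 > 0" by (simp add: add_pos_nonneg)
  ultimately have "(1 + u) ^ N * exp (- pi * u / 2) \<le> real M ^ M / (1 + u\<^sup>2)"
    by (simp add: pos_le_divide_eq)
  then show ?thesis unfolding u(2) unfolding u_def M_def .
qed

lemma norm_of_real_powr_strip_le:
  fixes y :: real
  assumes "y > 0" "a \<le> r" "r \<le> b"
  shows "y powr r \<le> y powr a + y powr b"
proof (cases "y \<ge> 1")
  case True
  then have "y powr r \<le> y powr b" using assms by (intro powr_mono) auto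
  then show ?thesis by (simp add: add_increasing)
next
  case False
  then have "y powr r \<le> y powr a" using assms by (intro powr_mono') auto
  then show ?thesis by (simp add: add_increasing2)
qed

section \<open>The Meijer function as an integral of Gamma and cosine\<close>

text \<open>The Mellin transform of \<open>y \<mapsto> \<Psi>\<close> stripped of its Dirichlet series; for \<open>k = 1\<close> it is that of
  \<open>exp (-y)\<close>.\<close>

definition mellin_kernel :: "nat \<Rightarrow> complex \<Rightarrow> complex" where
  "mellin_kernel k w = Gamma w ^ k * cos (of_real pi * w / 2) ^ (k - 1)"

lemma mellin_kernel_holomorphic: "mellin_kernel k holomorphic_on {w. Re w > 0}"
proof -
  have "z \<notin> \<int>\<^sub>\<le>\<^sub>0" if "Re z > 0" for z :: complex
    using that by (auto simp: nonpos_Ints_def)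
  then show ?thesis unfolding mellin_kernel_def by (intro holomorphic_intros) auto
qed

lemma continuous_on_mellin_kernel_line:
  assumes "c > 0"
  shows "continuous_on S (\<lambda>t. mellin_kernel k (Complex c t))"
  by (rule continuous_on_vertical_line[OF holomorphic_on_imp_continuous_on[OF mellin_kernel_holomorphic]])
     (use assms in auto)

text \<open>Of the \<open>k\<close> exponentially small Gamma factors the \<open>k - 1\<close> cosines cancel all but one.\<close>

lemma norm_mellin_kernel_strip_le:
  fixes a b :: real
  assumes a: "a > 0" and k: "k \<ge> 1"
  shows "\<exists>C N. C > 0 \<and> (\<forall>x t. a \<le> x \<longrightarrow> x \<le> b \<longrightarrow>
    norm (mellin_kernel k (Complex x t)) \<le> C * (1 + \<bar>t\<bar>) ^ N * exp (- pi * \<bar>t\<bar> / 2))"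
proof -
  obtain C N where C0: "C > 0" and C1: "\<forall>x t. a \<le> x \<longrightarrow> x \<le> b \<longrightarrow>
      norm (Gamma (Complex x t)) \<le> C * (1 + \<bar>t\<bar>) ^ N * exp (- pi * \<bar>t\<bar> / 2)"
    using norm_Gamma_strip_le[OF a, of b] by (elim exE conjE)
  note C = C0 C1[rule_format]
  have "C ^ k > 0" using C0 by simp
  show ?thesis
  proof (rule exI[of _ "C ^ k"], rule exI[of _ "N * k"], intro conjI allI impI)
    show "C ^ k > 0" by fact
    fix x t assume x: "a \<le> x" "x \<le> b"
    define e where "e = exp (pi * \<bar>t\<bar> / 2)"
    have "exp (- pi * \<bar>t\<bar> / 2) = 1 / e"
      unfolding e_def by (simp add: exp_minus inverse_eq_divide)
    moreover have "e > 0" by (simp add: e_def)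
    ultimately have e: "e > 0" "exp (- pi * \<bar>t\<bar> / 2) = 1 / e" by blast+
    have 1: "norm (Gamma (Complex x t)) \<le> C * (1 + \<bar>t\<bar>) ^ N * (1 / e)"
      using C(2)[OF x, of t] unfolding e(2) .
    have 2: "norm (cos (of_real pi * Complex x t / 2)) \<le> e"
      unfolding e_def by (rule norm_cos_half_pi_le)
    have "norm (mellin_kernel k (Complex x t)) = norm (Gamma (Complex x t)) ^ k * norm (cos (of_real pi * Complex x t / 2)) ^ (k - 1)"
      by (simp only: mellin_kernel_def norm_mult norm_power)
    also have "\<dots> \<le> (C * (1 + \<bar>t\<bar>) ^ N * (1 / e)) ^ k * e ^ (k - 1)"
      using C0 e(1) by (intro mult_mono power_mono 1 2) auto
    also have "\<dots> = C ^ k * (1 + \<bar>t\<bar>) ^ (N * k) * ((1 / e) ^ k * e ^ (k - 1))"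
      by (simp only: power_mult_distrib power_mult mult.assoc)
    also have "(1 / e) ^ k * e ^ (k - 1) = 1 / e"
      using k e(1) by (cases k) (auto simp: power_one_over)
    finally show "norm (mellin_kernel k (Complex x t)) \<le> C ^ k * (1 + \<bar>t\<bar>) ^ (N * k) * exp (- pi * \<bar>t\<bar> / 2)"
      by (simp only: e(2))
  qed
qed

definition mellin_integral :: "nat \<Rightarrow> real \<Rightarrow> real \<Rightarrow> complex" where
  "mellin_integral k c y =
     (LINT t|lborel. mellin_kernel k (Complex c t) * of_real y powr (- Complex c t)) / (2 * of_real pi)"

lemma mellin_kernel_line_integrable:
  assumes "c > 0" "k \<ge> 1"
  shows "integrable lborel (\<lambda>t. mellin_kernel k (Complex c t))"
proof -
  obtain C N where C0: "C > 0" and C1: "\<forall>x t. c \<le> x \<longrightarrow> x \<le> c \<longrightarrow>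
      norm (mellin_kernel k (Complex x t)) \<le> C * (1 + \<bar>t\<bar>) ^ N * exp (- pi * \<bar>t\<bar> / 2)"
    using norm_mellin_kernel_strip_le[OF assms, of c] by (elim exE conjE)
  note C = C0 C1[rule_format]
  show ?thesis
  proof (rule integrable_of_inverse_square_decay[where T = 0])
    show "continuous_on UNIV (\<lambda>t. mellin_kernel k (Complex c t))"
      using assms by (intro continuous_on_mellin_kernel_line)
    fix t :: real
    have "norm (mellin_kernel k (Complex c t)) \<le> C * ((1 + \<bar>t\<bar>) ^ N * exp (- pi * \<bar>t\<bar> / 2))"
      using C(2)[of c t] by (simp only: mult.assoc order.refl)
    also have "\<dots> \<le> C * (real (N + 2) ^ (N + 2) / (1 + t\<^sup>2))"
      using C(1) by (intro mult_left_mono polynomial_times_exp_le) auto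
    finally show "norm (mellin_kernel k (Complex c t)) \<le> (C * real (N + 2) ^ (N + 2)) / (1 + t\<^sup>2)" by simp
  qed
qed

text \<open>The kernel is holomorphic in the right half-plane, so moving the line crosses no pole. This frees
  the choice of the line from the parameter \<open>\<mu>\<close>.\<close>

lemma mellin_integral_independent:
  assumes k: "k \<ge> 1" and y: "y > 0" and c: "0 < c" "0 < c'"
  shows "mellin_integral k c y = mellin_integral k c' y"
proof -
  have shift: "mellin_integral k a y = mellin_integral k b y" if ab: "0 < a" "a < b" for a b
  proof -
    define f where "f w = mellin_kernel k w * of_real y powr (- w)" for w
    define p where "p = complex_of_real ((a + b) / 2)"
    obtain C N where C0: "C > 0" and C1: "\<forall>x t. a \<le> x \<longrightarrow> x \<le> b \<longrightarrow>
        norm (mellin_kernel k (Complex x t)) \<le> C * (1 + \<bar>t\<bar>) ^ N * exp (- pi * \<bar>t\<bar> / 2)"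
      using norm_mellin_kernel_strip_le[OF ab(1) k, of b] by (elim exE conjE)
    note C = C0 C1[rule_format]
    define B where "B = y powr (-b) + y powr (-a)"
    have holo: "f holomorphic_on {w. Re w > 0}"
      unfolding f_def using y by (intro holomorphic_intros mellin_kernel_holomorphic) auto
    have decay: "norm (f (Complex x t)) \<le> (C * real (N + 2) ^ (N + 2) * B) / (1 + t\<^sup>2)"
      if x: "a \<le> x" "x \<le> b" for x t
    proof -
      have "norm (of_real y powr (- Complex x t)) = y powr (-x)"
        using y by (subst norm_powr_real_powr) auto
      also have "\<dots> \<le> B" unfolding B_def using x y by (intro norm_of_real_powr_strip_le) auto
      finally have 1: "norm (of_real y powr (- Complex x t)) \<le> B" .
      have "norm (mellin_kernel k (Complex x t)) \<le> C * ((1 + \<bar>t\<bar>) ^ N * exp (- pi * \<bar>t\<bar> / 2))"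
        using C(2)[OF x] by (simp only: mult.assoc)
      also have "\<dots> \<le> C * (real (N + 2) ^ (N + 2) / (1 + t\<^sup>2))"
        using C(1) by (intro mult_left_mono polynomial_times_exp_le) auto
      finally have 2: "norm (mellin_kernel k (Complex x t)) \<le> C * (real (N + 2) ^ (N + 2) / (1 + t\<^sup>2))" .
      have "norm (f (Complex x t)) \<le> C * (real (N + 2) ^ (N + 2) / (1 + t\<^sup>2)) * B"
        unfolding f_def norm_mult using C(1) by (intro mult_mono 1 2) auto
      then show ?thesis by simp
    qed
    have res: "residue f p = 0"
      by (rule residue_holo[OF _ _ holo]) (use ab in \<open>auto simp: p_def open_halfspace_Re_gt\<close>)
    have "(LINT t|lborel. f (Complex b t)) - (LINT t|lborel. f (Complex a t)) = 2 * of_real pi * residue f p"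
    proof (rule vertical_line_shift[where T = 0 and ?x0.0 = 0 and ?x1.0 = "b + 1"])
      show "f holomorphic_on {w. 0 < Re w \<and> Re w < b + 1} - {p}"
        using holo by (rule holomorphic_on_subset) auto
    qed (use ab decay in \<open>auto simp: p_def\<close>)
    then show ?thesis unfolding mellin_integral_def f_def[symmetric] res by simp
  qed
  show ?thesis
  proof (cases c c' rule: linorder_cases)
    case less
    with c show ?thesis by (intro shift)
  next
    case greater
    with c show ?thesis by (intro shift[symmetric])
  qed simp
qed

text \<open>The reflection formula removes Gamma from the denominator, the duplication formula merges
  \<open>\<Gamma>(-s) \<Gamma>(1/2-s)\<close> into \<open>\<Gamma>(-2s)\<close>, and the factor \<open>4^(ks)\<close> that this creates cancels against
  the power of 2 in the argument.\<close>

lemma meijer_G_integrand: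
  fixes y :: real and s :: complex
  assumes k: "k \<ge> 1" and s: "Re s < 0" and y: "y > 0"
  shows "Gamma (- s) ^ k * Gamma (1/2 - s) / Gamma (1/2 + s) ^ (k - 1) * of_real (y\<^sup>2 / 2 ^ (2 * k)) powr s
    = (2 ^ k * of_real (sqrt pi) ^ k / of_real pi ^ (k - 1)) * (mellin_kernel k (-2 * s) * of_real y powr (-(-2 * s)))"
proof -
  \<comment> \<open>This also holds at the poles of \<open>\<Gamma>(1/2 + s)\<close>: there both sides are 0, the left by \<open>1 / 0 = 0\<close>, the right by the zero of the cosine.\<close>
  have rec: "1 / Gamma (1/2 + s) = Gamma (1/2 - s) * (cos (of_real pi * s) / of_real pi)"
  proof -
    have "rGamma (1/2 - s) * rGamma (1 - (1/2 - s)) = sin (of_real pi * (1/2 - s)) / of_real pi"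
      by (rule rGamma_reflection_complex)
    also have "1 - (1/2 - s) = 1/2 + s" by simp
    also have "sin (of_real pi * (1/2 - s)) = cos (of_real pi * s)"
      by (simp add: cos_sin_eq algebra_simps)
    finally have r: "rGamma (1/2 - s) * rGamma (1/2 + s) = cos (of_real pi * s) / of_real pi" .
    have "1/2 - s \<notin> \<int>\<^sub>\<le>\<^sub>0" using s by (auto simp: nonpos_Ints_def complex_eq_iff)
    then have "rGamma (1/2 - s) \<noteq> 0" by (simp add: rGamma_eq_zero_iff)
    then show ?thesis using r by (simp add: Gamma_def field_simps)
  qed
  have dup: "Gamma (- s) * Gamma (1/2 - s) = exp ((1 + 2 * s) * of_real (ln 2)) * of_real (sqrt pi) * Gamma (-2 * s)"
  proof -
    have "- s \<notin> \<int>\<^sub>\<le>\<^sub>0" "- s + 1/2 \<notin> \<int>\<^sub>\<le>\<^sub>0" using s by (auto simp: nonpos_Ints_def complex_eq_iff)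
    from Gamma_legendre_duplication[OF this] show ?thesis by (simp add: add.commute)
  qed
  have pw: "exp ((1 + 2 * s) * of_real (ln 2)) ^ k * of_real (y\<^sup>2 / 2 ^ (2 * k)) powr s = 2 ^ k * of_real y powr (2 * s)"
  proof -
    have ln: "ln (y\<^sup>2 / 2 ^ (2 * k)) = 2 * ln y - 2 * real k * ln 2"
      using y by (simp add: ln_div ln_realpow)
    have two: "(2::complex) ^ k = exp (of_nat k * of_real (ln 2))"
      by (simp add: exp_of_nat_mult exp_of_real)
    have "exp ((1 + 2 * s) * of_real (ln 2)) ^ k * of_real (y\<^sup>2 / 2 ^ (2 * k)) powr s
      = exp (of_nat k * ((1 + 2 * s) * of_real (ln 2)) + s * of_real (2 * ln y - 2 * real k * ln 2))"
      using y by (simp add: powr_of_real_exp ln exp_add exp_of_nat_mult del: of_real_divide of_real_diff)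
    also have "of_nat k * ((1 + 2 * s) * of_real (ln 2)) + s * of_real (2 * ln y - 2 * real k * ln 2)
      = of_nat k * complex_of_real (ln 2) + 2 * s * of_real (ln y)"
      by (simp add: algebra_simps)
    also have "exp \<dots> = 2 ^ k * of_real y powr (2 * s)"
      using y by (simp add: powr_of_real_exp two exp_add)
    finally show ?thesis .
  qed
  have Gk: "Gamma (1/2 - s) ^ k = Gamma (1/2 - s) * Gamma (1/2 - s) ^ (k - 1)"
    using k by (cases k) auto
  have "Gamma (- s) ^ k * Gamma (1/2 - s) / Gamma (1/2 + s) ^ (k - 1)
     = Gamma (- s) ^ k * Gamma (1/2 - s) * (1 / Gamma (1/2 + s)) ^ (k - 1)"
    by (simp add: power_one_over)
  also have "\<dots> = (Gamma (- s) * Gamma (1/2 - s)) ^ k * (cos (of_real pi * s) / of_real pi) ^ (k - 1)"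
    unfolding rec power_mult_distrib Gk by (simp only: mult_ac)
  also have "\<dots> = exp ((1 + 2 * s) * of_real (ln 2)) ^ k * of_real (sqrt pi) ^ k / of_real pi ^ (k - 1)
      * mellin_kernel k (-2 * s)"
    unfolding dup power_mult_distrib power_divide mellin_kernel_def by simp
  also have "\<dots> * of_real (y\<^sup>2 / 2 ^ (2 * k)) powr s
     = (exp ((1 + 2 * s) * of_real (ln 2)) ^ k * of_real (y\<^sup>2 / 2 ^ (2 * k)) powr s) * of_real (sqrt pi) ^ k / of_real pi ^ (k - 1)
      * mellin_kernel k (-2 * s)" by simp
  finally show ?thesis unfolding pw by simp
qed

text \<open>The substitution \<open>w = -2s\<close> in the Mellin--Barnes integral; the normalising constant of \<open>\<Psi>\<close> is
  the one that makes all constants cancel.\<close>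

lemma meijer_G_eq_mellin_integral:
  assumes k: "k \<ge> 1" and \<mu>: "\<mu> < 0" and y: "y > 0" and c: "c > 0"
  shows "of_real (pi powr (real k / 2 - 1) / 2 ^ (k - 1)) * meijer_G \<mu> k (y\<^sup>2 / 2 ^ (2 * k))
    = mellin_integral k c y"
proof -
  define g where "g \<tau> = mellin_kernel k (Complex (-2 * \<mu>) \<tau>) * of_real y powr (- Complex (-2 * \<mu>) \<tau>)" for \<tau>
  define A :: complex where "A = 2 ^ k * of_real (sqrt pi) ^ k / of_real pi ^ (k - 1)"
  have w: "-2 * Complex \<mu> t = Complex (-2 * \<mu>) (0 + (-2) * t)" for t
    by (simp add: complex_eq_iff)
  have integrand: "Gamma (- s) ^ k * Gamma (1/2 - s) / Gamma (1/2 + s) ^ (k - 1) * of_real (y\<^sup>2 / 2 ^ (2 * k)) powr s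
     = A * g (0 + (-2) * t)" if "s = Complex \<mu> t" for s t
    using meijer_G_integrand[of k s y] k \<mu> y that unfolding that w g_def A_def by simp
  have "meijer_G \<mu> k (y\<^sup>2 / 2 ^ (2 * k)) = 1 / (2 * of_real pi) * (LINT t|lborel. A * g (0 + (-2) * t))"
    unfolding meijer_G_def Let_def integrand[OF refl] ..
  also have "(LINT t|lborel. A * g (0 + (-2) * t)) = A * (LINT t|lborel. g (0 + (-2) * t))" by simp
  also have "(LINT t|lborel. g (0 + (-2) * t)) = (LINT t|lborel. g t) / 2"
    using lborel_integral_real_affine[of "-2" g 0] by (simp add: scaleR_conv_of_real)
  also have "(LINT t|lborel. g t) = 2 * of_real pi * mellin_integral k (-2 * \<mu>) y"
    by (simp add: mellin_integral_def g_def)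
  also have "mellin_integral k (-2 * \<mu>) y = mellin_integral k c y"
    using k y \<mu> c by (intro mellin_integral_independent) auto
  finally have 1: "meijer_G \<mu> k (y\<^sup>2 / 2 ^ (2 * k)) = A / 2 * mellin_integral k c y" by simp
  have 2: "of_real (pi powr (real k / 2 - 1) / 2 ^ (k - 1)) * (A / 2) = 1"
  proof -
    have pk: "pi powr (real k / 2 - 1) * sqrt pi ^ k = pi ^ (k - 1)"
    proof -
      have "sqrt pi ^ k = pi powr (real k / 2)"
        by (simp add: powr_half_sqrt[symmetric] powr_power)
      then have "pi powr (real k / 2 - 1) * sqrt pi ^ k = pi powr (real k / 2 - 1 + real k / 2)"
        by (simp only: powr_add)
      also have "real k / 2 - 1 + real k / 2 = real (k - 1)" using k by (simp add: of_nat_diff)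
      also have "pi powr real (k - 1) = pi ^ (k - 1)" by (simp add: powr_realpow)
      finally show ?thesis .
    qed
    have "(2::complex) ^ k = 2 * 2 ^ (k - 1)" using k by (cases k) auto
    then have "A / 2 = of_real (2 ^ (k - 1) * sqrt pi ^ k / pi ^ (k - 1))" by (simp add: A_def)
    then have "of_real (pi powr (real k / 2 - 1) / 2 ^ (k - 1)) * (A / 2)
      = complex_of_real (pi powr (real k / 2 - 1) / 2 ^ (k - 1) * (2 ^ (k - 1) * sqrt pi ^ k / pi ^ (k - 1)))"
      by (simp only: of_real_mult)
    also have "pi powr (real k / 2 - 1) / 2 ^ (k - 1) * (2 ^ (k - 1) * sqrt pi ^ k / pi ^ (k - 1))
      = (pi powr (real k / 2 - 1) * sqrt pi ^ k) / pi ^ (k - 1)" by simp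
    also have "\<dots> = 1" unfolding pk by simp
    finally show ?thesis by simp
  qed
  show ?thesis unfolding 1 mult.assoc[symmetric] 2 by simp
qed

text \<open>The sum over \<open>j\<close> is the Dirichlet series of \<open>\<zeta>(w)^k\<close>, and \<open>c > 1\<close> lies in its region of
  absolute convergence.\<close>

lemma Psi_eq_integral:
  assumes k: "k \<ge> 1" and \<mu>: "\<mu> < 0" and \<rho>: "\<rho> > 0" and x: "x > 0" and c: "c > 1"
  defines "g \<equiv> \<lambda>t. mellin_kernel k (Complex c t) * of_real (\<rho> * x) powr (- Complex c t)"
  shows "integrable lborel (\<lambda>t. g t * zeta (Complex c t) ^ k)"
    and "Psi \<mu> \<rho> k x = (LINT t|lborel. g t * zeta (Complex c t) ^ k) / (2 * of_real pi)"
proof -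
  have g: "integrable lborel g"
  proof (rule Bochner_Integration.integrable_bound)
    show "integrable lborel (\<lambda>t. of_real ((\<rho> * x) powr (-c)) * mellin_kernel k (Complex c t))"
      using mellin_kernel_line_integrable[of c k] k c by (intro integrable_mult_right) auto
    have "continuous_on UNIV g"
      unfolding g_def using c \<rho> x
      by (intro continuous_intros continuous_on_mellin_kernel_line continuous_on_vertical_line[where S = UNIV]) auto
    then show "g \<in> borel_measurable lborel" using borel_measurable_continuous_onI by simp
    show "AE t in lborel. norm (g t) \<le> norm (of_real ((\<rho> * x) powr (-c)) * mellin_kernel k (Complex c t))"
    proof (rule AE_I2)
      fix t
      have "norm (of_real (\<rho> * x) powr (- Complex c t)) = (\<rho> * x) powr (-c)"
        using \<rho> x by (subst norm_powr_real_powr) auto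
      then show "norm (g t) \<le> norm (of_real ((\<rho> * x) powr (-c)) * mellin_kernel k (Complex c t))"
        by (simp add: g_def norm_mult)
    qed
  qed
  have a1: "real (piltz k (Suc n)) \<ge> 0" for n by simp
  have a2: "summable (\<lambda>n. real (piltz k (Suc n)) * real (Suc n) powr (-c))"
    using c by (rule summable_piltz_powr)
  have a3: "(\<lambda>n. of_real (real (piltz k (Suc n))) * of_nat (Suc n) powr (- Complex c t)) sums zeta (Complex c t) ^ k" for t
    using piltz_sums_zeta_power[of "Complex c t" k] c by simp
  show "integrable lborel (\<lambda>t. g t * zeta (Complex c t) ^ k)"
    by (rule dirichlet_series_integral(1)[OF g a1 a2 a3])
  define I where "I = (LINT t|lborel. g t * zeta (Complex c t) ^ k) / (2 * of_real pi)"
  define p where "p = complex_of_real (pi powr (real k / 2 - 1) / 2 ^ (k - 1))"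
  define G where "G j = meijer_G \<mu> k (\<rho>\<^sup>2 * real (Suc j)^2 * x^2 / 2 ^ (2 * k))" for j
  have p0: "p \<noteq> 0" by (simp add: p_def)
  have pG: "p * G j = (LINT t|lborel. g t * of_nat (Suc j) powr (- Complex c t)) / (2 * of_real pi)" for j
  proof -
    have "p * G j = mellin_integral k c (\<rho> * x * real (Suc j))"
      using meijer_G_eq_mellin_integral[OF k \<mu>, of "\<rho> * x * real (Suc j)" c] \<rho> x c
      by (simp add: p_def G_def power_mult_distrib mult_ac del: of_nat_Suc)
    also have "\<dots> = (LINT t|lborel. g t * of_nat (Suc j) powr (- Complex c t)) / (2 * of_real pi)"
    proof -
      have "of_real (\<rho> * x * real (Suc j)) powr (- Complex c t) = of_real (\<rho> * x) powr (- Complex c t) * of_nat (Suc j) powr (- Complex c t)" for t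
        using powr_times_real[of "of_real (\<rho> * x)" "of_real (real (Suc j))" "- Complex c t"] \<rho> x
        by (simp del: of_nat_Suc)
      then show ?thesis unfolding mellin_integral_def g_def by (simp only: mult.assoc)
    qed
    finally show ?thesis .
  qed
  have "(\<lambda>j. of_real (real (piltz k (Suc j))) * (LINT t|lborel. g t * of_nat (Suc j) powr (- Complex c t)) / (2 * of_real pi)) sums I"
    unfolding I_def by (intro sums_divide dirichlet_series_integral(2)[OF g a1 a2 a3])
  then have "(\<lambda>j. p * (of_nat (piltz k (Suc j)) * G j)) sums I"
    by (simp add: mult.left_commute[of p] pG)
  from sums_divide[OF this, of p] have "(\<lambda>j. of_nat (piltz k (Suc j)) * G j) sums (I / p)" using p0 by simp
  then have "(\<Sum>j. of_nat (piltz k (Suc j)) * G j) = I / p" by (simp only: sums_iff)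
  moreover have "Psi \<mu> \<rho> k x = p * (\<Sum>j. of_nat (piltz k (Suc j)) * G j)"
    unfolding Psi_def p_def G_def ..
  ultimately show "Psi \<mu> \<rho> k x = (LINT t|lborel. g t * zeta (Complex c t) ^ k) / (2 * of_real pi)"
    using p0 by (simp flip: I_def)
qed

section \<open>The integrand after summation and its symmetry\<close>

text \<open>The integrand \<open>\<Phi>_\<gamma>\<close> of the weighted series, with the factor \<open>\<gamma>^(km)\<close> already included; this
  is what makes the powers of \<open>\<alpha>\<close> and \<open>\<beta>\<close> symmetric about \<open>Re w = m\<close>.\<close>

definition mellin_integrand :: "nat \<Rightarrow> nat \<Rightarrow> real \<Rightarrow> complex \<Rightarrow> complex" where
  "mellin_integrand k m \<gamma> w = zeta (1 - 2 * of_nat m + w) ^ k * zeta w ^ k * Gamma w ^ k *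
     cos (of_real pi * w / 2) ^ (k - 1) * 2 powr (- (of_nat k * w)) *
     of_real \<gamma> powr (- (of_nat k * (w - of_nat m)))"

text \<open>The factor of \<open>\<Phi>_\<gamma>\<close> that is regular at the origin: \<open>\<Gamma>(w)\<close> is replaced by
  \<open>\<Gamma>(w+1) = w \<Gamma>(w)\<close>.\<close>

definition mellin_numerator :: "nat \<Rightarrow> nat \<Rightarrow> real \<Rightarrow> complex \<Rightarrow> complex" where
  "mellin_numerator k m \<gamma> w = zeta (1 - 2 * of_nat m + w) ^ k * zeta w ^ k * Gamma (w + 1) ^ k *
     cos (of_real pi * w / 2) ^ (k - 1) * 2 powr (- (of_nat k * w)) *
     of_real \<gamma> powr (- (of_nat k * (w - of_nat m)))"

text \<open>The weight \<open>n^(2m-1)\<close> shifts the argument of the second Dirichlet series to \<open>w + 1 - 2m\<close>,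
  which is absolutely convergent because \<open>c > 2m\<close>.\<close>

lemma Psi_series_sums:
  fixes k m :: nat and \<gamma> \<mu> c :: real
  assumes k: "k \<ge> 1" and m: "m \<ge> 1" and \<mu>: "\<mu> < 0" and \<gamma>: "\<gamma> > 0" and c: "c > 2 * real m"
  shows "(\<lambda>n. of_real ((\<gamma> ^ k) ^ m) * (of_nat (piltz k (Suc n)) * of_nat (Suc n) ^ (2 * m - 1) *
                       Psi \<mu> ((2 * \<gamma>) ^ k) k (real (Suc n))))
     sums ((LINT t|lborel. mellin_integrand k m \<gamma> (Complex c t)) / (2 * of_real pi))"
proof -
  define \<rho> where "\<rho> = (2 * \<gamma>) ^ k"
  have \<rho>: "\<rho> > 0" using \<gamma> by (simp add: \<rho>_def)
  have c1: "c > 1" using c m by linarith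
  define c' where "c' = c - (2 * real m - 1)"
  have c': "c' > 1" using c by (simp add: c'_def)
  define g where "g t = mellin_kernel k (Complex c t) * of_real \<rho> powr (- Complex c t) * zeta (Complex c t) ^ k" for t
  define a where "a n = real (piltz k (Suc n)) * real (Suc n) ^ (2 * m - 1)" for n
  have g: "integrable lborel g"
    using Psi_eq_integral(1)[OF k \<mu> \<rho>, of 1 c] c1 unfolding g_def by simp
  have shift: "of_nat (Suc n) ^ (2 * m - 1) * of_nat (Suc n) powr (- Complex c t) = of_nat (Suc n) powr (- Complex c' t)" for n t
  proof -
    have "(of_nat (Suc n) :: complex) ^ (2 * m - 1) = of_nat (Suc n) powr of_nat (2 * m - 1)"
      by (simp add: powr_nat del: of_nat_Suc)
    moreover have "of_nat (2 * m - 1) + - Complex c t = - Complex c' t"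
      using m by (simp add: complex_eq_iff c'_def of_nat_diff)
    ultimately show ?thesis by (simp only: powr_add[symmetric])
  qed
  have a1: "a n \<ge> 0" for n by (simp add: a_def)
  have a2: "summable (\<lambda>n. a n * real (Suc n) powr (-c))"
  proof -
    have "a n * real (Suc n) powr (-c) = real (piltz k (Suc n)) * real (Suc n) powr (-c')" for n
    proof -
      have "real (Suc n) ^ (2 * m - 1) = real (Suc n) powr real (2 * m - 1)"
        by (simp add: powr_realpow del: of_nat_Suc)
      moreover have "real (2 * m - 1) + - c = - c'" using m by (simp add: c'_def of_nat_diff)
      ultimately show ?thesis by (simp only: a_def mult.assoc powr_add[symmetric])
    qed
    then show ?thesis using summable_piltz_powr(1)[OF c'] by simp
  qed
  have a3: "(\<lambda>n. of_real (a n) * of_nat (Suc n) powr (- Complex c t)) sums zeta (Complex c' t) ^ k" for t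
  proof -
    have "of_real (a n) * of_nat (Suc n) powr (- Complex c t) = of_nat (piltz k (Suc n)) * of_nat (Suc n) powr (- Complex c' t)" for n
      unfolding a_def of_real_mult of_real_power of_real_of_nat_eq mult.assoc shift ..
    then show ?thesis using piltz_sums_zeta_power[of "Complex c' t" k] c' by simp
  qed
  have summand: "of_real (a n) * (LINT t|lborel. g t * of_nat (Suc n) powr (- Complex c t)) / (2 * of_real pi)
     = of_nat (piltz k (Suc n)) * of_nat (Suc n) ^ (2 * m - 1) * Psi \<mu> ((2 * \<gamma>) ^ k) k (real (Suc n))" for n
  proof -
    have "of_real (\<rho> * real (Suc n)) powr (- Complex c t) = of_real \<rho> powr (- Complex c t) * of_nat (Suc n) powr (- Complex c t)" for t
      using powr_times_real[of "of_real \<rho>" "of_real (real (Suc n))" "- Complex c t"] \<rho> by (simp del: of_nat_Suc)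
    then have "Psi \<mu> \<rho> k (real (Suc n)) = (LINT t|lborel. g t * of_nat (Suc n) powr (- Complex c t)) / (2 * of_real pi)"
      using Psi_eq_integral(2)[OF k \<mu> \<rho> _ c1, of "real (Suc n)"] unfolding g_def by (simp only: mult_ac)
    then show ?thesis unfolding \<rho>_def[symmetric] by (simp add: a_def del: of_nat_Suc)
  qed
  have "(\<lambda>n. of_real (a n) * (LINT t|lborel. g t * of_nat (Suc n) powr (- Complex c t)) / (2 * of_real pi))
     sums ((LINT t|lborel. g t * zeta (Complex c' t) ^ k) / (2 * of_real pi))"
    by (intro sums_divide dirichlet_series_integral(2)[OF g a1 a2 a3])
  then have "(\<lambda>n. of_real ((\<gamma> ^ k) ^ m) * (of_nat (piltz k (Suc n)) * of_nat (Suc n) ^ (2 * m - 1) * Psi \<mu> ((2 * \<gamma>) ^ k) k (real (Suc n))))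
     sums (of_real ((\<gamma> ^ k) ^ m) * ((LINT t|lborel. g t * zeta (Complex c' t) ^ k) / (2 * of_real pi)))"
    unfolding summand by (rule sums_mult)
  also have "of_real ((\<gamma> ^ k) ^ m) * ((LINT t|lborel. g t * zeta (Complex c' t) ^ k) / (2 * of_real pi))
     = (LINT t|lborel. of_real ((\<gamma> ^ k) ^ m) * (g t * zeta (Complex c' t) ^ k)) / (2 * of_real pi)"
    by simp
  also have "(\<lambda>t. of_real ((\<gamma> ^ k) ^ m) * (g t * zeta (Complex c' t) ^ k)) = (\<lambda>t. mellin_integrand k m \<gamma> (Complex c t))"
  proof
    fix t
    define w where "w = Complex c t"
    have w': "Complex c' t = 1 - 2 * of_nat m + w" by (simp add: w_def c'_def complex_eq_iff)
    have "of_real ((\<gamma> ^ k) ^ m) * of_real \<rho> powr (- w) = 2 powr (- (of_nat k * w)) * of_real \<gamma> powr (- (of_nat k * (w - of_nat m)))"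
    proof -
      have ln: "ln \<rho> = real k * (ln 2 + ln \<gamma>)" using \<gamma> by (simp add: \<rho>_def ln_realpow ln_mult distrib_left)
      have "complex_of_real ((\<gamma> ^ k) ^ m) = exp (of_nat (k * m) * of_real (ln \<gamma>))"
        using \<gamma> by (simp add: exp_of_nat_mult exp_of_real power_mult del: of_nat_mult)
      moreover have "2 powr (- (of_nat k * w)) = exp (- (of_nat k * w) * of_real (ln 2))"
        using powr_of_real_exp[of 2] by simp
      ultimately show ?thesis
        using \<gamma> \<rho> unfolding powr_of_real_exp[OF \<rho>] powr_of_real_exp[OF \<gamma>] ln
        by (simp add: exp_add[symmetric] algebra_simps)
    qed
    then show "of_real ((\<gamma> ^ k) ^ m) * (g t * zeta (Complex c' t) ^ k) = mellin_integrand k m \<gamma> (Complex c t)"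
      unfolding g_def mellin_integrand_def mellin_kernel_def w' w_def[symmetric] by (simp add: mult_ac)
  qed
  finally show ?thesis .
qed

text \<open>The functional equation at \<open>w\<close> rewrites \<open>\<zeta>(1-w)\<close> on the left, and at \<open>2m - w\<close> it rewrites
  \<open>\<zeta>(1-2m+w)\<close> on the right. Both sides then contain the same zeta and Gamma factors, the cosines at \<open>w\<close> and \<open>2m - w\<close>
  differ by the sign \<open>(-1)^m\<close>, and the remaining exponentials agree because \<open>\<alpha>\<beta> = \<pi>\<^sup>2\<close>.\<close>

lemma mellin_integrand_reflection:
  fixes \<alpha> \<beta> :: real
  assumes pos: "\<alpha> > 0" "\<beta> > 0" "\<alpha> * \<beta> = pi\<^sup>2" and k: "k \<ge> 1" and w: "w \<notin> \<int>"
  shows "mellin_integrand k m \<beta> (2 * of_nat m - w) = (-1) ^ m * mellin_integrand k m \<alpha> w"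
proof -
  define v where "v = 2 * of_nat m - w"
  have v: "v \<notin> \<int>"
  proof
    assume "v \<in> \<int>"
    then have "2 * of_nat m - v \<in> \<int>" by (intro Ints_diff Ints_mult) auto
    then show False using w by (simp add: v_def)
  qed
  define e :: complex where "e = (-1) ^ m"
  have e: "e * e = 1" by (simp add: e_def flip: power_mult_distrib)
  define u where "u = cos (of_real pi * w / 2)"
  have cv: "cos (of_real pi * v / 2) = e * u"
  proof -
    have "of_real pi * v / 2 = of_real (pi * real m) - of_real pi * w / 2"
      by (simp add: v_def field_simps)
    then have "cos (of_real pi * v / 2) = cos (of_real (pi * real m)) * u + sin (of_real (pi * real m)) * sin (of_real pi * w / 2)"
      by (simp only: cos_diff u_def)
    moreover have "cos (complex_of_real (pi * real m)) = e" "sin (complex_of_real (pi * real m)) = 0"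
      unfolding cos_of_real sin_of_real by (simp_all add: e_def cos_npi2 sin_npi2)
    ultimately show ?thesis by simp
  qed
  define A where "A = 2 * (2 * of_real pi) powr (-w)"
  define B where "B = 2 * (2 * of_real pi) powr (-v)"
  have z1: "zeta (1 - 2 * of_nat m + v) = A * u * Gamma w * zeta w"
    using zeta_functional_equation[OF w] by (simp add: v_def A_def u_def)
  have z2: "zeta (1 - 2 * of_nat m + w) = B * (e * u) * Gamma v * zeta v"
    using zeta_functional_equation[OF v] by (simp add: B_def cv) (simp add: v_def algebra_simps)
  have scal: "A ^ k * 2 powr (- (of_nat k * v)) * of_real \<beta> powr (- (of_nat k * (v - of_nat m)))
     = B ^ k * 2 powr (- (of_nat k * w)) * of_real \<alpha> powr (- (of_nat k * (w - of_nat m)))"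
  proof -
    define K M la lb lp l2 where "K = complex_of_nat k" and "M = complex_of_nat m" and "la = complex_of_real (ln \<alpha>)"
      and "lb = complex_of_real (ln \<beta>)" and "lp = complex_of_real (ln pi)" and "l2 = complex_of_real (ln 2)"
    have "ln \<alpha> + ln \<beta> = ln (\<alpha> * \<beta>)" using ln_mult[of \<alpha> \<beta>] pos(1,2) by simp
    also have "\<dots> = 2 * ln pi" unfolding pos(3) by (simp add: ln_realpow)
    finally have "complex_of_real (ln \<alpha> + ln \<beta>) = of_real (2 * ln pi)" by simp
    then have ab: "lb = 2 * lp - la" by (simp add: la_def lb_def lp_def algebra_simps)
    have p2: "(2 * of_real pi) powr z = exp (z * (l2 + lp))" for z
      using powr_of_real_exp[of "2 * pi" z] by (simp add: l2_def lp_def ln_mult)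
    have two: "2 powr z = exp (z * l2)" for z using powr_of_real_exp[of 2 z] by (simp add: l2_def)
    have "A ^ k * 2 powr (- (of_nat k * v)) * of_real \<beta> powr (- (of_nat k * (v - of_nat m)))
      = 2 ^ k * exp (K * (- w * (l2 + lp)) + - (K * v) * l2 + - (K * (v - M)) * lb)"
      unfolding A_def power_mult_distrib p2 two powr_of_real_exp[OF pos(2)] lb_def[symmetric] exp_add K_def M_def exp_of_nat_mult
      by (simp only: mult.assoc)
    also have "K * (- w * (l2 + lp)) + - (K * v) * l2 + - (K * (v - M)) * lb
       = K * (- v * (l2 + lp)) + - (K * w) * l2 + - (K * (w - M)) * la"
      unfolding ab v_def M_def[symmetric] by (simp add: algebra_simps)
    also have "2 ^ k * exp \<dots> = B ^ k * 2 powr (- (of_nat k * w)) * of_real \<alpha> powr (- (of_nat k * (w - of_nat m)))"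
      unfolding B_def power_mult_distrib p2 two powr_of_real_exp[OF pos(1)] la_def[symmetric] exp_add K_def M_def exp_of_nat_mult
      by (simp only: mult.assoc)
    finally show ?thesis .
  qed
  have uk: "u ^ k = u * u ^ (k - 1)" "(e * u) ^ k = e * u * (e * u) ^ (k - 1)" using k by (cases k; simp)+
  have "mellin_integrand k m \<beta> v = (A ^ k * 2 powr (- (of_nat k * v)) * of_real \<beta> powr (- (of_nat k * (v - of_nat m))))
      * (u * u ^ (k - 1) * Gamma w ^ k * zeta w ^ k * zeta v ^ k * Gamma v ^ k * (e * u) ^ (k - 1))"
    unfolding mellin_integrand_def z1 cv power_mult_distrib[of _ _ k] uk(1) by (simp only: mult_ac)
  also have "\<dots> = (e * e) * (B ^ k * 2 powr (- (of_nat k * w)) * of_real \<alpha> powr (- (of_nat k * (w - of_nat m))))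
      * (u * u ^ (k - 1) * Gamma w ^ k * zeta w ^ k * zeta v ^ k * Gamma v ^ k * (e * u) ^ (k - 1))"
    unfolding scal e by simp
  also have "\<dots> = e * ((B * (e * u) * Gamma v * zeta v) ^ k * zeta w ^ k * Gamma w ^ k * u ^ (k - 1)
      * 2 powr (- (of_nat k * w)) * of_real \<alpha> powr (- (of_nat k * (w - of_nat m))))"
  proof -
    have "(B * (e * u) * Gamma v * zeta v) ^ k = B ^ k * (e * u * (e * u) ^ (k - 1)) * Gamma v ^ k * zeta v ^ k"
      unfolding power_mult_distrib[of "B * (e * u) * Gamma v" "zeta v"] power_mult_distrib[of "B * (e * u)" "Gamma v"]
        power_mult_distrib[of B "e * u"] uk(2) ..
    then show ?thesis by (simp only: mult_ac)
  qed
  also have "\<dots> = e * mellin_integrand k m \<alpha> w" unfolding mellin_integrand_def z2 u_def ..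
  finally show ?thesis by (simp add: v_def e_def)
qed

lemma mellin_integrand_holomorphic:
  assumes "\<gamma> > 0"
  shows "mellin_integrand k m \<gamma> holomorphic_on {w. Re w > 1} - {2 * of_nat m}"
proof -
  have "w \<noteq> 1" "1 - 2 * of_nat m + w \<noteq> 1" "w \<notin> \<int>\<^sub>\<le>\<^sub>0" if "w \<in> {w. Re w > 1} - {2 * of_nat m}" for w :: complex
    using that by (auto simp: nonpos_Ints_def algebra_simps)
  then show ?thesis unfolding mellin_integrand_def using assms by (intro holomorphic_intros) auto
qed

lemma mellin_numerator_holomorphic:
  assumes "\<gamma> > 0" "m \<ge> 1"
  shows "mellin_numerator k m \<gamma> holomorphic_on ball 0 1"
proof -
  have "w \<noteq> 1" "1 - 2 * of_nat m + w \<noteq> 1" "w + 1 \<notin> \<int>\<^sub>\<le>\<^sub>0" if "w \<in> ball 0 1" for w :: complex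
  proof -
    have "\<bar>Re w\<bar> < 1" using that abs_Re_le_cmod[of w] by simp
    then have "Re w < 1" "Re w > -1" by linarith+
    moreover have "2 * real m \<ge> 2" using assms by simp
    ultimately show "w \<noteq> 1" "1 - 2 * of_nat m + w \<noteq> 1" "w + 1 \<notin> \<int>\<^sub>\<le>\<^sub>0"
      by (auto simp: nonpos_Ints_def complex_eq_iff)
  qed
  then show ?thesis unfolding mellin_numerator_def using assms by (intro holomorphic_intros) auto
qed

lemma mellin_integrand_eq_numerator_over_power:
  assumes "w \<notin> \<int>"
  shows "mellin_integrand k m \<gamma> w = mellin_numerator k m \<gamma> w / w ^ k"
proof -
  have "w \<noteq> 0" "w \<notin> \<int>\<^sub>\<le>\<^sub>0" using assms nonpos_Ints_subset_Ints by auto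
  then have "Gamma (w + 1) ^ k = w ^ k * Gamma w ^ k" by (simp add: Gamma_plus1 power_mult_distrib)
  then show ?thesis using \<open>w \<noteq> 0\<close> unfolding mellin_integrand_def mellin_numerator_def by simp
qed

lemma mellin_integrand_decay:
  assumes k: "k \<ge> 1" and m: "m \<ge> 1" and \<gamma>: "\<gamma> > 0"
  shows "\<exists>C. \<forall>x t. real m \<le> x \<longrightarrow> x \<le> c \<longrightarrow> \<bar>t\<bar> \<ge> 1 \<longrightarrow> norm (mellin_integrand k m \<gamma> (Complex x t)) \<le> C / (1 + t\<^sup>2)"
proof -
  obtain C1 N1 where C1: "C1 > 0" and b1: "\<forall>x t. real m \<le> x \<longrightarrow> x \<le> c \<longrightarrow>
      norm (mellin_kernel k (Complex x t)) \<le> C1 * (1 + \<bar>t\<bar>) ^ N1 * exp (- pi * \<bar>t\<bar> / 2)"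
  proof -
    have "real m > 0" using m by simp
    from norm_mellin_kernel_strip_le[OF this k, of c] show ?thesis using that by blast
  qed
  obtain C2 N2 where C2: "C2 > 0" and b2: "\<forall>x t. real m \<le> x \<longrightarrow> x \<le> c \<longrightarrow> \<bar>t\<bar> \<ge> 1 \<longrightarrow>
      norm (zeta (Complex x t)) \<le> C2 * (1 + \<bar>t\<bar>) ^ N2"
    using norm_zeta_strip_le[of "real m" c] by (elim exE conjE)
  obtain C3 N3 where C3: "C3 > 0" and b3: "\<forall>x t. 1 - real m \<le> x \<longrightarrow> x \<le> c + 1 - 2 * real m \<longrightarrow> \<bar>t\<bar> \<ge> 1 \<longrightarrow>
      norm (zeta (Complex x t)) \<le> C3 * (1 + \<bar>t\<bar>) ^ N3"
    using norm_zeta_strip_le[of "1 - real m" "c + 1 - 2 * real m"] by (elim exE conjE)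
  define B where "B = \<gamma> powr (- (real k * (c - real m))) + \<gamma> powr 0"
  define N where "N = N3 * k + N2 * k + N1"
  have B: "B \<ge> 0" by (simp add: B_def)
  show ?thesis
  proof (rule exI[of _ "C3 ^ k * C2 ^ k * C1 * B * real (N + 2) ^ (N + 2)"], intro allI impI)
    fix x t :: real
    assume x: "real m \<le> x" "x \<le> c" and t: "\<bar>t\<bar> \<ge> 1"
    define w where "w = Complex x t"
    define T where "T = 1 + \<bar>t\<bar>"
    have T: "T \<ge> 0" by (simp add: T_def)
    have 1: "norm (mellin_kernel k w) \<le> C1 * T ^ N1 * exp (- pi * \<bar>t\<bar> / 2)"
      using b1 x unfolding w_def T_def by blast
    have 2: "norm (zeta w) \<le> C2 * T ^ N2" using b2 x t unfolding w_def T_def by blast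
    have shift: "1 - 2 * of_nat m + w = Complex (x + 1 - 2 * real m) t"
      by (simp add: w_def complex_eq_iff)
    have 3: "norm (zeta (1 - 2 * of_nat m + w)) \<le> C3 * T ^ N3"
      unfolding shift T_def by (rule b3[rule_format]) (use x t in auto)
    have 4: "norm (2 powr (- (of_nat k * w))) \<le> 1"
    proof -
      have "norm (2 powr (- (of_nat k * w))) = 2 powr (- (real k * x))"
        by (subst norm_powr_real_powr) (auto simp: w_def)
      also have "\<dots> \<le> 2 powr 0" using x by (intro powr_mono) auto
      finally show ?thesis by simp
    qed
    have 5: "norm (of_real \<gamma> powr (- (of_nat k * (w - of_nat m)))) \<le> B"
    proof -
      have "norm (of_real \<gamma> powr (- (of_nat k * (w - of_nat m)))) = \<gamma> powr (- (real k * (x - real m)))"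
        using \<gamma> by (subst norm_powr_real_powr) (auto simp: w_def)
      also have "\<dots> \<le> B"
        unfolding B_def using x \<gamma> by (intro norm_of_real_powr_strip_le) (auto intro!: mult_left_mono)
      finally show ?thesis .
    qed
    have "norm (mellin_integrand k m \<gamma> w) = norm (zeta (1 - 2 * of_nat m + w)) ^ k * norm (zeta w) ^ k * norm (mellin_kernel k w)
       * norm (2 powr (- (of_nat k * w))) * norm (of_real \<gamma> powr (- (of_nat k * (w - of_nat m))))"
      unfolding mellin_integrand_def mellin_kernel_def norm_mult norm_power by (simp only: mult.assoc)
    also have "\<dots> \<le> (C3 * T ^ N3) ^ k * (C2 * T ^ N2) ^ k * (C1 * T ^ N1 * exp (- pi * \<bar>t\<bar> / 2)) * 1 * B"
      using C1 C2 C3 T B by (intro mult_mono power_mono 1 2 3 4 5 mult_nonneg_nonneg) auto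
    also have "\<dots> = C3 ^ k * C2 ^ k * C1 * B * ((1 + \<bar>t\<bar>) ^ N * exp (- pi * \<bar>t\<bar> / 2))"
      unfolding N_def power_mult_distrib power_mult[symmetric] power_add T_def by (simp only: mult_ac mult_1_left)
    also have "\<dots> \<le> C3 ^ k * C2 ^ k * C1 * B * (real (N + 2) ^ (N + 2) / (1 + t\<^sup>2))"
      using C1 C2 C3 B by (intro mult_left_mono polynomial_times_exp_le) auto
    finally show "norm (mellin_integrand k m \<gamma> (Complex x t)) \<le> C3 ^ k * C2 ^ k * C1 * B * real (N + 2) ^ (N + 2) / (1 + t\<^sup>2)"
      by (simp add: w_def)
  qed
qed

text \<open>Moving the line for \<open>\<Phi>_\<gamma>\<close> from \<open>c\<close> to \<open>m\<close> crosses its pole at \<open>2m\<close>. Reflecting the plane in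
  the point \<open>m\<close> puts that pole at the origin, where the symmetry turns \<open>\<Phi>_\<gamma>\<close> into \<open>\<Phi>_\<delta>\<close>, whose
  polar part is visible from \<open>\<Gamma>(w)^k\<close>.\<close>

lemma mellin_integrand_integral_shift:
  fixes \<gamma> \<delta> :: real
  assumes k: "k \<ge> 1" and m: "m > 1" and pos: "\<gamma> > 0" "\<delta> > 0" "\<delta> * \<gamma> = pi\<^sup>2" and c: "c > 2 * real m"
  shows "(LINT t|lborel. mellin_integrand k m \<gamma> (Complex (real m) t)) - (LINT t|lborel. mellin_integrand k m \<gamma> (Complex c t))
    = 2 * of_real pi * ((-1) ^ m * ((deriv ^^ (k - 1)) (mellin_numerator k m \<delta>) 0 / fact (k - 1)))"
proof -
  define g where "g w = mellin_integrand k m \<gamma> (2 * of_nat m - w)" for w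
  have arg: "2 * of_nat m - Complex x t = Complex (2 * real m - x) (-t)" for x t
    by (simp add: complex_eq_iff)
  obtain C where C: "\<forall>x t. real m \<le> x \<longrightarrow> x \<le> c \<longrightarrow> \<bar>t\<bar> \<ge> 1 \<longrightarrow> norm (mellin_integrand k m \<gamma> (Complex x t)) \<le> C / (1 + t\<^sup>2)"
    using mellin_integrand_decay[OF k _ pos(1), of m c] m by auto
  have m2: "real m \<ge> 2" using m by linarith
  have "(LINT t|lborel. g (Complex (real m) t)) - (LINT t|lborel. g (Complex (2 * real m - c) t)) = 2 * of_real pi * residue g 0"
  proof (rule vertical_line_shift[where T = 1 and C = C and ?x0.0 = "2 * real m - c - 1" and ?x1.0 = "2 * real m - 1"])
    have "mellin_integrand k m \<gamma> \<circ> (\<lambda>w. 2 * of_nat m - w) holomorphic_on {w. 2 * real m - c - 1 < Re w \<and> Re w < 2 * real m - 1} - {0}"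
      by (rule holomorphic_on_compose_gen[OF _ mellin_integrand_holomorphic[OF pos(1)]]) (auto intro!: holomorphic_intros)
    then show "g holomorphic_on {w. 2 * real m - c - 1 < Re w \<and> Re w < 2 * real m - 1} - {0}"
      by (simp add: g_def[abs_def] o_def)
    show "norm (g (Complex x t)) \<le> C / (1 + t\<^sup>2)" if "2 * real m - c \<le> x" "x \<le> real m" "\<bar>t\<bar> \<ge> 1" for x t
    proof -
      have "norm (mellin_integrand k m \<gamma> (Complex (2 * real m - x) (-t))) \<le> C / (1 + (-t)\<^sup>2)"
        by (rule C[rule_format]) (use that in auto)
      then show ?thesis by (simp add: g_def arg)
    qed
  qed (use c m2 in auto)
  also have "(LINT t|lborel. g (Complex (real m) t)) = (LINT t|lborel. mellin_integrand k m \<gamma> (Complex (real m) t))"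
    using lborel_integral_real_affine[of "-1" "\<lambda>t. mellin_integrand k m \<gamma> (Complex (real m) t)" 0] by (simp add: g_def arg)
  also have "(LINT t|lborel. g (Complex (2 * real m - c) t)) = (LINT t|lborel. mellin_integrand k m \<gamma> (Complex c t))"
    using lborel_integral_real_affine[of "-1" "\<lambda>t. mellin_integrand k m \<gamma> (Complex c t)" 0] by (simp add: g_def arg)
  also have "residue g 0 = residue (\<lambda>w. ((-1) ^ m * mellin_numerator k m \<delta> w) / w ^ Suc (k - 1)) 0"
  proof (rule residue_cong)
    have "\<forall>\<^sub>F w in at 0. w \<in> ball 0 1 - {0::complex}"
      by (intro eventually_at_in_open) auto
    then show "\<forall>\<^sub>F w in at 0. g w = ((-1) ^ m * mellin_numerator k m \<delta> w) / w ^ Suc (k - 1)"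
    proof eventually_elim
      case (elim w)
      have "w \<notin> \<int>"
      proof
        assume "w \<in> \<int>"
        then obtain n where "w = of_int n" by (auto simp: Ints_def)
        then show False using elim by (auto simp: norm_of_int)
      qed
      then have "g w = (-1) ^ m * (mellin_numerator k m \<delta> w / w ^ k)"
        unfolding g_def using mellin_integrand_reflection[OF pos(2,1,3) k] mellin_integrand_eq_numerator_over_power by simp
      then show ?case using k by simp
    qed
  qed simp
  also have "\<dots> = (deriv ^^ (k - 1)) (\<lambda>w. (-1) ^ m * mellin_numerator k m \<delta> w) 0 / fact (k - 1)"
    by (rule residue_holomorphic_over_power'[where A = "ball 0 1"])
       (use mellin_numerator_holomorphic[OF pos(2), of m k] m in \<open>auto intro!: holomorphic_intros\<close>)
  also have "(deriv ^^ (k - 1)) (\<lambda>w. (-1) ^ m * mellin_numerator k m \<delta> w) 0 = (-1) ^ m * (deriv ^^ (k - 1)) (mellin_numerator k m \<delta>) 0"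
    by (rule higher_deriv_cmult[where A = "ball 0 1"]) (use mellin_numerator_holomorphic[OF pos(2), of m k] m in auto)
  finally show ?thesis by simp
qed

lemma mellin_integrand_central_line:
  fixes \<alpha> \<beta> :: real
  assumes pos: "\<alpha> > 0" "\<beta> > 0" "\<alpha> * \<beta> = pi\<^sup>2" and k: "k \<ge> 1" and m: "m > 1"
  shows "(LINT t|lborel. mellin_integrand k m \<beta> (Complex (real m) t)) = (-1) ^ m * (LINT t|lborel. mellin_integrand k m \<alpha> (Complex (real m) t))"
proof -
  have meas: "(\<lambda>t. mellin_integrand k m \<gamma> (Complex (real m) t)) \<in> borel_measurable borel" if "\<gamma> > 0" for \<gamma>
    by (intro borel_measurable_continuous_onI
        continuous_on_vertical_line[OF holomorphic_on_imp_continuous_on[OF mellin_integrand_holomorphic[OF that]]])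
       (use m in \<open>auto simp: complex_eq_iff\<close>)
  have "(LINT t|lborel. mellin_integrand k m \<beta> (Complex (real m) t)) = (LINT t|lborel. mellin_integrand k m \<beta> (Complex (real m) (0 + (-1) * t)))"
    using lborel_integral_real_affine[of "-1" "\<lambda>t. mellin_integrand k m \<beta> (Complex (real m) t)" 0] by simp
  also have "\<dots> = (LINT t|lborel. (-1) ^ m * mellin_integrand k m \<alpha> (Complex (real m) t))"
  proof (rule integral_cong_AE)
    show "AE t in lborel. mellin_integrand k m \<beta> (Complex (real m) (0 + (-1) * t)) = (-1) ^ m * mellin_integrand k m \<alpha> (Complex (real m) t)"
      using AE_lborel_singleton[of 0]
    proof eventually_elim
      case (elim t)
      \<comment> \<open>The symmetry is known off the integers, hence everywhere on the line except at \<open>t = 0\<close>.\<close>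
      have "Complex (real m) t \<notin> \<int>" using elim by (auto simp: Ints_def complex_eq_iff)
      moreover have "2 * of_nat m - Complex (real m) t = Complex (real m) (0 + (-1) * t)"
        by (simp add: complex_eq_iff)
      ultimately show ?case using mellin_integrand_reflection[OF pos k, of "Complex (real m) t" m] by simp
    qed
    show "(\<lambda>t. mellin_integrand k m \<beta> (Complex (real m) (0 + (-1) * t))) \<in> borel_measurable lborel"
      by (rule measurable_compose[OF _ meas[OF pos(2)]]) simp
    show "(\<lambda>t. (-1) ^ m * mellin_integrand k m \<alpha> (Complex (real m) t)) \<in> borel_measurable lborel"
      using meas[OF pos(1)] by simp
  qed
  finally show ?thesis by simp
qed

section \<open>The transformation formula\<close>

theorem corollary1p4:
  fixes k m :: nat and \<alpha> \<beta> \<mu> :: real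
  assumes "k \<ge> 1" and "m > 1"
    and "\<alpha> > 0" and "\<beta> > 0" and "\<alpha> * \<beta> = pi^2"
    and "\<mu> < 0"
  defines "S \<equiv> (\<lambda>\<gamma> n. of_nat (piltz k (Suc n)) * of_nat (Suc n) ^ (2 * m - 1) *
                       Psi \<mu> ((2 * \<gamma>) ^ k) k (real (Suc n)))"
  shows "summable (S \<alpha>) \<and> summable (S \<beta>) \<and>
    of_real ((\<alpha> ^ k) ^ m) * (\<Sum>n. S \<alpha> n) - of_real ((- (\<beta> ^ k)) ^ m) * (\<Sum>n. S \<beta> n) =
    1 / fact (k - 1) *
    (deriv ^^ (k - 1))
      (\<lambda>s :: complex.
         zeta (1 - 2 * of_nat m + s) ^ k * zeta s ^ k * Gamma (s + 1) ^ k *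
         cos (of_real pi * s / 2) ^ (k - 1) * 2 powr (- (of_nat k * s)) *
         (of_real \<alpha> powr (- (of_nat k * (s - of_nat m))) -
          (-1) ^ m * of_real \<beta> powr (- (of_nat k * (s - of_nat m))))) 0"
proof -
  \<comment> \<open>Any line to the right of \<open>2m\<close> serves.\<close>
  define c where "c = 2 * real m + 1"
  define J where "J \<gamma> x = (LINT t|lborel. mellin_integrand k m \<gamma> (Complex x t))" for \<gamma> x
  define R where "R \<gamma> = (deriv ^^ (k - 1)) (mellin_numerator k m \<gamma>) 0 / fact (k - 1)" for \<gamma>
  define e :: complex where "e = (-1) ^ m"
  have ee: "e * e = 1" by (simp add: e_def flip: power_mult_distrib)
  have ba: "\<beta> * \<alpha> = pi\<^sup>2" using assms(5) by (simp add: mult.commute)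
  have S_sums: "(\<lambda>n. of_real ((\<gamma> ^ k) ^ m) * S \<gamma> n) sums (J \<gamma> c / (2 * of_real pi))" if "\<gamma> > 0" for \<gamma>
    unfolding S_def J_def using assms that by (intro Psi_series_sums) (auto simp: c_def)
  have S: "summable (S \<gamma>)" "of_real ((\<gamma> ^ k) ^ m) * (\<Sum>n. S \<gamma> n) = J \<gamma> c / (2 * of_real pi)" if "\<gamma> > 0" for \<gamma>
  proof -
    define q where "q = complex_of_real ((\<gamma> ^ k) ^ m)"
    have q: "q \<noteq> 0" using that by (simp add: q_def)
    have "(\<lambda>n. q * S \<gamma> n / q) sums (J \<gamma> c / (2 * of_real pi) / q)"
      unfolding q_def by (intro sums_divide S_sums that)
    then have *: "S \<gamma> sums (J \<gamma> c / (2 * of_real pi) / q)" using q by simp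
    then show "summable (S \<gamma>)" by (rule sums_summable)
    show "of_real ((\<gamma> ^ k) ^ m) * (\<Sum>n. S \<gamma> n) = J \<gamma> c / (2 * of_real pi)"
      unfolding q_def[symmetric] sums_unique[OF *, symmetric] using q by simp
  qed
  have shift\<alpha>: "J \<alpha> (real m) - J \<alpha> c = 2 * of_real pi * (e * R \<beta>)"
    unfolding J_def e_def R_def using assms ba by (intro mellin_integrand_integral_shift) (auto simp: c_def)
  have shift\<beta>: "J \<beta> (real m) - J \<beta> c = 2 * of_real pi * (e * R \<alpha>)"
    unfolding J_def e_def R_def using assms by (intro mellin_integrand_integral_shift) (auto simp: c_def)
  have line: "J \<beta> (real m) = e * J \<alpha> (real m)"
    unfolding J_def e_def using assms by (intro mellin_integrand_central_line) auto
  \<comment> \<open>The terms \<open>J m\<close> cancel because \<open>e * e = 1\<close>.\<close>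
  have "J \<alpha> c - e * J \<beta> c = 2 * of_real pi * ((e * e) * R \<alpha> - e * R \<beta>) + (1 - e * e) * J \<alpha> (real m)"
    using shift\<alpha> shift\<beta> line by algebra
  then have main: "J \<alpha> c / (2 * of_real pi) - e * (J \<beta> c / (2 * of_real pi)) = R \<alpha> - e * R \<beta>"
    unfolding ee by (simp add: field_simps)
  have holo: "mellin_numerator k m \<gamma> holomorphic_on ball 0 1" if "\<gamma> > 0" for \<gamma>
    using that assms by (intro mellin_numerator_holomorphic) auto
  have "R \<alpha> - e * R \<beta> = 1 / fact (k - 1) * ((deriv ^^ (k - 1)) (mellin_numerator k m \<alpha>) 0 - e * (deriv ^^ (k - 1)) (mellin_numerator k m \<beta>) 0)"
    by (simp add: R_def diff_divide_distrib)
  also have "e * (deriv ^^ (k - 1)) (mellin_numerator k m \<beta>) 0 = (deriv ^^ (k - 1)) (\<lambda>s. e * mellin_numerator k m \<beta> s) 0"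
    by (rule higher_deriv_cmult[symmetric, OF holo[OF assms(4)]]) auto
  also have "(deriv ^^ (k - 1)) (mellin_numerator k m \<alpha>) 0 - \<dots>
      = (deriv ^^ (k - 1)) (\<lambda>s. mellin_numerator k m \<alpha> s - e * mellin_numerator k m \<beta> s) 0"
    by (rule higher_deriv_diff[symmetric, where S = "ball 0 1"])
       (use holo[OF assms(3)] holo[OF assms(4)] in \<open>auto intro!: holomorphic_intros\<close>)
  also have "(\<lambda>s. mellin_numerator k m \<alpha> s - e * mellin_numerator k m \<beta> s) =
      (\<lambda>s :: complex.
         zeta (1 - 2 * of_nat m + s) ^ k * zeta s ^ k * Gamma (s + 1) ^ k *
         cos (of_real pi * s / 2) ^ (k - 1) * 2 powr (- (of_nat k * s)) *
         (of_real \<alpha> powr (- (of_nat k * (s - of_nat m))) -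
          (-1) ^ m * of_real \<beta> powr (- (of_nat k * (s - of_nat m)))))"
    unfolding mellin_numerator_def e_def by (simp only: right_diff_distrib mult_ac)
  finally have R: "R \<alpha> - e * R \<beta> = 1 / fact (k - 1) *
    (deriv ^^ (k - 1))
      (\<lambda>s :: complex.
         zeta (1 - 2 * of_nat m + s) ^ k * zeta s ^ k * Gamma (s + 1) ^ k *
         cos (of_real pi * s / 2) ^ (k - 1) * 2 powr (- (of_nat k * s)) *
         (of_real \<alpha> powr (- (of_nat k * (s - of_nat m))) -
          (-1) ^ m * of_real \<beta> powr (- (of_nat k * (s - of_nat m))))) 0" .
  have "complex_of_real ((- (\<beta> ^ k)) ^ m) = e * of_real ((\<beta> ^ k) ^ m)"
    unfolding e_def power_minus[of "\<beta> ^ k"] by simp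
  then have "of_real ((\<alpha> ^ k) ^ m) * (\<Sum>n. S \<alpha> n) - of_real ((- (\<beta> ^ k)) ^ m) * (\<Sum>n. S \<beta> n) = R \<alpha> - e * R \<beta>"
    using main S(2)[OF assms(3)] S(2)[OF assms(4)] by (simp only: mult.assoc)
  then show ?thesis using S(1)[OF assms(3)] S(1)[OF assms(4)] unfolding R by blast
qed

end
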